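(* Let $\Xi$ be a subset of $(0,1]$ that is closed with respect to the relative topology of $(0,1]$. Then there exists a solution $\mathbb{F}$ of the frozen percolation equation for the set of possible freezing times $\Xi$. This solution can be chosen so that it is stationary, adapted, and respects the tree structure. Subject to these additional conditions (stationary, adapted, respecting the tree structure), the joint law of $\Omega$ and $\mathbb{F}$ is uniquely determined.
   Context: Let $\mathbb{T}$ be the set of all finite words $\mathbf{i}=i_1\cdots i_n$ ($n\ge 0$) over the alphabet $\{1,2\}$, with root $\varnothing$ (the empty word); $\mathbf{i}\mathbf{j}$ denotes concatenation, and the parent of $\mathbf{i}=i_1\cdots i_n$ ($n\ge1$) is $i_1\cdots i_{n-1}$. A rooted subtree is a set $\mathbb{U}\subset\mathbb{T}$ that contains the parent of each of its elements other than $\varnothing$. Its boundary $\partial\mathbb{U}$ is the set of all $\mathbf{i}\in\mathbb{T}\setminus\mathbb{U}$ whose parent lies in $\mathbb{U}$, with the convention $\partial\emptyset=\{\varnothing\}$. Let $\omega_{\mathbf{i}}=(\tau_{\mathbf{i}},\kappa_{\mathbf{i}})$, $\mathbf{i}\in\mathbb{T}$, be i.i.d. uniformly distributed on $[0,1]\times\{1,2\}$. Put $\Omega:=(\omega_{\mathbf{i}})_{\mathbf{i}\in\mathbb{T}}$, $\Omega_{\mathbf{j}}:=(\omega_{\mathbf{j}\mathbf{i}})_{\mathbf{i}\in\mathbb{T}}$, $\mathbb{I}:=\{\mathbf{i}:\kappa_{\mathbf{i}}=1\}$, $\mathbb{B}:=\{\mathbf{i}:\kappa_{\mathbf{i}}=2\}$,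 and $\mathbb{T}^t:=\{\mathbf{i}\in\mathbb{I}:\tau_{\mathbf{i}}\le t\}\cup\mathbb{B}$ for $0\le t\le1$. For $\mathbf{i}\in\mathbb{T}$ and $A\subset\mathbb{T}$, write $\mathbf{i}\overset{A}{\longrightarrow}\infty$ if there is a sequence $(j_k)_{k\ge1}$ in $\{1,2\}$ such that $j_{k+1}\le\kappa_{\mathbf{i}j_1\cdots j_k}$ and $\mathbf{i}j_1\cdots j_k\in A$ for all $k\ge0$. A random subset $\mathbb{F}\subset\mathbb{T}$ (defined on a probability space carrying $\Omega$, which may be larger than the one generated by $\Omega$) solves the frozen percolation equation for the set of possible freezing times $\Xi$ if (almost surely), for every $\mathbf{i}\in\mathbb{T}$: $\mathbf{i}\in\mathbb{F}$ if and only if $\kappa_{\mathbf{i}}=1$ and $\mathbf{i}1\overset{\mathbb{T}^t\setminus\mathbb{F}}{\longrightarrow}\infty$ for some $t\in\Xi\cap(0,\tau_{\mathbf{i}}]$. Let $\mathbb{F}_{\mathbf{j}}:=\{\mathbf{i}\in\mathbb{T}:\mathbf{j}\mathbf{i}\in\mathbb{F}\}$. A solution $\mathbb{F}$ is: stationary if the law of $(\Omega_{\mathbf{j}},\mathbb{F}_{\mathbf{j}})$ does not depend on $\mathbf{j}\in\mathbb{T}$; adapted if for each finite rooted subtree $\mathbb{U}$, $(\Omega_{\mathbf{j}},\mathbb{F}_{\mathbf{j}})_{\mathbf{j}\in\partial\mathbb{U}}$ is independent of $(\omega_{\mathbf{i}})_{\mathbf{i}\in\mathbb{U}}$; and it respects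 the tree structure if for each finite rooted subtree $\mathbb{U}$, $(\Omega_{\mathbf{j}},\mathbb{F}_{\mathbf{j}})_{\mathbf{j}\in\partial\mathbb{U}}$ is a collection of independent random variables. *)

theory Defs
  imports "HOL-Probability.Probability"
begin

definition words :: "nat list set" where
  "words = lists {1, 2}"

text \<open>For a nonempty word \<^term>\<open>i\<close>, its parent is \<^term>\<open>butlast i\<close>.\<close>

definition rooted_subtree :: "nat list set \<Rightarrow> bool" where
  "rooted_subtree U \<longleftrightarrow> U \<subseteq> words \<and> (\<forall>i\<in>U. i \<noteq> [] \<longrightarrow> butlast i \<in> U)"

definition boundary :: "nat list set \<Rightarrow> nat list set" where
  "boundary U = (if U = {} then {[]} else {i \<in> words - U. i \<noteq> [] \<and> butlast i \<in> U})"


subsection \<open>The frozen percolation equation for deterministic marks\<close>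

text \<open>
  A family of marks is a function \<^term>\<open>w\<close> with \<^term>\<open>w i = (\<tau>, \<kappa>)\<close>, the time and the
  type of the word \<^term>\<open>i\<close>.
\<close>

type_synonym marks = "nat list \<Rightarrow> real \<times> nat"

definition open_words :: "marks \<Rightarrow> real \<Rightarrow> nat list set" where
  "open_words w t = {i \<in> words. snd (w i) = 1 \<and> fst (w i) \<le> t} \<union> {i \<in> words. snd (w i) = 2}"

text \<open>
  The sequence \<^term>\<open>j\<close> is indexed from 1 (the value \<^term>\<open>j 0\<close> is irrelevant), and
  \<^term>\<open>map j [1..<Suc k]\<close> is the word with letters \<^term>\<open>j 1\<close> to \<^term>\<open>j k\<close>.
\<close>

definition percolates :: "marks \<Rightarrow> nat list set \<Rightarrow> nat list \<Rightarrow> bool" where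
  "percolates w A i \<longleftrightarrow>
     (\<exists>j :: nat \<Rightarrow> nat. (\<forall>k\<ge>1. j k \<in> {1, 2}) \<and>
        (\<forall>k. j (Suc k) \<le> snd (w (i @ map j [1..<Suc k])) \<and> i @ map j [1..<Suc k] \<in> A))"

definition frozen_equation :: "real set \<Rightarrow> marks \<Rightarrow> nat list set \<Rightarrow> bool" where
  "frozen_equation \<Xi> w F \<longleftrightarrow>
     (\<forall>i\<in>words. i \<in> F \<longleftrightarrow>
        snd (w i) = 1 \<and> (\<exists>t \<in> \<Xi> \<inter> {0<..fst (w i)}. percolates w (open_words w t - F) (i @ [1])))"


subsection \<open>Random marks and random sets of words\<close>

definition mark_space :: "(real \<times> nat) measure" where
  "mark_space = borel \<Otimes>\<^sub>M count_space {1, 2}"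

definition mark_law :: "(real \<times> nat) measure" where
  "mark_law = uniform_measure lborel {0..1} \<Otimes>\<^sub>M uniform_count_measure {1, 2}"

definition iid_uniform_marks :: "'a measure \<Rightarrow> (nat list \<Rightarrow> 'a \<Rightarrow> real \<times> nat) \<Rightarrow> bool" where
  "iid_uniform_marks M \<omega> \<longleftrightarrow>
     prob_space M \<and>
     prob_space.indep_vars M (\<lambda>_. mark_space) \<omega> words \<and>
     (\<forall>i\<in>words. distr M mark_space (\<omega> i) = mark_law)"

definition random_words :: "'a measure \<Rightarrow> ('a \<Rightarrow> nat list set) \<Rightarrow> bool" where
  "random_words M F \<longleftrightarrow>
     (\<forall>x\<in>space M. F x \<subseteq> words) \<and> (\<forall>i\<in>words. {x \<in> space M. i \<in> F x} \<in> sets M)"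

definition frozen_solution ::
    "real set \<Rightarrow> 'a measure \<Rightarrow> (nat list \<Rightarrow> 'a \<Rightarrow> real \<times> nat) \<Rightarrow> ('a \<Rightarrow> nat list set) \<Rightarrow> bool" where
  "frozen_solution \<Xi> M \<omega> F \<longleftrightarrow>
     iid_uniform_marks M \<omega> \<and> random_words M F \<and>
     (AE x in M. frozen_equation \<Xi> (\<lambda>i. \<omega> i x) (F x))"

text \<open>
  The state space of a family of marks together with a set of words, the latter
  identified with its indicator function; both carry the product sigma-algebra.
\<close>

definition tree_space :: "((nat list \<Rightarrow> real \<times> nat) \<times> (nat list \<Rightarrow> bool)) measure" where
  "tree_space = (\<Pi>\<^sub>M i\<in>words. mark_space) \<Otimes>\<^sub>M (\<Pi>\<^sub>M i\<in>words. count_space UNIV)"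

text \<open>
  The marks and the random set as seen from the word \<^term>\<open>j\<close>. The restriction of the
  functions to \<^term>\<open>words\<close> is what membership in the product spaces requires.
\<close>

definition tree_at ::
    "(nat list \<Rightarrow> 'a \<Rightarrow> real \<times> nat) \<Rightarrow> ('a \<Rightarrow> nat list set) \<Rightarrow> nat list \<Rightarrow> 'a
      \<Rightarrow> (nat list \<Rightarrow> real \<times> nat) \<times> (nat list \<Rightarrow> bool)" where
  "tree_at \<omega> F j x = ((\<lambda>i\<in>words. \<omega> (j @ i) x), (\<lambda>i\<in>words. j @ i \<in> F x))"

definition law_at ::
    "'a measure \<Rightarrow> (nat list \<Rightarrow> 'a \<Rightarrow> real \<times> nat) \<Rightarrow> ('a \<Rightarrow> nat list set) \<Rightarrow> nat list
      \<Rightarrow> ((nat list \<Rightarrow> real \<times> nat) \<times> (nat list \<Rightarrow> bool)) measure" where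
  "law_at M \<omega> F j = distr M tree_space (tree_at \<omega> F j)"

abbreviation joint_law ::
    "'a measure \<Rightarrow> (nat list \<Rightarrow> 'a \<Rightarrow> real \<times> nat) \<Rightarrow> ('a \<Rightarrow> nat list set)
      \<Rightarrow> ((nat list \<Rightarrow> real \<times> nat) \<times> (nat list \<Rightarrow> bool)) measure" where
  "joint_law M \<omega> F \<equiv> law_at M \<omega> F []"

definition stationary ::
    "'a measure \<Rightarrow> (nat list \<Rightarrow> 'a \<Rightarrow> real \<times> nat) \<Rightarrow> ('a \<Rightarrow> nat list set) \<Rightarrow> bool" where
  "stationary M \<omega> F \<longleftrightarrow> (\<forall>j\<in>words. \<forall>j'\<in>words. law_at M \<omega> F j = law_at M \<omega> F j')"

text \<open>
  Independence of two random variables whose value types may differ: the right-hand side is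
  that of the lemma \<open>prob_space.indep_var_eq\<close>, but the library constant
  \<open>prob_space.indep_var\<close> requires both variables to have values in one type.
\<close>

definition independent_pair ::
    "'a measure \<Rightarrow> 'b measure \<Rightarrow> ('a \<Rightarrow> 'b) \<Rightarrow> 'c measure \<Rightarrow> ('a \<Rightarrow> 'c) \<Rightarrow> bool" where
  "independent_pair M S X T Y \<longleftrightarrow>
     X \<in> measurable M S \<and> Y \<in> measurable M T \<and>
     prob_space.indep_set M
       (sigma_sets (space M) {X -` A \<inter> space M | A. A \<in> sets S})
       (sigma_sets (space M) {Y -` A \<inter> space M | A. A \<in> sets T})"

definition adapted ::
    "'a measure \<Rightarrow> (nat list \<Rightarrow> 'a \<Rightarrow> real \<times> nat) \<Rightarrow> ('a \<Rightarrow> nat list set) \<Rightarrow> bool" where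
  "adapted M \<omega> F \<longleftrightarrow>
     (\<forall>U. finite U \<and> rooted_subtree U \<longrightarrow>
        independent_pair M
          (\<Pi>\<^sub>M j\<in>boundary U. tree_space) (\<lambda>x. \<lambda>j\<in>boundary U. tree_at \<omega> F j x)
          (\<Pi>\<^sub>M i\<in>U. mark_space) (\<lambda>x. \<lambda>i\<in>U. \<omega> i x))"

definition respects_tree ::
    "'a measure \<Rightarrow> (nat list \<Rightarrow> 'a \<Rightarrow> real \<times> nat) \<Rightarrow> ('a \<Rightarrow> nat list set) \<Rightarrow> bool" where
  "respects_tree M \<omega> F \<longleftrightarrow>
     (\<forall>U. finite U \<and> rooted_subtree U \<longrightarrow>
        prob_space.indep_vars M (\<lambda>_. tree_space) (tree_at \<omega> F) (boundary U))"

text \<open>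
  A point of this type is a triple of reals at each word: room for a time, a type and an
  additional source of randomness. Since the law of the marks together with the random set
  lives on a standard Borel space, asserting existence on a probability space over this type
  is no more than asserting it on some probability space; the measure and its sigma-algebra
  are not prescribed.
\<close>

type_synonym sample_point = "nat list \<Rightarrow> real \<times> real \<times> real"

end

theory Submission
  imports Defs
begin

text \<open>
  Let \<open>Y i\<close> be the first time \<open>t \<in> \<Xi>\<close> at which the word \<open>i\<close> percolates in the open unfrozen
  words. It satisfies a recursion along the tree: a word of type 2 takes the minimum of the values
  of its children, while a word of type 1 inherits the value of its first child unless this is at
  most \<open>\<tau> i\<close>, in which case the word freezes. Under stationarity, adaptedness and independence
  the distribution function \<open>G\<close> of \<open>Y\<close> therefore satisfies
  \<open>(G t)\<^sup>2 = \<integral> s dG(s)\<close> over \<open>[0, t]\<close>. Given \<open>Y > t\<close>, the open unfrozen cluster of a word is a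
  branching process with mean offspring \<open>1 + t / 2 - G t\<close>, so for \<open>t \<in> \<Xi>\<close> it dies out, as it
  must, if and only if \<open>G t \<ge> t / 2\<close>. Together with the support condition these properties
  determine \<open>G\<close>: a difference of two solutions at some time reappears at a time earlier by at
  least twice that difference. Existence of \<open>G\<close> follows by reflection for finite \<open>\<Xi>\<close> and Helly
  selection in general.

  The law of \<open>Y\<close> and the recursion determine the law of the marks together with all \<open>Y i\<close>, and
  hence that of the frozen words. Conversely, Kolmogorov extension gives a tree of marks and times
  that satisfies the recursion, and freezing the words of type 1 with \<open>Y (i1) \<le> \<tau> i\<close> yields the
  solution.
\<close>

subsection \<open>Distribution functions of burning times\<close>

text \<open>The recursion for the burning times cannot be solved from the leaves upwards, since the
  tree has none. The times are therefore carried as additional random coordinates, and only their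
  joint law with the marks is pinned down. The integral equation balances the two types. A time in
  \<open>[0, t]\<close> arises with type 1 from a first child with
  \<open>\<tau> < Y \<le> t\<close>, which contributes half the integral of \<open>s dG(s)\<close>,
  or with type 2 from the earlier of two children, which contributes
  \<open>G t - (G t)\<^sup>2 / 2\<close>. The total is \<open>G t\<close>, so the linear terms
  cancel. This equation alone leaves much freedom, the zero function being a solution; the bound at
  the freezing times is what selects. Its constant comes from the mean offspring: a word of type 1
  keeps its child with probability \<open>t\<close> and so contributes \<open>t / 2\<close>, while
  type 2 contributes two children with probability 1/2, weighted by \<open>1 - G t\<close> because
  the sibling must outlast \<open>t\<close> as well. At \<open>G t = t / 2\<close> the process is
  critical and still dies out, so the bound is not strict and survives limits.\<close>

text \<open>
  The third clause is the integral equation for \<^term>\<open>G\<close>, in a form that passes to pointwise limits.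
\<close>

definition frozen_cdf :: "real set \<Rightarrow> (real \<Rightarrow> real) \<Rightarrow> bool" where
  "frozen_cdf \<Xi> G \<longleftrightarrow> mono G \<and> (\<forall>t\<le>0. G t = 0) \<and>
     (\<forall>u t. 0 \<le> u \<longrightarrow> u \<le> t \<longrightarrow>
        u * (G t - G u) \<le> (G t)\<^sup>2 - (G u)\<^sup>2 \<and> (G t)\<^sup>2 - (G u)\<^sup>2 \<le> t * (G t - G u)) \<and>
     (\<forall>t\<in>\<Xi>. t / 2 \<le> G t) \<and>
     (\<forall>u t. 0 \<le> u \<longrightarrow> u \<le> t \<longrightarrow> {u<..t} \<inter> \<Xi> = {} \<longrightarrow> G u = G t)"

lemma frozen_cdfD:
  assumes "frozen_cdf \<Xi> G"
  shows "x \<le> y \<Longrightarrow> G x \<le> G y"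
    and "t \<le> 0 \<Longrightarrow> G t = 0"
    and "0 \<le> u \<Longrightarrow> u \<le> t \<Longrightarrow> u * (G t - G u) \<le> (G t)\<^sup>2 - (G u)\<^sup>2"
    and "0 \<le> u \<Longrightarrow> u \<le> t \<Longrightarrow> (G t)\<^sup>2 - (G u)\<^sup>2 \<le> t * (G t - G u)"
    and "t \<in> \<Xi> \<Longrightarrow> t / 2 \<le> G t"
    and "0 \<le> u \<Longrightarrow> u \<le> t \<Longrightarrow> {u<..t} \<inter> \<Xi> = {} \<Longrightarrow> G u = G t"
  using assms unfolding frozen_cdf_def mono_def by blast+

lemma frozen_cdfI:
  assumes "\<And>x y. x \<le> y \<Longrightarrow> G x \<le> G y"
    and "\<And>t. t \<le> 0 \<Longrightarrow> G t = 0"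
    and "\<And>u t. 0 \<le> u \<Longrightarrow> u \<le> t \<Longrightarrow> u * (G t - G u) \<le> (G t)\<^sup>2 - (G u)\<^sup>2"
    and "\<And>u t. 0 \<le> u \<Longrightarrow> u \<le> t \<Longrightarrow> (G t)\<^sup>2 - (G u)\<^sup>2 \<le> t * (G t - G u)"
    and "\<And>t. t \<in> \<Xi> \<Longrightarrow> t / 2 \<le> G t"
    and "\<And>u t. 0 \<le> u \<Longrightarrow> u \<le> t \<Longrightarrow> {u<..t} \<inter> \<Xi> = {} \<Longrightarrow> G u = G t"
  shows "frozen_cdf \<Xi> G"
  using assms unfolding frozen_cdf_def mono_def by blast

section \<open>Uniqueness of the distribution function\<close>

text \<open>The difference of squares factors and the positive increment cancels. Letting
  \<open>u\<close> and \<open>t\<close> close in on an atom \<open>s\<close>, the values of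
  \<open>G\<close> before and after the jump must add up to \<open>s\<close>.\<close>

lemma frozen_cdf_sum_bounds:
  assumes "frozen_cdf \<Xi> G" "0 \<le> u" "u \<le> t" "G u \<noteq> G t"
  shows "u \<le> G t + G u" "G t + G u \<le> t"
proof -
  have lt: "G u < G t"
    using frozen_cdfD(1)[OF assms(1,3)] assms(4) by simp
  have "u * (G t - G u) \<le> (G t + G u) * (G t - G u)" "(G t + G u) * (G t - G u) \<le> t * (G t - G u)"
    using frozen_cdfD(3,4)[OF assms(1-3)] by (simp_all add: power2_eq_square algebra_simps)
  then show "u \<le> G t + G u" "G t + G u \<le> t"
    using lt by (auto simp: mult_le_cancel_right)
qed

text \<open>The point 0 is the only limit of the half-open interval that relative closedness does
  not control. Adjoining it yields a closed set, in which extremal times can be chosen.\<close>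

lemma closed_insert_zero:
  fixes \<Xi> :: "real set"
  assumes "\<Xi> \<subseteq> {0<..1}" "closedin (top_of_set {0<..1}) \<Xi>"
  shows "closed (insert 0 \<Xi>)"
proof -
  obtain T where T: "closed T" "\<Xi> = {0<..1} \<inter> T"
    using assms(2) by (auto simp: closedin_closed)
  have "insert 0 \<Xi> = {0} \<union> ({0..1} \<inter> T)"
    using T(2) by (cases "0 \<in> T") (auto simp: less_le)
  moreover have "closed ({0} \<union> ({0..1} \<inter> T))"
    using T(1) by (intro closed_Un closed_Int) auto
  ultimately show ?thesis by simp
qed

text \<open>Reduces an arbitrary time to one in \<open>insert 0 \<Xi>\<close>: a function that is
  constant on gaps of \<open>\<Xi>\<close> has the same value at \<open>s\<close> as at
  \<open>t\<close>.\<close>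

lemma last_freezing_time:
  fixes \<Xi> :: "real set"
  assumes "closed (insert 0 \<Xi>)" "0 \<le> t"
  obtains s where "s \<in> insert 0 \<Xi>" "s \<le> t" "\<And>r. r \<in> \<Xi> \<Longrightarrow> r \<le> t \<Longrightarrow> r \<le> s"
proof -
  let ?A = "insert 0 \<Xi> \<inter> {0..t}"
  have "compact ?A" using assms by (intro closed_Int_compact) auto
  moreover have "?A \<noteq> {}" using assms by auto
  ultimately obtain s where "s \<in> ?A" "\<forall>r\<in>?A. r \<le> s" using compact_attains_sup by blast
  then show thesis using that[of s] by (force simp: not_le)
qed

text \<open>
  Where a cdf exceeds half the time it is locally constant to the left, except for a jump from
  \<^term>\<open>s / 2 - c\<close> to \<^term>\<open>s / 2 + c\<close>, which forces a gap of length \<^term>\<open>2 * c\<close> in the set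
  of freezing times.
\<close>

lemma frozen_cdf_gap:
  assumes \<Xi>: "\<Xi> \<subseteq> {0<..1}" and G: "frozen_cdf \<Xi> G"
    and "t / 2 + \<eta> \<le> G t" "u \<in> insert 0 \<Xi>" "u < t" "G u \<noteq> G t"
  shows "u \<le> t - 2 * \<eta>"
proof -
  have "0 \<le> u" using assms by auto
  have "u / 2 \<le> G u" using frozen_cdfD(2,5)[OF G, of u] assms(4) by auto
  moreover have "G t + G u \<le> t"
    using frozen_cdf_sum_bounds[OF G \<open>0 \<le> u\<close>] assms by auto
  ultimately show ?thesis using assms by linarith
qed

text \<open>Since \<open>H t \<ge> t / 2\<close>, the value \<open>G t\<close> exceeds
  \<open>t / 2\<close> by at least \<open>\<eta>\<close>. Following the level \<open>G t\<close> to
  the left leads to a freezing time at which \<open>G\<close> jumps by reflection. There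
  \<open>H\<close>, being lower by \<open>\<eta>\<close>, either jumps by reflection as well or not
  at all, and in both cases it lies above \<open>G\<close> before the jump.\<close>

lemma frozen_cdf_descent:
  assumes \<Xi>: "\<Xi> \<subseteq> {0<..1}" "closed (insert 0 \<Xi>)"
    and G: "frozen_cdf \<Xi> G" and H: "frozen_cdf \<Xi> H"
    and t: "t \<in> insert 0 \<Xi>" and d: "\<eta> \<le> G t - H t" "0 < \<eta>"
  obtains s where "s \<in> insert 0 \<Xi>" "s \<le> t - 2 * \<eta>" "\<eta> \<le> H s - G s"
proof -
  have zero: "G 0 = 0" "H 0 = 0" using frozen_cdfD(2)[OF G] frozen_cdfD(2)[OF H] by auto
  have monoG: "G a \<le> G b" and monoH: "H a \<le> H b" if "a \<le> b" for a b
    using frozen_cdfD(1)[OF G that] frozen_cdfD(1)[OF H that] by auto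
  have t': "t \<in> \<Xi>" "0 < t" using t d zero \<Xi> by auto
  have half: "u / 2 \<le> H u" "u / 2 \<le> G u" if "u \<in> insert 0 \<Xi>" for u
    using that zero frozen_cdfD(5)[OF G, of u] frozen_cdfD(5)[OF H, of u] by auto
  have Gt: "t / 2 + \<eta> \<le> G t" using half[OF t] d by linarith
  define S where "S = {u \<in> insert 0 \<Xi>. u \<le> t \<and> G u = G t}"
  define s where "s = Inf S"
  have S0: "0 \<le> u" if "u \<in> S" for u using that \<Xi>(1) by (auto simp: S_def)
  then have bdd: "bdd_below S" by (meson bdd_below.I)
  have "t \<in> S" using t by (simp add: S_def)
  have sle: "s \<le> u" if "u \<in> S" for u using that bdd by (simp add: s_def cInf_lower)
  have "s \<in> closure S"
    using bdd \<open>t \<in> S\<close> unfolding s_def by (intro closure_contains_Inf) auto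
  moreover have "S \<subseteq> insert 0 \<Xi>" by (auto simp: S_def)
  ultimately have s\<Xi>: "s \<in> insert 0 \<Xi>"
    using \<Xi>(2) closure_minimal by blast
  \<comment> \<open>Otherwise \<open>S\<close> would accumulate at \<open>s\<close> from the right,
    but \<open>G s \<noteq> G t\<close> keeps \<open>s\<close> at distance \<open>2 * \<eta>\<close>
    from every point of \<open>S\<close>.\<close>
  have sS: "s \<in> S"
  proof (rule ccontr)
    assume "s \<notin> S"
    then have ne: "G s \<noteq> G t" using s\<Xi> sle[OF \<open>t \<in> S\<close>] by (auto simp: S_def)
    have "\<exists>u\<in>S. u < s + 2 * \<eta>"
      using \<open>t \<in> S\<close> d(2) cInf_lessD[of S "s + 2 * \<eta>"] by (auto simp: s_def)
    then obtain u where u: "u \<in> S" "u < s + 2 * \<eta>" by auto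
    then have "s < u" using sle[of u] \<open>s \<notin> S\<close> by (cases "s = u") auto
    moreover have "G u = G t" "u \<le> t" using u by (auto simp: S_def)
    ultimately have "s \<le> u - 2 * \<eta>"
      using frozen_cdf_gap[OF \<Xi>(1) G, of u \<eta> s] s\<Xi> ne t' Gt by auto
    with u show False by linarith
  qed
  have s: "G s = G t" "s \<le> t" using sS t' by (auto simp: S_def)
  have "s \<noteq> 0" using s zero Gt t' d by auto
  then have s0: "0 < s" "s \<in> \<Xi>" using s\<Xi> \<Xi>(1) by auto
  have Gs: "s / 2 + \<eta> \<le> G s" using s Gt by linarith
  \<comment> \<open>Every earlier time lies at least \<open>2 * \<eta>\<close> before
    \<open>s\<close>, so the last of them, \<open>r\<close>, is strictly earlier and no freezing
    time lies between the two.\<close>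
  define B where "B = {u \<in> insert 0 \<Xi>. u < s}"
  define r where "r = Sup B"
  have Bne: "0 \<in> B" using s0 by (simp add: B_def)
  have Bgap: "u \<le> s - 2 * \<eta>" "G u \<noteq> G s" if "u \<in> B" for u
  proof -
    have u: "u \<in> insert 0 \<Xi>" "u < s" using that by (auto simp: B_def)
    show "G u \<noteq> G s"
    proof
      assume "G u = G s"
      then have "u \<in> S" using u s by (auto simp: S_def)
      then show False using sle u by force
    qed
    then show "u \<le> s - 2 * \<eta>" using frozen_cdf_gap[OF \<Xi>(1) G Gs u] by simp
  qed
  have bddB: "bdd_above B" using Bgap by (meson bdd_above.I)
  have rge: "u \<le> r" if "u \<in> B" for u using that bddB by (simp add: r_def cSup_upper)
  have "r \<in> closure B"
    using bddB Bne unfolding r_def by (intro closure_contains_Sup) auto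
  moreover have "B \<subseteq> insert 0 \<Xi>" by (auto simp: B_def)
  ultimately have r\<Xi>: "r \<in> insert 0 \<Xi>" using \<Xi>(2) closure_minimal by blast
  have rs: "r \<le> s - 2 * \<eta>" unfolding r_def using Bgap Bne by (intro cSup_least) auto
  then have "r \<in> B" using r\<Xi> d by (auto simp: B_def)
  have r0: "0 \<le> r" using rge[OF Bne] .
  \<comment> \<open>On \<open>[r, s)\<close> the value is \<open>K r\<close>. The sum bounds on
    \<open>[v, s]\<close>, with \<open>v\<close> approaching \<open>s\<close>, leave only one
    possible nonzero jump.\<close>
  have jump: "K s = K r \<or> K s + K r = s" if K: "frozen_cdf \<Xi> K" for K
  proof (cases "K s = K r")
    case False
    have Kv: "K v = K r" if "r < v" "v < s" for v
    proof -
      have "{r<..v} \<inter> \<Xi> = {}" using rge that by (force simp: B_def)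
      then show ?thesis using frozen_cdfD(6)[OF K r0, of v] that by auto
    qed
    have "K s + K r \<le> s"
      using frozen_cdf_sum_bounds(2)[OF K r0] False rs d by auto
    moreover have "s \<le> K s + K r"
    proof (rule dense_le_bounded[of r s])
      show "r < s" using rs d by linarith
      fix v assume v: "r < v" "v < s"
      then show "v \<le> K s + K r"
        using frozen_cdf_sum_bounds(1)[OF K, of v] False r0 Kv[OF v] by auto
    qed
    ultimately show ?thesis by auto
  qed auto
  have "H s \<le> H t" using monoH s by auto
  then have Hs: "H s \<le> G s - \<eta>" using s d by auto
  have "G s + G r = s" using jump[OF G] Bgap(2)[OF \<open>r \<in> B\<close>] by auto
  \<comment> \<open>If \<open>H\<close> jumps too, the reflections turn \<open>G s - H s\<close>
    into \<open>H r - G r\<close>. If \<open>H r = H s\<close>, then \<open>H r \<ge> s / 2\<close>,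
    while \<open>G r = s - G s \<le> s - H s - \<eta>\<close>.\<close>
  then have "\<eta> \<le> H r - G r"
    using jump[OF H] Hs half(1)[OF s\<Xi>] by auto
  then show thesis using that[of r] r\<Xi> rs s by auto
qed

text \<open>Each descent exchanges the roles of the two functions, hence the absolute value, and
  lowers the time by \<open>2 * \<eta>\<close>, while times stay nonnegative.\<close>

lemma frozen_cdf_diff_descent:
  assumes \<Xi>: "\<Xi> \<subseteq> {0<..1}" "closed (insert 0 \<Xi>)"
    and GH: "frozen_cdf \<Xi> G" "frozen_cdf \<Xi> H"
    and s: "s \<in> insert 0 \<Xi>" "\<eta> \<le> \<bar>G s - H s\<bar>" "0 < \<eta>"
  shows "2 * \<eta> * real n \<le> s"
  using s(1,2)
proof (induction n arbitrary: s)
  case 0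
  then show ?case using \<Xi> by auto
next
  case (Suc n)
  obtain r where "r \<in> insert 0 \<Xi>" "r \<le> s - 2 * \<eta>" "\<eta> \<le> \<bar>G r - H r\<bar>"
  proof (cases "\<eta> \<le> G s - H s")
    case True
    obtain r where "r \<in> insert 0 \<Xi>" "r \<le> s - 2 * \<eta>" "\<eta> \<le> H r - G r"
      using frozen_cdf_descent[OF \<Xi> GH Suc.prems(1) True s(3)] by blast
    then show thesis by (intro that[of r]) linarith+
  next
    case False
    then have "\<eta> \<le> H s - G s" using Suc.prems by linarith
    then obtain r where "r \<in> insert 0 \<Xi>" "r \<le> s - 2 * \<eta>" "\<eta> \<le> G r - H r"
      using frozen_cdf_descent[OF \<Xi> GH(2,1) Suc.prems(1) _ s(3)] by blast
    then show thesis by (intro that[of r]) linarith+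
  qed
  with Suc.IH[of r] show ?case by (auto simp: algebra_simps)
qed

text \<open>A nonzero difference at a freezing time could be moved down arbitrarily often, beyond
  time 0. Other times inherit the value of the last freezing time before them.\<close>

lemma frozen_cdf_unique:
  assumes \<Xi>: "\<Xi> \<subseteq> {0<..1}" "closed (insert 0 \<Xi>)"
    and GH: "frozen_cdf \<Xi> G" "frozen_cdf \<Xi> H" and t: "0 \<le> t"
  shows "G t = H t"
proof -
  have eq: "G s = H s" if s: "s \<in> insert 0 \<Xi>" for s
  proof (rule ccontr)
    assume "G s \<noteq> H s"
    then have pos: "0 < \<bar>G s - H s\<bar>" by simp
    then obtain n where "s < real n * (2 * \<bar>G s - H s\<bar>)"
      using reals_Archimedean3[of "2 * \<bar>G s - H s\<bar>"] by auto
    then show False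
      using frozen_cdf_diff_descent[OF \<Xi> GH s order_refl pos, of n] by (simp add: algebra_simps)
  qed
  obtain s where s: "s \<in> insert 0 \<Xi>" "s \<le> t" "\<And>r. r \<in> \<Xi> \<Longrightarrow> r \<le> t \<Longrightarrow> r \<le> s"
    using last_freezing_time[OF \<Xi>(2) t] by blast
  have "0 \<le> s" "{s<..t} \<inter> \<Xi> = {}" using s \<Xi>(1) by force+
  then have "G s = G t" "H s = H t" using frozen_cdfD(6)[OF GH(1) _ s(2)] frozen_cdfD(6)[OF GH(2) _ s(2)] by auto
  with eq[OF s(1)] show ?thesis by simp
qed

section \<open>Existence of the distribution function\<close>

text \<open>At a new freezing time \<^term>\<open>b\<close> the cdf is reflected at \<^term>\<open>b / 2\<close>.\<close>

lemma finite_frozen_cdf: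
  assumes "finite A" "A \<subseteq> {0<..1}"
  shows "\<exists>G. frozen_cdf A G \<and> (\<forall>x. continuous (at_right x) G) \<and> (\<forall>x. G x \<le> 1)"
  using assms
proof (induction rule: finite_linorder_max_induct)
  case empty
  show ?case by (intro exI[of _ "\<lambda>_. 0"]) (auto intro!: frozen_cdfI)
next
  case (insert b A)
  then obtain G where G: "frozen_cdf A G" "\<And>x. continuous (at_right x) G" "\<And>x. G x \<le> 1"
    by auto
  have b: "0 < b" "b \<le> 1" using insert by auto
  have mono: "G x \<le> G y" if "x \<le> y" for x y using frozen_cdfD(1)[OF G(1) that] .
  have zero: "G x = 0" if "x \<le> 0" for x using frozen_cdfD(2)[OF G(1) that] .
  have nn: "0 \<le> G x" for x using mono[of "min x 0" x] zero[of "min x 0"] by simp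
  \<comment> \<open>The reflected value \<open>b - G b\<close> is taken only if
    \<open>G b < b / 2\<close>. Either way \<open>c\<^sup>2 - (G b)\<^sup>2 = b * (c - G b)\<close>,
    which is what the integral equation demands of an atom at \<open>b\<close>.\<close>
  define c where "c = max (G b) (b - G b)"
  define G' where "G' x = (if x < b then G x else c)" for x
  have c: "G b \<le> c" "b / 2 \<le> c" "c \<le> 1" "c \<noteq> G b \<Longrightarrow> c + G b = b"
    using G(3)[of b] nn[of b] b by (auto simp: c_def max_def split: if_splits)
  have cb: "c\<^sup>2 - (G b)\<^sup>2 = b * (c - G b)"
  proof (cases "c = G b")
    case False
    have "c\<^sup>2 - (G b)\<^sup>2 = (c + G b) * (c - G b)" by (simp add: power2_eq_square algebra_simps)
    then show ?thesis using c(4)[OF False] by simp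
  qed simp
  have sq: "u * (G t - G u) \<le> (G t)\<^sup>2 - (G u)\<^sup>2" "(G t)\<^sup>2 - (G u)\<^sup>2 \<le> t * (G t - G u)"
    if "0 \<le> u" "u \<le> t" for u t
    using frozen_cdfD(3,4)[OF G(1) that] by auto
  have rec: "u * (G' t - G' u) \<le> (G' t)\<^sup>2 - (G' u)\<^sup>2 \<and> (G' t)\<^sup>2 - (G' u)\<^sup>2 \<le> t * (G' t - G' u)"
    if u: "0 \<le> u" "u \<le> t" for u t
  proof -
    consider "t < b" | "u < b" "b \<le> t" | "b \<le> u" using u by linarith
    then show ?thesis
    proof cases
      case 1 then show ?thesis using sq u by (simp add: G'_def)
    next
      case 2
      have *: "G u \<le> G b" "u * (c - G b) \<le> b * (c - G b)" "b * (G b - G u) \<le> t * (G b - G u)"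
         "b * (c - G b) \<le> t * (c - G b)"
        using 2 mono[of u b] c by (auto intro!: mult_right_mono)
      have "u * (G b - G u) \<le> (G b)\<^sup>2 - (G u)\<^sup>2" "(G b)\<^sup>2 - (G u)\<^sup>2 \<le> b * (G b - G u)"
        using sq[of u b] 2 u b by auto
      then have "u * (c - G u) \<le> c\<^sup>2 - (G u)\<^sup>2 \<and> c\<^sup>2 - (G u)\<^sup>2 \<le> t * (c - G u)"
        using * cb by (simp add: algebra_simps)
      then show ?thesis using 2 by (simp add: G'_def)
    next
      case 3 then show ?thesis using u by (simp add: G'_def)
    qed
  qed
  have "mono G'"
  proof (rule monoI)
    fix x y :: real assume "x \<le> y"
    then show "G' x \<le> G' y" using mono[of x y] mono[of x b] c(1) by (auto simp: G'_def)
  qed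
  have gap': "G' u = G' t" if u: "0 \<le> u" "u \<le> t" "{u<..t} \<inter> insert b A = {}" for u t
  proof -
    have "{u<..t} \<inter> A = {}" "\<not> (u < b \<and> b \<le> t)" using u by auto
    then show ?thesis using frozen_cdfD(6)[OF G(1) u(1,2)] u(2) by (auto simp: G'_def)
  qed
  have half: "t / 2 \<le> G' t" if "t \<in> insert b A" for t
  proof (cases "t = b")
    case True then show ?thesis using c(2) by (simp add: G'_def)
  next
    case False
    then have "t \<in> A" "t < b" using that insert.hyps by auto
    then show ?thesis using frozen_cdfD(5)[OF G(1)] by (simp add: G'_def)
  qed
  have rc: "continuous (at_right x) G'" for x
  proof (cases "x < b")
    case True
    then have "\<forall>\<^sub>F y in at_right x. G y = G' y"
      by (auto simp: eventually_at_right G'_def intro!: exI[of _ b])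
    then show ?thesis
      using G(2)[of x] True unfolding continuous_within
      by (subst (asm) tendsto_cong[where g = G']) (auto simp: G'_def)
  next
    case False
    then have "\<forall>\<^sub>F y in at_right x. c = G' y"
      using False by (intro eventually_at_rightI[of x "x + 1"]) (auto simp: G'_def)
    then show ?thesis
      using False tendsto_const[of c "at_right x"] unfolding continuous_within
      by (subst (asm) tendsto_cong[where g = G']) (auto simp: G'_def)
  qed
  have "frozen_cdf (insert b A) G'"
  proof (rule frozen_cdfI)
    show "G' x \<le> G' y" if "x \<le> y" for x y using \<open>mono G'\<close> that by (auto simp: mono_def)
    show "G' t = 0" if "t \<le> 0" for t using zero[OF that] that b by (simp add: G'_def)
  qed (use rec gap' half in blast)+
  moreover have "G' x \<le> 1" for x using c(3) G(3) by (simp add: G'_def)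
  ultimately show ?case using rc by blast
qed

text \<open>Finite subsets exhausting a countable dense set of freezing times have distribution
  functions by \<open>finite_frozen_cdf\<close>, and Helly selection provides a limit. Convergence
  is known only at continuity points, so each clause is first obtained along these and then carried
  to all times by right continuity.\<close>

lemma frozen_cdf_exists:
  assumes \<Xi>: "\<Xi> \<subseteq> {0<..1}" "closed (insert 0 \<Xi>)"
  obtains G where "frozen_cdf \<Xi> G" "\<And>x. continuous (at_right x) G" "\<And>x. G x \<le> 1"
proof -
  obtain D :: "real set" where D: "countable D" "D \<subseteq> \<Xi>" "\<Xi> \<subseteq> closure D"
    using separable[of \<Xi>] by blast
  define A where "A n = {d \<in> D. to_nat_on D d < n}" for n
  have "finite (A n)" for n
    using inj_on_to_nat_on[OF D(1)]
    by (intro finite_imageD[of "to_nat_on D" "A n"]) (auto simp: A_def inj_on_def intro: finite_subset[of _ "{..<n}"])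
  then have "\<exists>G. frozen_cdf (A n) G \<and> (\<forall>x. continuous (at_right x) G) \<and> (\<forall>x. G x \<le> 1)" for n
    using finite_frozen_cdf[of "A n"] D(2) \<Xi>(1) by (auto simp: A_def)
  then obtain g where g: "\<And>n. frozen_cdf (A n) (g n)" "\<And>n x. continuous (at_right x) (g n)"
      "\<And>n x. g n x \<le> 1"
    by metis
  have gmono: "mono (g n)" for n using frozen_cdfD(1)[OF g(1)] by (auto simp: mono_def)
  have "0 \<le> g n x" for n x
    using frozen_cdfD(1)[OF g(1), of "min x 0" x n] frozen_cdfD(2)[OF g(1), of "min x 0" n] by simp
  then have bdd: "\<bar>g n x\<bar> \<le> 1" for n x using g(3)[of n x] by (simp add: abs_of_nonneg)
  obtain r G where r: "strict_mono (r::nat \<Rightarrow> nat)" and rc: "\<And>x. continuous (at_right x) G"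
    and G: "mono G" "\<And>x. \<bar>G x\<bar> \<le> 1"
    and lim: "\<And>x. isCont G x \<Longrightarrow> (\<lambda>n. g (r n) x) \<longlonglongrightarrow> G x"
    using Helly_selection[of g, OF g(2) gmono bdd] by (elim exE conjE) blast
  have ex: "\<exists>c. x < c \<and> c < y \<and> isCont G c" if "x < y" for x y :: real
    using open_minus_countable[OF mono_ctble_discont[OF G(1)], of "{x<..<y}"] that by auto
  \<comment> \<open>A monotone function has only countably many discontinuities, so every
    \<open>x\<close> is approached by continuity points strictly from the right, the side from which
    \<open>G\<close> is continuous.\<close>
  have "\<exists>c. (\<forall>n. x < c n \<and> isCont G (c n)) \<and> c \<longlonglongrightarrow> x \<and> (\<lambda>n. G (c n)) \<longlonglongrightarrow> G x" for x
  proof -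
    have "\<forall>n. \<exists>c. x < c \<and> c < x + 1 / real (Suc n) \<and> isCont G c" using ex by simp
    then obtain c where c: "\<And>n. x < c n" "\<And>n. c n < x + 1 / real (Suc n)" "\<And>n. isCont G (c n)"
      by metis
    have "(\<lambda>n. x + 1 / real (Suc n)) \<longlonglongrightarrow> x + 0"
      by (intro tendsto_intros LIMSEQ_Suc[OF lim_1_over_n])
    then have "c \<longlonglongrightarrow> x"
      using c by (intro tendsto_sandwich[of "\<lambda>_. x" c sequentially "\<lambda>n. x + 1 / real (Suc n)"])
        (auto intro: always_eventually less_imp_le)
    moreover from this have "filterlim c (at_right x) sequentially"
      using c(1) by (auto simp: filterlim_at intro: always_eventually)
    then have "(\<lambda>n. G (c n)) \<longlonglongrightarrow> G x"
      using rc[of x] unfolding continuous_within by (rule filterlim_compose[rotated])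
    ultimately show ?thesis using c by blast
  qed
  then obtain c where c: "\<And>x n. x < c x n" "\<And>x n. isCont G (c x n)" "\<And>x. c x \<longlonglongrightarrow> x"
      "\<And>x. (\<lambda>n. G (c x n)) \<longlonglongrightarrow> G x"
    by metis
  have cev: "\<forall>\<^sub>F n in sequentially. c x n < y" if "x < y" for x y
    using order_tendstoD(2)[OF c(3) that] .
  have neg: "G t = 0" if "t < 0" for t
  proof -
    have "\<forall>\<^sub>F n in sequentially. G (c t n) = 0"
      using cev[OF that]
    proof eventually_elim
      case (elim n)
      then have "g (r k) (c t n) = 0" for k using frozen_cdfD(2)[OF g(1)] by auto
      then show ?case using lim[OF c(2)[of t n]] by (simp add: LIMSEQ_const_iff)
    qed
    from tendsto_eventually[OF this] show ?thesis using c(4)[of t] LIMSEQ_unique by blast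
  qed
  have cont_bounds: "u * (G t - G u) \<le> (G t)\<^sup>2 - (G u)\<^sup>2" "(G t)\<^sup>2 - (G u)\<^sup>2 \<le> t * (G t - G u)"
    if "0 \<le> u" "u \<le> t" "isCont G u" "isCont G t" for u t
  proof -
    note lims = lim[OF that(3)] lim[OF that(4)]
    have l1: "(\<lambda>n. a * (g (r n) t - g (r n) u)) \<longlonglongrightarrow> a * (G t - G u)" for a
      by (intro tendsto_intros lims)
    have l2: "(\<lambda>n. (g (r n) t)\<^sup>2 - (g (r n) u)\<^sup>2) \<longlonglongrightarrow> (G t)\<^sup>2 - (G u)\<^sup>2"
      by (intro tendsto_intros lims)
    show "u * (G t - G u) \<le> (G t)\<^sup>2 - (G u)\<^sup>2"
      using frozen_cdfD(3)[OF g(1) that(1,2)] by (intro LIMSEQ_le[OF l1 l2]) auto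
    show "(G t)\<^sup>2 - (G u)\<^sup>2 \<le> t * (G t - G u)"
      using frozen_cdfD(4)[OF g(1) that(1,2)] by (intro LIMSEQ_le[OF l2 l1]) auto
  qed
  have bounds: "u * (G t - G u) \<le> (G t)\<^sup>2 - (G u)\<^sup>2 \<and> (G t)\<^sup>2 - (G u)\<^sup>2 \<le> t * (G t - G u)"
    if "0 \<le> u" "u \<le> t" for u t
  proof (cases "u = t")
    case False
    then have "u < t" using that by simp
    from cev[OF this] have ev: "\<forall>\<^sub>F n in sequentially. c u n \<le> c t n"
      using c(1)[of t] by (auto elim!: eventually_mono intro: less_imp_le less_trans)
    have pos: "0 \<le> c u n" for n using c(1)[of u n] that by linarith
    have "\<forall>\<^sub>F n in sequentially. c u n * (G (c t n) - G (c u n)) \<le> (G (c t n))\<^sup>2 - (G (c u n))\<^sup>2"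
      using ev by eventually_elim (use cont_bounds pos c(2) in blast)
    moreover have "\<forall>\<^sub>F n in sequentially. (G (c t n))\<^sup>2 - (G (c u n))\<^sup>2 \<le> c t n * (G (c t n) - G (c u n))"
      using ev by eventually_elim (use cont_bounds pos c(2) in blast)
    ultimately show ?thesis
      by (intro conjI; elim tendsto_le[rotated 3]; intro tendsto_intros c(3,4) trivial_limit_sequentially)
  qed simp
  \<comment> \<open>Mass could drift to 0 in the limit. The sum bound on \<open>[0, t]\<close> gives
    \<open>g n t \<le> t\<close> for every \<open>n\<close>, which rules this out.\<close>
  have G0: "G 0 = 0"
  proof (rule ccontr)
    assume "G 0 \<noteq> 0"
    have "\<forall>\<^sub>F n in sequentially. G (c 0 n) \<le> c 0 n"
    proof (rule always_eventually, intro allI)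
      fix n
      have "g (r k) (c 0 n) \<le> c 0 n" for k
      proof (cases "g (r k) (c 0 n) = 0")
        case True then show ?thesis using c(1)[of 0 n] by simp
      next
        case False
        then show ?thesis
          using frozen_cdf_sum_bounds(2)[OF g(1)[of "r k"], of 0 "c 0 n"] c(1)[of 0 n]
            frozen_cdfD(2)[OF g(1)[of "r k"], of 0] by simp
      qed
      then show "G (c 0 n) \<le> c 0 n" using lim[OF c(2)[of 0 n]] by (intro LIMSEQ_le_const2) auto
    qed
    from tendsto_le[OF trivial_limit_sequentially c(3)[of 0] c(4)[of 0] this] have "G 0 \<le> 0" .
    moreover have "0 \<le> G 0" using neg[of "-1"] G(1) by (simp add: mono_def) (metis neg_le_0_iff_le zero_le_one)
    ultimately show False using \<open>G 0 \<noteq> 0\<close> by simp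
  qed
  have halfD: "t / 2 \<le> G t" if "t \<in> D" for t
  proof -
    have "t / 2 \<le> G (c t n)" for n
    proof (rule LIMSEQ_le_const[OF lim[OF c(2)]], intro exI allI impI)
      fix k assume "Suc (to_nat_on D t) \<le> k"
      also have "k \<le> r k" using r seq_suble by blast
      finally have "t \<in> A (r k)" using that by (simp add: A_def)
      then have "t / 2 \<le> g (r k) t" using frozen_cdfD(5)[OF g(1)] by blast
      also have "\<dots> \<le> g (r k) (c t n)" using frozen_cdfD(1)[OF g(1)] c(1) less_imp_le by blast
      finally show "t / 2 \<le> g (r k) (c t n)" .
    qed
    then show ?thesis using c(4)[of t] by (intro LIMSEQ_le_const) auto
  qed
  have half: "t / 2 \<le> G t" if t: "t \<in> \<Xi>" for t
  proof -
    have "t \<in> closure D" using t D(3) by auto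
    then obtain d where d: "\<And>n. d n \<in> D" "d \<longlonglongrightarrow> t" by (auto simp: closure_sequential)
    \<comment> \<open>The approximating times may lie on either side of \<open>t\<close>; the
      maximum moves them to the right, where continuity of \<open>G\<close> applies.\<close>
    have "d n / 2 \<le> G (max (d n) t)" for n
      using halfD[OF d(1)[of n]] G(1) by (auto simp: mono_def intro: order_trans)
    moreover have "(\<lambda>n. G (max (d n) t)) \<longlonglongrightarrow> G t"
    proof -
      have "continuous (at t within {t..}) G"
        using rc[of t] by (simp add: at_within_Ici_at_right)
      moreover have "(\<lambda>n. max (d n) t) \<longlonglongrightarrow> max t t" by (intro tendsto_max d(2) tendsto_const)
      ultimately show ?thesis
        by (simp add: continuous_within_sequentially comp_def)
    qed
    moreover have "(\<lambda>n. d n / 2) \<longlonglongrightarrow> t / 2" using d(2) by (intro tendsto_intros) auto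
    ultimately show ?thesis using LIMSEQ_le by blast
  qed
  have gap: "G u = G t" if u: "0 \<le> u" "u \<le> t" "{u<..t} \<inter> \<Xi> = {}" for u t
  proof (cases "u = t")
    case False
    then have "u < t" "t \<in> {u<..t}" using u by auto
    \<comment> \<open>The points \<open>c t n\<close> lie beyond \<open>t\<close>, so a whole
      neighbourhood of \<open>t\<close> without freezing times is needed to keep the approximating
      intervals empty.\<close>
    then have "t \<in> - insert 0 \<Xi>" using u(1,3) by fastforce
    then obtain e where e: "0 < e" "ball t e \<subseteq> - insert 0 \<Xi>"
      using \<Xi>(2) by (meson open_Compl open_contains_ball)
    have "\<forall>\<^sub>F n in sequentially. c t n < t + e" using cev e(1) by simp
    with cev[OF \<open>u < t\<close>] have "\<forall>\<^sub>F n in sequentially. G (c u n) = G (c t n)"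
    proof eventually_elim
      case (elim n)
      have le: "c u n \<le> c t n" "0 \<le> c u n" using elim c(1)[of t n] c(1)[of u n] u by linarith+
      have "{c u n<..c t n} \<inter> \<Xi> = {}"
      proof (intro equals0I)
        fix x assume x: "x \<in> {c u n<..c t n} \<inter> \<Xi>"
        then have "u < x" using c(1)[of u n] by auto
        then have "t < x" using x u(3) by (auto simp: disjoint_iff not_less)
        then have "x \<in> ball t e" using x elim by (auto simp: dist_real_def)
        then show False using x e by blast
      qed
      then have "{c u n<..c t n} \<inter> A (r k) = {}" for k using D(2) by (auto simp: A_def)
      then have "g (r k) (c u n) = g (r k) (c t n)" for k
        using frozen_cdfD(6)[OF g(1) le(2,1)] by blast
      then show ?case using lim[OF c(2)[of u n]] lim[OF c(2)[of t n]] LIMSEQ_unique by simp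
    qed
    from tendsto_cong[OF this] show ?thesis using c(4)[of u] c(4)[of t] LIMSEQ_unique by blast
  qed simp
  have "frozen_cdf \<Xi> G"
  proof (rule frozen_cdfI)
    show "G x \<le> G y" if "x \<le> y" for x y using G(1) that by (auto simp: mono_def)
    show "G t = 0" if "t \<le> 0" for t using neg[of t] G0 that by (cases "t = 0") auto
  qed (use bounds half gap in blast)+
  moreover have "G x \<le> 1" for x using G(2)[of x] by simp
  ultimately show thesis using that rc by blast
qed

subsection \<open>Percolation and burning times\<close>

lemma words_Nil [simp]: "[] \<in> words"
  by (simp add: words_def)

lemma words_Cons [simp]: "a # i \<in> words \<longleftrightarrow> (a = 1 \<or> a = 2) \<and> i \<in> words"
  by (auto simp: words_def)

lemma words_append [simp]: "i @ j \<in> words \<longleftrightarrow> i \<in> words \<and> j \<in> words"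
  by (auto simp: words_def)

text \<open>Percolation to finite depth: a condition on finitely many words, hence measurable, with
  the recursion of a branching process over its generations.\<close>

fun reach :: "marks \<Rightarrow> nat list set \<Rightarrow> nat \<Rightarrow> nat list \<Rightarrow> bool" where
  "reach w A 0 i \<longleftrightarrow> True"
| "reach w A (Suc n) i \<longleftrightarrow> i \<in> A \<and> (\<exists>j\<in>{1, 2}. j \<le> snd (w i) \<and> reach w A n (i @ [j]))"

lemma percolatesD:
  assumes "percolates w A i"
  shows "i \<in> A" "\<exists>j\<in>{1, 2}. j \<le> snd (w i) \<and> percolates w A (i @ [j])"
proof -
  obtain J where J: "\<And>k. k \<ge> 1 \<Longrightarrow> J k \<in> {1, 2}"
    "\<And>k. J (Suc k) \<le> snd (w (i @ map J [1..<Suc k])) \<and> i @ map J [1..<Suc k] \<in> A"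
    using assms by (auto simp: percolates_def)
  show "i \<in> A" using J(2)[of 0] by simp
  have shift: "map J [1..<Suc (Suc k)] = J 1 # map (\<lambda>k. J (Suc k)) [1..<Suc k]" for k
    by (simp add: upt_conv_Cons map_Suc_upt[symmetric] comp_def del: upt_Suc)
  have "percolates w A (i @ [J 1])"
    unfolding percolates_def
  proof (intro exI[of _ "\<lambda>k. J (Suc k)"] conjI allI impI)
    show "J (Suc k) \<in> {1, 2}" if "1 \<le> k" for k using J(1) by simp
    show "J (Suc (Suc k)) \<le> snd (w ((i @ [J 1]) @ map (\<lambda>k. J (Suc k)) [1..<Suc k]))"
      "(i @ [J 1]) @ map (\<lambda>k. J (Suc k)) [1..<Suc k] \<in> A" for k
      using J(2)[of "Suc k"] unfolding shift by simp_all
  qed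
  then show "\<exists>j\<in>{1, 2}. j \<le> snd (w i) \<and> percolates w A (i @ [j])"
    using J(1)[of 1] J(2)[of 0] by (intro bexI[of _ "J 1"]) auto
qed

text \<open>Percolation is the greatest fixed point of the one-step condition: choosing a child that
  keeps \<open>P\<close>, again and again, builds the path.\<close>

lemma percolates_coinduct [consumes 1, case_names step]:
  assumes "P i" and step: "\<And>i. P i \<Longrightarrow> i \<in> A \<and> (\<exists>j\<in>{1, 2}. j \<le> snd (w i) \<and> P (i @ [j]))"
  shows "percolates w A i"
proof -
  obtain c where c: "\<And>i. P i \<Longrightarrow> c i \<in> {1, 2} \<and> c i \<le> snd (w i) \<and> P (i @ [c i])"
    using step by metis
  define I where "I = rec_nat i (\<lambda>_ u. u @ [c u])"
  have I: "I 0 = i" "I (Suc k) = I k @ [c (I k)]" for k by (simp_all add: I_def)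
  define J where "J k = c (I (k - 1))" for k
  have PI: "P (I k)" for k by (induction k) (use I c assms(1) in auto)
  have IJ: "I k = i @ map J [1..<Suc k]" for k
    by (induction k) (auto simp: I J_def)
  show ?thesis
    unfolding percolates_def
  proof (intro exI[of _ J] conjI allI impI)
    show "J k \<in> {1, 2}" for k using c[OF PI] by (simp add: J_def)
    show "J (Suc k) \<le> snd (w (i @ map J [1..<Suc k]))" "i @ map J [1..<Suc k] \<in> A" for k
      using c[OF PI[of k]] step[OF PI[of k]] unfolding IJ[symmetric] by (auto simp: J_def)
  qed
qed

lemma percolates_unfold:
  "percolates w A i \<longleftrightarrow> i \<in> A \<and> (\<exists>j\<in>{1, 2}. j \<le> snd (w i) \<and> percolates w A (i @ [j]))"
proof
  assume "i \<in> A \<and> (\<exists>j\<in>{1, 2}. j \<le> snd (w i) \<and> percolates w A (i @ [j]))"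
  then show "percolates w A i"
  proof (rule percolates_coinduct[where P = "\<lambda>i. i \<in> A \<and>
      (\<exists>j\<in>{1, 2}. j \<le> snd (w i) \<and> percolates w A (i @ [j]))"])
    fix i assume "i \<in> A \<and> (\<exists>j\<in>{1, 2}. j \<le> snd (w i) \<and> percolates w A (i @ [j]))"
    then obtain j where "i \<in> A" "j \<in> {1, 2}" "j \<le> snd (w i)" "percolates w A (i @ [j])" by blast
    then show "i \<in> A \<and> (\<exists>j\<in>{1, 2}. j \<le> snd (w i) \<and> i @ [j] \<in> A \<and>
        (\<exists>k\<in>{1, 2}. k \<le> snd (w (i @ [j])) \<and> percolates w A ((i @ [j]) @ [k])))"
      using percolatesD[of w A "i @ [j]"] by blast
  qed
next
  assume "percolates w A i"
  from percolatesD[OF this]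
  show "i \<in> A \<and> (\<exists>j\<in>{1, 2}. j \<le> snd (w i) \<and> percolates w A (i @ [j]))" by blast
qed

lemma reach_decreasing: "reach w A (Suc n) i \<Longrightarrow> reach w A n i"
proof (induction n arbitrary: i)
  case (Suc n)
  from Suc.prems have "i \<in> A" "\<exists>j\<in>{1, 2}. j \<le> snd (w i) \<and> reach w A (Suc n) (i @ [j])"
    by (simp_all only: reach.simps(2)[of w A "Suc n" i])
  with Suc.IH show ?case unfolding reach.simps(2)[of w A n i] by blast
qed simp

lemma reach_antimono: "m \<le> n \<Longrightarrow> reach w A n i \<Longrightarrow> reach w A m i"
  by (induction n rule: dec_induct) (auto dest: reach_decreasing simp del: reach.simps)

text \<open>Koenig's lemma for a tree with at most two children per word.\<close>

lemma percolates_iff_reach: "percolates w A i \<longleftrightarrow> (\<forall>n. reach w A n i)"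
proof
  assume "percolates w A i"
  then have "reach w A n i" for n
  proof (induction n arbitrary: i)
    case (Suc n)
    from percolatesD[OF Suc.prems] Suc.IH show ?case unfolding reach.simps by blast
  qed simp
  then show "\<forall>n. reach w A n i" by blast
next
  assume "\<forall>n. reach w A n i"
  then show "percolates w A i"
  proof (coinduction arbitrary: i rule: percolates_coinduct)
    case (step i)
    \<comment> \<open>If each admissible child failed at some depth, all of them would fail at the
      larger one, against \<open>reach\<close> one level higher.\<close>
    have "\<exists>j\<in>{1, 2}. j \<le> snd (w i) \<and> (\<forall>n. reach w A n (i @ [j]))"
    proof (rule ccontr)
      assume "\<not> ?thesis"
      then obtain f where f: "\<And>j. j \<in> {1, 2} \<Longrightarrow> j \<le> snd (w i) \<Longrightarrow> \<not> reach w A (f j) (i @ [j])"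
        by metis
      obtain j where j: "j \<in> {1, 2}" "j \<le> snd (w i)" "reach w A (max (f 1) (f 2)) (i @ [j])"
        using step[rule_format, of "Suc (max (f 1) (f 2))"] by auto
      then have "reach w A (f j) (i @ [j])" by (intro reach_antimono[OF _ j(3)]) auto
      with f j show False by blast
    qed
    moreover have "i \<in> A" using step[rule_format, of 1] by simp
    ultimately show ?case by blast
  qed
qed

lemma reach_mono: "A \<subseteq> B \<Longrightarrow> reach w A n i \<Longrightarrow> reach w B n i"
proof (induction n arbitrary: i)
  case (Suc n)
  then show ?case unfolding reach.simps by blast
qed simp

lemma percolates_mono: "A \<subseteq> B \<Longrightarrow> percolates w A i \<Longrightarrow> percolates w B i"
  unfolding percolates_iff_reach using reach_mono by blast

lemma reach_append: "reach w A n (j @ i) = reach (\<lambda>k. w (j @ k)) {k. j @ k \<in> A} n i"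
  by (induction n arbitrary: i) auto

lemma reach_cong:
  assumes "\<And>k. k \<in> words \<Longrightarrow> w k = w' k \<and> (k \<in> A \<longleftrightarrow> k \<in> A')" "i \<in> words"
  shows "reach w A n i = reach w' A' n i"
  using assms(2) by (induction n arbitrary: i) (auto simp: assms(1))

lemma open_words_mono: "s \<le> t \<Longrightarrow> open_words w s \<subseteq> open_words w t"
  by (auto simp: open_words_def)

section \<open>Burning times and their recursion\<close>

abbreviation burns :: "marks \<Rightarrow> nat list set \<Rightarrow> real \<Rightarrow> nat list \<Rightarrow> bool" where
  "burns w F t \<equiv> percolates w (open_words w t - F)"

lemma burns_mono: "s \<le> t \<Longrightarrow> burns w F s i \<Longrightarrow> burns w F t i"
  using percolates_mono[of "open_words w s - F" "open_words w t - F"] open_words_mono by blast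

text \<open>Up to a fixed depth only finitely many conditions \<open>fst (w i) \<le> s\<close> are
  involved, so a failure at \<open>y\<close> persists slightly beyond \<open>y\<close>.\<close>

lemma reach_right_continuous:
  assumes "\<And>s. y < s \<Longrightarrow> reach w (open_words w s - F) n i"
  shows "reach w (open_words w y - F) n i"
  using assms
proof (induction n arbitrary: i)
  case (Suc n)
  have "i \<in> open_words w s - F" if "y < s" for s using Suc.prems[OF that] by simp
  then have "i \<in> open_words w y - F"
    using dense_ge[of y "fst (w i)"] gt_ex[of y] by (fastforce simp: open_words_def)
  moreover have "\<exists>j\<in>{1, 2}. j \<le> snd (w i) \<and> reach w (open_words w y - F) n (i @ [j])"
  proof (rule ccontr)
    assume "\<not> ?thesis"
    then have "\<exists>s>y. \<not> reach w (open_words w s - F) n (i @ [j])"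
      if "j \<in> {1, 2}" "j \<le> snd (w i)" for j using Suc.IH that by blast
    then obtain f where f: "\<And>j. j \<in> {1, 2} \<Longrightarrow> j \<le> snd (w i) \<Longrightarrow>
        y < f j \<and> \<not> reach w (open_words w (f j) - F) n (i @ [j])"
      by metis
    \<comment> \<open>The minimum over the failing children still exceeds \<open>y\<close>; the
      entry \<open>y + 1\<close> covers the case without admissible children.\<close>
    define s where "s = Min (insert (y + 1) (f ` {j \<in> {1, 2}. j \<le> snd (w i)}))"
    have "y < s" using f by (auto simp: s_def)
    then obtain j where j: "j \<in> {1, 2}" "j \<le> snd (w i)" "reach w (open_words w s - F) n (i @ [j])"
      using Suc.prems[of s] by auto
    have "s \<le> f j" unfolding s_def using j by (intro Min_le) auto
    then have "reach w (open_words w (f j) - F) n (i @ [j])"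
      using j(3) open_words_mono[of s "f j" w] by (blast intro: reach_mono[rotated])
    with f j show False by blast
  qed
  ultimately show ?case by simp
qed simp

lemma burns_right_continuous: "(\<And>s. y < s \<Longrightarrow> burns w F s i) \<Longrightarrow> burns w F y i"
  unfolding percolates_iff_reach using reach_right_continuous by blast

text \<open>The value 2 stands for a time that never comes.\<close>

definition burning_time :: "real set \<Rightarrow> marks \<Rightarrow> nat list set \<Rightarrow> nat list \<Rightarrow> real" where
  "burning_time \<Xi> w F i = (if \<exists>t\<in>\<Xi>. burns w F t i then Inf {t \<in> \<Xi>. burns w F t i} else 2)"

definition combine :: "real \<times> nat \<Rightarrow> real \<Rightarrow> real \<Rightarrow> real" where
  "combine w x y = (if snd w = 1 then if fst w < x then x else 2 else min x y)"

locale freezing_times =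
  fixes \<Xi> :: "real set"
  assumes unit: "\<Xi> \<subseteq> {0<..1}" and closed: "closed (insert 0 \<Xi>)"
begin

lemma bdd_below_times: "bdd_below {t \<in> \<Xi>. P t}"
  by (rule bdd_belowI[of _ 0]) (use unit in auto)

lemma burning_time_le: "t \<in> \<Xi> \<Longrightarrow> burns w F t i \<Longrightarrow> burning_time \<Xi> w F i \<le> t"
  unfolding burning_time_def using bdd_below_times by (auto intro!: cInf_lower)

text \<open>The bound on \<open>a\<close> excludes the default value 2; below it, an infimum is less
  than \<open>a\<close> exactly if one of the times is.\<close>

lemma burning_time_less_iff:
  assumes "a \<le> 2"
  shows "burning_time \<Xi> w F i < a \<longleftrightarrow> (\<exists>t\<in>\<Xi>. t < a \<and> burns w F t i)"
proof
  assume "burning_time \<Xi> w F i < a"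
  then show "\<exists>t\<in>\<Xi>. t < a \<and> burns w F t i"
    using assms cInf_lessD[of "{t \<in> \<Xi>. burns w F t i}" a]
    by (auto simp: burning_time_def split: if_splits)
qed (use burning_time_le le_less_trans in blast)

text \<open>Infima stay in the closed set \<open>insert 0 \<Xi>\<close>. The value 0 covers words
  that burn at arbitrarily early times.\<close>

lemma burning_time_range: "burning_time \<Xi> w F i \<in> insert 2 (insert 0 \<Xi>)"
proof (cases "\<exists>t\<in>\<Xi>. burns w F t i")
  case True
  then have "Inf {t \<in> \<Xi>. burns w F t i} \<in> closure {t \<in> \<Xi>. burns w F t i}"
    using bdd_below_times by (intro closure_contains_Inf) auto
  also have "\<dots> \<subseteq> insert 0 \<Xi>" using closed by (intro closure_minimal) auto
  finally show ?thesis using True by (simp add: burning_time_def)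
qed (simp add: burning_time_def)

text \<open>An infimum below \<open>t\<close> yields an earlier time directly. An infimum equal to
  \<open>t\<close> lies in \<open>\<Xi>\<close>, and right continuity lets the word burn at
  \<open>t\<close> itself.\<close>

lemma burning_time_attained:
  assumes "burning_time \<Xi> w F i \<le> t" "0 < t" "t < 2"
  shows "\<exists>s\<in>\<Xi>. s \<le> t \<and> burns w F s i"
proof (cases "burning_time \<Xi> w F i < t")
  case True
  then obtain s where "s \<in> \<Xi>" "s < t" "burns w F s i"
    using burning_time_less_iff[of t w F i] assms by auto
  then show ?thesis by (intro bexI[of _ s]) auto
next
  case False
  then have t: "burning_time \<Xi> w F i = t" using assms by simp
  then have "t \<in> \<Xi>" using burning_time_range[of w F i] assms by auto
  moreover have "burns w F t i"
  proof (rule burns_right_continuous)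
    fix s assume "t < s"
    then have "burning_time \<Xi> w F i < min s 2" using t assms by auto
    then obtain r where "r \<in> \<Xi>" "r < s" "burns w F r i"
      using burning_time_less_iff[of "min s 2" w F i] by auto
    then show "burns w F s i" using burns_mono[of r s] by auto
  qed
  ultimately show ?thesis by blast
qed

lemma burning_time_eqI:
  assumes "\<And>t. t \<in> \<Xi> \<Longrightarrow> burns w F t i \<longleftrightarrow> burns w F t j"
  shows "burning_time \<Xi> w F i = burning_time \<Xi> w F j"
proof -
  have "{t \<in> \<Xi>. burns w F t i} = {t \<in> \<Xi>. burns w F t j}" using assms by auto
  then show ?thesis using assms by (auto simp: burning_time_def)
qed

lemma burning_time_min:
  assumes "\<And>t. t \<in> \<Xi> \<Longrightarrow> burns w F t i \<longleftrightarrow> burns w F t j \<or> burns w F t k"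
  shows "burning_time \<Xi> w F i = min (burning_time \<Xi> w F j) (burning_time \<Xi> w F k)"
proof (rule antisym)
  have less: "burning_time \<Xi> w F i < a \<longleftrightarrow>
      burning_time \<Xi> w F j < a \<or> burning_time \<Xi> w F k < a" if "a \<le> 2" for a
    using assms unfolding burning_time_less_iff[OF that] by blast
  have le2: "burning_time \<Xi> w F l \<le> 2" for l
    using burning_time_range[of w F l] unit by force
  show "burning_time \<Xi> w F i \<le> min (burning_time \<Xi> w F j) (burning_time \<Xi> w F k)"
    using less[OF le2[of i]] by (simp add: not_less)
  show "min (burning_time \<Xi> w F j) (burning_time \<Xi> w F k) \<le> burning_time \<Xi> w F i"
    using less[of "min (burning_time \<Xi> w F j) (burning_time \<Xi> w F k)"] le2[of j]
    by (simp add: not_less[symmetric])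
qed

text \<open>Attainment of the infimum turns the existential condition for freezing into a comparison
  of the child's burning time with \<open>fst (w i)\<close>. The bounds on \<open>fst (w i)\<close>
  place it where attainment is available.\<close>

lemma burning_time_recursion:
  assumes eq: "frozen_equation \<Xi> w F" and i: "i \<in> words"
    and w: "snd (w i) \<in> {1, 2}" "0 < fst (w i)" "fst (w i) \<le> 1"
  shows "i \<in> F \<longleftrightarrow> snd (w i) = 1 \<and> burning_time \<Xi> w F (i @ [1]) \<le> fst (w i)"
    and "burning_time \<Xi> w F i =
      combine (w i) (burning_time \<Xi> w F (i @ [1])) (burning_time \<Xi> w F (i @ [2]))"
proof -
  have F: "i \<in> F \<longleftrightarrow> snd (w i) = 1 \<and> (\<exists>t\<in>\<Xi>. t \<le> fst (w i) \<and> burns w F t (i @ [1]))"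
    using eq i unit unfolding frozen_equation_def by fastforce
  show iF: "i \<in> F \<longleftrightarrow> snd (w i) = 1 \<and> burning_time \<Xi> w F (i @ [1]) \<le> fst (w i)"
    using F burning_time_attained[of w F "i @ [1]" "fst (w i)"] w burning_time_le[of _ w F "i @ [1]"]
    by force
  have burns: "burns w F t i \<longleftrightarrow> i \<notin> F \<and> (if snd (w i) = 1 then fst (w i) \<le> t \<and> burns w F t (i @ [1])
      else burns w F t (i @ [1]) \<or> burns w F t (i @ [2]))" for t
    using w(1) i by (subst percolates_unfold) (auto simp: open_words_def)
  show "burning_time \<Xi> w F i =
      combine (w i) (burning_time \<Xi> w F (i @ [1])) (burning_time \<Xi> w F (i @ [2]))"
  proof (cases "snd (w i) = 1")
    case True
    show ?thesis
    proof (cases "i \<in> F")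
      case True
      then show ?thesis using iF burns by (simp add: burning_time_def combine_def)
    next
      case False
      \<comment> \<open>The child of an unfrozen word of type 1 burns at no freezing time up to
        \<open>fst (w i)\<close>. Beyond that time the word is open, so it burns whenever its child
        does.\<close>
      have "burning_time \<Xi> w F i = burning_time \<Xi> w F (i @ [1])"
        using True False F burns by (intro burning_time_eqI) force
      then show ?thesis using True False iF by (simp add: combine_def)
    qed
  next
    case False
    then have "i \<notin> F" using F by simp
    then have "burning_time \<Xi> w F i = min (burning_time \<Xi> w F (i @ [1])) (burning_time \<Xi> w F (i @ [2]))"
      using False burns by (intro burning_time_min) simp
    then show ?thesis using False by (simp add: combine_def)
  qed
qed

text \<open>Taking the last freezing time before each rational reduces statements about all of
  \<open>\<Xi>\<close> to countably many times, as null sets and measurability require.\<close>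

lemma right_dense_times:
  obtains D where "countable D" "D \<subseteq> \<Xi>" "\<And>s a. s \<in> \<Xi> \<Longrightarrow> s < a \<Longrightarrow> \<exists>d\<in>D. s \<le> d \<and> d < a"
proof -
  have "\<forall>q. \<exists>s. 0 \<le> q \<longrightarrow> s \<in> insert 0 \<Xi> \<and> s \<le> q \<and> (\<forall>r\<in>\<Xi>. r \<le> q \<longrightarrow> r \<le> s)"
    using last_freezing_time[OF closed] by metis
  then obtain l where l: "\<And>q. 0 \<le> q \<Longrightarrow> l q \<in> insert 0 \<Xi> \<and> l q \<le> q \<and> (\<forall>r\<in>\<Xi>. r \<le> q \<longrightarrow> r \<le> l q)"
    by metis
  show thesis
  proof (rule that[of "l ` \<rat> \<inter> \<Xi>"])
    show "countable (l ` \<rat> \<inter> \<Xi>)" using countable_rat by blast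
    fix s a assume s: "s \<in> \<Xi>" "s < a"
    then obtain q where q: "q \<in> \<rat>" "s < q" "q < a" using Rats_dense_in_real by blast
    then have "0 < s" "0 \<le> q" using s unit by auto
    with l[of q] s q have "l q \<in> \<Xi>" "s \<le> l q" "l q < a" by force+
    then show "\<exists>d\<in>l ` \<rat> \<inter> \<Xi>. s \<le> d \<and> d < a" using q by blast
  qed blast
qed

text \<open>
  A word with burning time \<^term>\<open>t\<close> has a child with burning time \<^term>\<open>t\<close>, so it
  percolates at that time; the last assumption excludes an earlier time.
\<close>

lemma frozen_equationI:
  fixes w :: marks and Y :: "nat list \<Rightarrow> real"
  defines "F \<equiv> {i \<in> words. snd (w i) = 1 \<and> Y (i @ [1]) \<le> fst (w i)}"
  assumes w: "\<And>i. i \<in> words \<Longrightarrow> snd (w i) \<in> {1, 2} \<and> fst (w i) \<le> 1"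
    and Y: "\<And>i. i \<in> words \<Longrightarrow> Y i \<in> insert 2 \<Xi>"
      "\<And>i. i \<in> words \<Longrightarrow> Y i = combine (w i) (Y (i @ [1])) (Y (i @ [2]))"
    and D: "\<And>s a. s \<in> \<Xi> \<Longrightarrow> s < a \<Longrightarrow> \<exists>d\<in>D. s \<le> d \<and> d < a"
    and no: "\<And>i d. i \<in> words \<Longrightarrow> d \<in> D \<Longrightarrow> d < Y i \<Longrightarrow> \<not> burns w F d i"
  shows "frozen_equation \<Xi> w F"
  unfolding frozen_equation_def
proof (intro ballI)
  fix i assume i: "i \<in> words"
  have up: "burns w F t j" if "j \<in> words" "Y j = t" "t \<in> \<Xi>" for j t
    using that
  proof (coinduction arbitrary: j rule: percolates_coinduct)
    case (step j)
    have t: "t \<noteq> 2" using step(3) unit by auto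
    show ?case
    proof (cases "snd (w j) = 1")
      case True
      then have "fst (w j) < Y (j @ [1])" "Y (j @ [1]) = t"
        using Y(2)[OF step(1)] step(2) t by (auto simp: combine_def split: if_splits)
      then show ?thesis using True step by (auto simp: F_def open_words_def)
    next
      case False
      then have "snd (w j) = 2" "Y (j @ [1]) = t \<or> Y (j @ [2]) = t"
        using w[OF step(1)] Y(2)[OF step(1)] step(2) by (auto simp: combine_def min_def split: if_splits)
      then show ?thesis using step by (auto simp: F_def open_words_def)
    qed
  qed
  have down: "Y j \<le> t" if "j \<in> words" "t \<in> \<Xi>" "burns w F t j" for j t
  proof (rule ccontr)
    assume "\<not> Y j \<le> t"
    \<comment> \<open>Failure to burn is assumed only at times of \<open>D\<close>. As burning is
      monotone in time, \<open>t\<close> may be raised to such a time that is still below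
      \<open>Y j\<close>.\<close>
    then obtain d where "d \<in> D" "t \<le> d" "d < Y j" using D[of t "Y j"] \<open>t \<in> \<Xi>\<close> by auto
    then show False using no[OF \<open>j \<in> words\<close>] burns_mono that(3) by blast
  qed
  have "Y (i @ [1]) \<le> fst (w i) \<longleftrightarrow> (\<exists>t\<in>\<Xi> \<inter> {0<..fst (w i)}. burns w F t (i @ [1]))"
  proof
    assume le: "Y (i @ [1]) \<le> fst (w i)"
    then have "Y (i @ [1]) \<in> \<Xi>" using Y(1)[of "i @ [1]"] w[OF i] i by auto
    then show "\<exists>t\<in>\<Xi> \<inter> {0<..fst (w i)}. burns w F t (i @ [1])"
      using up[of "i @ [1]"] le i unit by (intro bexI[of _ "Y (i @ [1])"]) auto
  next
    assume "\<exists>t\<in>\<Xi> \<inter> {0<..fst (w i)}. burns w F t (i @ [1])"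
    then show "Y (i @ [1]) \<le> fst (w i)" using down[of "i @ [1]"] i by force
  qed
  then show "i \<in> F \<longleftrightarrow> snd (w i) = 1 \<and>
      (\<exists>t\<in>\<Xi> \<inter> {0<..fst (w i)}. percolates w (open_words w t - F) (i @ [1]))"
    using i by (auto simp: F_def)
qed

end

subsection \<open>Trees with an invariant law\<close>

lemma space_mark_space: "space mark_space = UNIV \<times> {1, 2}"
  by (simp add: mark_space_def space_pair_measure)

lemma sets_mark_law [measurable_cong, simp]: "sets mark_law = sets mark_space"
  by (auto simp: mark_law_def mark_space_def sets_uniform_count_measure intro!: sets_pair_measure_cong)

lemma space_mark_law: "space mark_law = UNIV \<times> {1, 2}"
  using sets_eq_imp_space_eq[OF sets_mark_law] by (simp add: space_mark_space)

lemma prob_space_unit_uniform: "prob_space (uniform_measure lborel {0..1::real})"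
  by (rule prob_space_uniform_measure) auto

lemma prob_space_mark_law: "prob_space mark_law"
proof -
  interpret U: prob_space "uniform_measure lborel {0..1::real}" by (rule prob_space_unit_uniform)
  interpret C: prob_space "uniform_count_measure {1, 2::nat}"
    by (rule prob_space_uniform_count_measure) auto
  interpret pair_prob_space "uniform_measure lborel {0..1::real}" "uniform_count_measure {1, 2::nat}" ..
  show ?thesis unfolding mark_law_def by (rule prob_space_axioms)
qed

lemma measurable_mark_fst [measurable]: "fst \<in> borel_measurable mark_space"
  unfolding mark_space_def by (rule measurable_fst)

lemma measurable_mark_snd [measurable]: "snd \<in> mark_space \<rightarrow>\<^sub>M count_space {1, 2}"
  unfolding mark_space_def by (rule measurable_snd)

lemma measurable_mark_snd_UNIV [measurable]: "snd \<in> mark_space \<rightarrow>\<^sub>M count_space UNIV"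
  using measurable_mark_snd by (rule measurable_compose) simp

section \<open>Grafting two trees onto a marked root\<close>

text \<open>The type is stored as a real number, so that all coordinates lie in one Polish space, as
  the projective limit requires.\<close>

definition tree_borel :: "sample_point measure" where
  "tree_borel = (\<Pi>\<^sub>M i\<in>words. borel)"

abbreviation root_time :: "sample_point \<Rightarrow> real" where
  "root_time x \<equiv> snd (snd (x []))"

text \<open>A tree carries at each word its time, its type and its burning time.\<close>

fun graft :: "(real \<times> nat) \<times> sample_point \<times> sample_point \<Rightarrow> sample_point" where
  "graft (w, x, y) = (\<lambda>i\<in>words. case i of
      [] \<Rightarrow> (fst w, real (snd w), combine w (root_time x) (root_time y))
    | a # j \<Rightarrow> if a = 1 then x j else y j)"

lemma measurable_combine [measurable (raw)]:
  assumes [measurable]: "f \<in> M \<rightarrow>\<^sub>M mark_space" "g \<in> borel_measurable M" "h \<in> borel_measurable M"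
  shows "(\<lambda>x. combine (f x) (g x) (h x)) \<in> borel_measurable M"
  unfolding combine_def by measurable

lemma measurable_component [measurable (raw)]:
  assumes "f \<in> M \<rightarrow>\<^sub>M tree_borel" "i \<in> words"
  shows "(\<lambda>x. f x i) \<in> M \<rightarrow>\<^sub>M (borel :: (real \<times> real \<times> real) measure)"
  using assms unfolding tree_borel_def by (rule measurable_component_singleton[THEN measurable_compose[rotated], rotated])

lemma measurable_tree_borel:
  assumes "\<And>i. i \<in> words \<Longrightarrow> (\<lambda>x. f x i) \<in> M \<rightarrow>\<^sub>M (borel :: (real \<times> real \<times> real) measure)"
  shows "(\<lambda>x. \<lambda>i\<in>words. f x i) \<in> M \<rightarrow>\<^sub>M tree_borel"
  unfolding tree_borel_def using assms by (rule measurable_restrict)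

lemma measurable_triple [measurable (raw)]:
  assumes "f \<in> M \<rightarrow>\<^sub>M (borel :: (real \<times> real \<times> real) measure)"
  shows "(\<lambda>x. fst (f x)) \<in> borel_measurable M"
    and "(\<lambda>x. fst (snd (f x))) \<in> borel_measurable M"
    and "(\<lambda>x. snd (snd (f x))) \<in> borel_measurable M"
  using assms by (rule measurable_compose; auto intro!: borel_measurable_continuous_onI continuous_intros)+

lemma measurable_root_time [measurable]: "root_time \<in> borel_measurable tree_borel"
  by (intro measurable_triple measurable_component) auto

lemma measurable_graft [measurable]:
  "graft \<in> mark_space \<Otimes>\<^sub>M (tree_borel \<Otimes>\<^sub>M tree_borel) \<rightarrow>\<^sub>M tree_borel"
proof -
  have "(\<lambda>p. case i of [] \<Rightarrow> (fst (fst p), real (snd (fst p)),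
        combine (fst p) (root_time (fst (snd p))) (root_time (snd (snd p))))
      | a # j \<Rightarrow> if a = 1 then fst (snd p) j else snd (snd p) j)
    \<in> mark_space \<Otimes>\<^sub>M (tree_borel \<Otimes>\<^sub>M tree_borel) \<rightarrow>\<^sub>M borel" if "i \<in> words" for i
  proof (cases i)
    case Nil
    then show ?thesis by simp measurable
  next
    case (Cons a j)
    then have "j \<in> words" using that by simp
    then show ?thesis unfolding Cons list.case by measurable
  qed
  from measurable_tree_borel[OF this]
  have "(\<lambda>p. \<lambda>i\<in>words. case i of [] \<Rightarrow> (fst (fst p), real (snd (fst p)),
        combine (fst p) (root_time (fst (snd p))) (root_time (snd (snd p))))
      | a # j \<Rightarrow> if a = 1 then fst (snd p) j else snd (snd p) j)
    \<in> mark_space \<Otimes>\<^sub>M (tree_borel \<Otimes>\<^sub>M tree_borel) \<rightarrow>\<^sub>M tree_borel" .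
  then show ?thesis
    by (rule measurable_cong[THEN iffD1, rotated]) (auto simp: fun_eq_iff restrict_def split: list.split)
qed

definition graft_law :: "sample_point measure \<Rightarrow> sample_point measure" where
  "graft_law Q = distr (mark_law \<Otimes>\<^sub>M (Q \<Otimes>\<^sub>M Q)) tree_borel graft"

lemma sets_graft_law [simp, measurable_cong]: "sets (graft_law Q) = sets tree_borel"
  by (simp add: graft_law_def)

lemma prob_space_mark_pair:
  assumes "prob_space Q" "prob_space R"
  shows "prob_space (mark_law \<Otimes>\<^sub>M (Q \<Otimes>\<^sub>M R))"
proof -
  interpret Q: prob_space Q by fact
  interpret R: prob_space R by fact
  interpret QR: pair_prob_space Q R ..
  interpret K: prob_space mark_law by (rule prob_space_mark_law)
  interpret pair_prob_space mark_law "Q \<Otimes>\<^sub>M R" ..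
  show ?thesis by (rule prob_space_axioms)
qed

lemma prob_space_graft_law:
  assumes "prob_space Q" "sets Q = sets tree_borel"
  shows "prob_space (graft_law Q)"
proof -
  note assms(2)[measurable_cong]
  show ?thesis unfolding graft_law_def
    by (rule prob_space.prob_space_distr[OF prob_space_mark_pair[OF assms(1,1)]]) measurable
qed

lemma mark_pair_distr:
  assumes "prob_space Q" "f \<in> Q \<rightarrow>\<^sub>M S"
  shows "mark_law \<Otimes>\<^sub>M (distr Q S f \<Otimes>\<^sub>M distr Q S f) =
    distr (mark_law \<Otimes>\<^sub>M (Q \<Otimes>\<^sub>M Q)) (mark_space \<Otimes>\<^sub>M (S \<Otimes>\<^sub>M S)) (\<lambda>(w, x, y). (w, f x, f y))"
proof -
  interpret Q: prob_space Q by fact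
  interpret Qf: prob_space "distr Q S f" by (rule Q.prob_space_distr) fact
  interpret QQ: pair_prob_space Q Q ..
  note [measurable] = assms(2)
  have QQ: "distr Q S f \<Otimes>\<^sub>M distr Q S f = distr (Q \<Otimes>\<^sub>M Q) (S \<Otimes>\<^sub>M S) (\<lambda>(x, y). (f x, f y))"
    by (rule pair_measure_distr) (auto intro: Qf.sigma_finite_measure_axioms assms)
  interpret D: prob_space "distr (Q \<Otimes>\<^sub>M Q) (S \<Otimes>\<^sub>M S) (\<lambda>(x, y). (f x, f y))"
    by (rule QQ.prob_space_distr) measurable
  have "mark_law = distr mark_law mark_space (\<lambda>w. w)"
    by (rule distr_id2[symmetric]) simp
  then have "mark_law \<Otimes>\<^sub>M (distr Q S f \<Otimes>\<^sub>M distr Q S f) =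
      distr mark_law mark_space (\<lambda>w. w) \<Otimes>\<^sub>M distr (Q \<Otimes>\<^sub>M Q) (S \<Otimes>\<^sub>M S) (\<lambda>(x, y). (f x, f y))"
    unfolding QQ by simp
  also have "\<dots> = distr (mark_law \<Otimes>\<^sub>M (Q \<Otimes>\<^sub>M Q)) (mark_space \<Otimes>\<^sub>M (S \<Otimes>\<^sub>M S))
      (\<lambda>(w, p). (w, (\<lambda>(x, y). (f x, f y)) p))"
    by (rule pair_measure_distr) (auto intro: D.sigma_finite_measure_axioms)
  also have "(\<lambda>(w, p). (w, (\<lambda>(x, y). (f x, f y)) p)) = (\<lambda>(w :: real \<times> nat, x, y). (w, f x, f y))"
    by auto
  finally show ?thesis .
qed

lemma graft_law_distr:
  assumes "prob_space Q" "f \<in> Q \<rightarrow>\<^sub>M tree_borel"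
  shows "graft_law (distr Q tree_borel f) =
    distr (mark_law \<Otimes>\<^sub>M (Q \<Otimes>\<^sub>M Q)) tree_borel (\<lambda>(w, x, y). graft (w, f x, f y))"
proof -
  note [measurable] = assms(2)
  show ?thesis
    unfolding graft_law_def mark_pair_distr[OF assms]
    by (subst distr_distr) (auto simp: comp_def case_prod_beta simp del: graft.simps intro!: distr_cong)
qed

definition root_law :: "sample_point measure \<Rightarrow> real measure" where
  "root_law Q = distr Q borel root_time"

definition combine_law :: "real measure \<Rightarrow> real measure" where
  "combine_law \<rho> = distr (mark_law \<Otimes>\<^sub>M (\<rho> \<Otimes>\<^sub>M \<rho>)) borel (\<lambda>(w, x, y). combine w x y)"

text \<open>The root time of a graft depends on the two subtrees only through their root times, so
  invariance of a tree law projects to a fixed point equation on the line.\<close>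

lemma root_law_graft_law:
  assumes "prob_space Q" "sets Q = sets tree_borel"
  shows "root_law (graft_law Q) = combine_law (root_law Q)"
proof -
  note assms(2)[measurable_cong]
  have "root_law (graft_law Q) = distr (mark_law \<Otimes>\<^sub>M (Q \<Otimes>\<^sub>M Q)) borel
      (\<lambda>(w, x, y). combine w (root_time x) (root_time y))"
    unfolding root_law_def graft_law_def
    by (subst distr_distr) (auto simp: comp_def case_prod_beta intro!: distr_cong)
  also have "\<dots> = combine_law (root_law Q)"
    unfolding root_law_def combine_law_def
    by (subst mark_pair_distr[OF assms(1)], measurable)
      (subst distr_distr, auto simp: comp_def case_prod_beta intro!: distr_cong)
  finally show ?thesis .
qed

text \<open>
  At depth \<^term>\<open>n\<close> only the times are kept: by the recursion they determine, together with the
  marks below depth \<^term>\<open>n\<close>, all earlier times.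
\<close>

definition truncate :: "nat \<Rightarrow> sample_point \<Rightarrow> sample_point" where
  "truncate n x = (\<lambda>i\<in>words. if length i < n then x i
     else if length i = n then (0, 0, snd (snd (x i))) else (0, 0, 0))"

lemma truncate_graft: "truncate (Suc n) (graft (w, x, y)) = graft (w, truncate n x, truncate n y)"
  by (rule ext) (auto simp: truncate_def restrict_def split: list.splits)

lemma truncate_truncate: "n \<le> m \<Longrightarrow> truncate n (truncate m x) = truncate n x"
  by (rule ext) (auto simp: truncate_def)

lemma measurable_truncate_PiM:
  assumes "{i \<in> words. length i \<le> n} \<subseteq> J"
  shows "truncate n \<in> (\<Pi>\<^sub>M i\<in>J. borel) \<rightarrow>\<^sub>M tree_borel"
proof -
  have "(\<lambda>x. if length i < n then x i else if length i = n then (0, 0, snd (snd (x i))) else (0, 0, 0))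
      \<in> (\<Pi>\<^sub>M i\<in>J. borel :: (real \<times> real \<times> real) measure) \<rightarrow>\<^sub>M borel" if "i \<in> words" for i
  proof (cases "length i \<le> n")
    case True
    then have "i \<in> J" using that assms by auto
    then have "(\<lambda>x. x i) \<in> (\<Pi>\<^sub>M i\<in>J. borel :: (real \<times> real \<times> real) measure) \<rightarrow>\<^sub>M borel"
      by (rule measurable_component_singleton)
    note this[measurable] measurable_triple(3)[OF this, measurable]
    show ?thesis by (cases "length i < n"; cases "length i = n"; simp)
  qed simp
  from measurable_tree_borel[OF this] show ?thesis unfolding truncate_def .
qed

lemma measurable_truncate [measurable]: "truncate n \<in> tree_borel \<rightarrow>\<^sub>M tree_borel"
  using measurable_truncate_PiM[of n words] by (simp add: tree_borel_def)

text \<open>Truncation commutes with grafting, with one level gained; this drives the inductions on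
  depth.\<close>

lemma distr_truncate_graft_law:
  assumes "prob_space Q" "sets Q = sets tree_borel"
  shows "distr (graft_law Q) tree_borel (truncate (Suc n)) = graft_law (distr Q tree_borel (truncate n))"
proof -
  note assms(2)[measurable_cong]
  have "truncate n \<in> Q \<rightarrow>\<^sub>M tree_borel" by measurable
  then show ?thesis
    unfolding graft_law_distr[OF assms(1) \<open>truncate n \<in> Q \<rightarrow>\<^sub>M tree_borel\<close>] unfolding graft_law_def
    by (subst distr_distr) (auto simp: comp_def case_prod_beta truncate_graft[symmetric] simp del: graft.simps intro!: distr_cong)
qed

text \<open>At depth 0 nothing but the root time is kept.\<close>

lemma distr_truncate_0_cong:
  assumes "sets Q = sets tree_borel" "sets R = sets tree_borel" "root_law Q = root_law R"
  shows "distr Q tree_borel (truncate 0) = distr R tree_borel (truncate 0)"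
proof -
  define h :: "real \<Rightarrow> sample_point" where "h y = (\<lambda>i\<in>words. (0, 0, if i = [] then y else 0))" for y
  have h: "h \<in> borel \<rightarrow>\<^sub>M tree_borel"
    unfolding h_def by (rule measurable_tree_borel) measurable
  have eq: "truncate 0 = h \<circ> root_time" by (auto simp: truncate_def h_def fun_eq_iff)
  have "distr Q tree_borel (truncate 0) = distr (root_law Q) tree_borel h" if "sets Q = sets tree_borel" for Q
    unfolding eq root_law_def using h that by (subst distr_distr) (auto cong: measurable_cong_sets)
  with assms show ?thesis by simp
qed

text \<open>Finite-dimensional cylinders determine the law, and finitely many coordinates are left
  untouched by a deep enough truncation.\<close>

lemma tree_law_eqI:
  assumes "prob_space Q" "sets Q = sets tree_borel" "sets R = sets tree_borel"
    and eq: "\<And>n. distr Q tree_borel (truncate n) = distr R tree_borel (truncate n)"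
  shows "Q = R"
proof (rule measure_eqI_PiM_infinite[where M = "\<lambda>_. borel" and I = words])
  show "sets Q = sets (Pi\<^sub>M words (\<lambda>_. borel))" "sets R = sets (Pi\<^sub>M words (\<lambda>_. borel))"
    using assms by (auto simp: tree_borel_def)
  show "finite_measure Q" using assms(1) by (simp add: prob_space.finite_measure)
  fix A :: "nat list \<Rightarrow> (real \<times> real \<times> real) set" and J
  assume J: "finite J" "J \<subseteq> words" "\<And>i. i \<in> J \<Longrightarrow> A i \<in> sets borel"
  define E where "E = prod_emb words (\<lambda>_. borel :: (real \<times> real \<times> real) measure) J (Pi\<^sub>E J A)"
  define n where "n = Suc (Max (insert 0 (length ` J)))"
  have n: "length i < n" if "i \<in> J" for i
    using that J(1) by (auto simp: n_def less_Suc_eq_le intro!: Max_ge)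
  have E: "E \<in> sets tree_borel" unfolding E_def tree_borel_def using J by (intro sets_PiM_I) auto
  have "truncate n -` E \<inter> space tree_borel = E"
  proof -
    have "x \<in> E \<longleftrightarrow> x \<in> space tree_borel \<and> (\<forall>i\<in>J. x i \<in> A i)" for x
      by (auto simp: E_def prod_emb_def tree_borel_def space_PiM PiE_iff)
    moreover have "truncate n x \<in> space tree_borel" for x
      by (auto simp: tree_borel_def space_PiM truncate_def)
    moreover have "truncate n x i = x i" if "i \<in> J" for i x
      using n[OF that] that J(2) by (auto simp: truncate_def)
    ultimately show ?thesis by auto
  qed
  then have "emeasure S E = emeasure (distr S tree_borel (truncate n)) E" if "sets S = sets tree_borel" for S
    using E sets_eq_imp_space_eq[OF that] that
    by (subst emeasure_distr) (auto cong: measurable_cong_sets)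
  then show "emeasure Q (prod_emb words (\<lambda>_. borel) J (Pi\<^sub>E J A)) = emeasure R (prod_emb words (\<lambda>_. borel) J (Pi\<^sub>E J A))"
    using assms(2,3) eq[of n] unfolding E_def[symmetric] by metis
qed

section \<open>Uniqueness and existence of invariant tree laws\<close>

text \<open>Invariance under grafting packs the recursion for the times, stationarity and the
  independence at the root into one equation.\<close>

definition fixed_law :: "sample_point measure \<Rightarrow> bool" where
  "fixed_law Q \<longleftrightarrow> prob_space Q \<and> sets Q = sets tree_borel \<and> graft_law Q = Q"

text \<open>Agreement of the root laws is agreement at depth 0; each application of the invariance
  propagates it one level further down.\<close>

theorem fixed_law_unique:
  assumes Q: "fixed_law Q" and R: "fixed_law R" and eq: "root_law Q = root_law R"
  shows "Q = R"
proof (rule tree_law_eqI)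
  show Q': "prob_space Q" "sets Q = sets tree_borel" and R': "sets R = sets tree_borel"
    using Q R by (auto simp: fixed_law_def)
  show "distr Q tree_borel (truncate n) = distr R tree_borel (truncate n)" for n
  proof (induction n)
    case 0
    show ?case using distr_truncate_0_cong[OF Q'(2) R' eq] .
  next
    case (Suc n)
    then show ?case
      using distr_truncate_graft_law[of Q n] distr_truncate_graft_law[of R n] Q R by (simp add: fixed_law_def)
  qed
qed

lemma distr_restrict_truncate:
  assumes Q: "sets Q = sets tree_borel" and J: "J \<subseteq> words" "\<And>i. i \<in> J \<Longrightarrow> length i < n"
  shows "distr Q (\<Pi>\<^sub>M i\<in>J. borel) (\<lambda>x. restrict x J) =
    distr (distr Q tree_borel (truncate n)) (\<Pi>\<^sub>M i\<in>J. borel) (\<lambda>x. restrict x J)"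
proof -
  note Q[measurable_cong]
  have [measurable]: "(\<lambda>x. restrict x J) \<in> tree_borel \<rightarrow>\<^sub>M (\<Pi>\<^sub>M i\<in>J. borel)"
    unfolding tree_borel_def using J(1) by (rule measurable_restrict_subset)
  have "restrict (truncate n x) J = restrict x J" for x
    using J by (auto simp: truncate_def restrict_def fun_eq_iff)
  then show ?thesis by (subst distr_distr) (auto simp: comp_def)
qed

text \<open>Iterating \<open>graft_law\<close> from a tree with root law \<open>\<rho>\<close>
  changes nothing near the root: as \<open>\<rho>\<close> is a fixed point, the law truncated at
  depth \<open>n\<close> is settled after \<open>n\<close> steps. The settled laws form a projective
  family, whose limit inherits the invariance.\<close>

theorem fixed_law_exists:
  assumes \<rho>: "prob_space \<rho>" "sets \<rho> = sets borel" "combine_law \<rho> = \<rho>"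
  obtains Q where "fixed_law Q" "root_law Q = \<rho>"
proof -
  \<comment> \<open>Only the root value of this initial tree enters \<open>q n\<close> truncated at
    depth \<open>n\<close>; the other entries are placeholders.\<close>
  define h :: "real \<Rightarrow> sample_point" where "h y = (\<lambda>i\<in>words. (0, 0, y))" for y
  have [measurable]: "h \<in> borel \<rightarrow>\<^sub>M tree_borel"
    unfolding h_def by (rule measurable_tree_borel) measurable
  note \<rho>(2)[measurable_cong]
  define q where "q = rec_nat (distr \<rho> tree_borel h) (\<lambda>_. graft_law)"
  have q_rec: "q 0 = distr \<rho> tree_borel h" "q (Suc n) = graft_law (q n)" for n by (simp_all add: q_def)
  have sets_q [simp, measurable_cong]: "sets (q n) = sets tree_borel" for n
    by (cases n) (simp_all add: q_rec)
  have prob_q: "prob_space (q n)" for n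
  proof (induction n)
    case 0
    show ?case unfolding q_rec by (rule prob_space.prob_space_distr[OF \<rho>(1)]) measurable
  qed (simp add: q_rec prob_space_graft_law)
  have root_q: "root_law (q n) = \<rho>" for n
  proof (induction n)
    case 0
    have "distr \<rho> borel (root_time \<circ> h) = distr \<rho> borel (\<lambda>y. y)" by (simp add: h_def comp_def)
    then show ?case using \<rho>(2) by (simp add: q_rec root_law_def distr_distr distr_id2)
  next
    case (Suc n)
    then show ?case using \<rho>(3) by (simp add: q_rec root_law_graft_law prob_q)
  qed
  have step: "distr (q (Suc n)) tree_borel (truncate n) = distr (q n) tree_borel (truncate n)" for n
  proof (induction n)
    case 0
    show ?case by (rule distr_truncate_0_cong) (auto simp: root_q)
  next
    case (Suc n)
    then show ?case
      using distr_truncate_graft_law[OF prob_q sets_q, of n n] distr_truncate_graft_law[OF prob_q sets_q, of "Suc n" n]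
      by (simp add: q_rec)
  qed
  have trunc: "distr (q m) tree_borel (truncate n) = distr (q n) tree_borel (truncate n)" if "n \<le> m" for n m
    using that
  proof (induction m rule: dec_induct)
    case (step m)
    have "distr (q k) tree_borel (truncate n) =
        distr (distr (q k) tree_borel (truncate m)) tree_borel (truncate n)" for k
      using step.hyps by (subst distr_distr) (auto simp: comp_def truncate_truncate)
    with step.IH \<open>\<And>n. distr (q (Suc n)) tree_borel (truncate n) = distr (q n) tree_borel (truncate n)\<close>
    show ?case by metis
  qed simp
  define b :: "nat list set \<Rightarrow> nat" where "b J = Suc (Max (insert 0 (length ` J)))" for J
  have b: "length i < b J" if "finite J" "i \<in> J" for i J
    using that by (auto simp: b_def less_Suc_eq_le intro!: Max_ge)
  \<comment> \<open>The depth \<open>b J\<close> lies beyond all words of \<open>J\<close>;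
    \<open>P_eq\<close> shows that any other such depth yields the same law.\<close>
  define P :: "nat list set \<Rightarrow> sample_point measure"
    where "P J = distr (q (b J)) (\<Pi>\<^sub>M i\<in>J. borel) (\<lambda>x. restrict x J)" for J
  have P_eq: "P J = distr (q m) (\<Pi>\<^sub>M i\<in>J. borel) (\<lambda>x. restrict x J)"
    if J: "finite J" "J \<subseteq> words" "\<And>i. i \<in> J \<Longrightarrow> length i < m" for J m
  proof -
    define k where "k = min m (b J)"
    have k: "length i < k" if "i \<in> J" for i using J(3) b[OF J(1)] that by (simp add: k_def)
    have "k \<le> m" "k \<le> b J" by (auto simp: k_def)
    then show ?thesis
      unfolding P_def using J(2) k trunc[of k m] trunc[of k "b J"]
        distr_restrict_truncate[OF sets_q J(2) k, of "b J"] distr_restrict_truncate[OF sets_q J(2) k, of m]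
      by simp
  qed
  have meas_restrict [measurable]: "(\<lambda>x. restrict x J) \<in> tree_borel \<rightarrow>\<^sub>M (\<Pi>\<^sub>M i\<in>J. borel)" if "J \<subseteq> words" for J
    unfolding tree_borel_def using that by (rule measurable_restrict_subset)
  interpret polish_projective words P
  proof (intro polish_projective.intro projective_family.intro)
    fix J H :: "nat list set" assume JH: "J \<subseteq> H" "finite H" "H \<subseteq> words"
    have J: "finite J" "J \<subseteq> words" using JH finite_subset by auto
    have 1: "P J = distr (q (b H)) (\<Pi>\<^sub>M i\<in>J. borel) (\<lambda>x. restrict x J)"
      using J b[OF JH(2)] JH(1) by (intro P_eq) auto
    have "(\<lambda>x. restrict x J) \<in> (\<Pi>\<^sub>M i\<in>H. borel) \<rightarrow>\<^sub>M (\<Pi>\<^sub>M i\<in>J. borel :: (real \<times> real \<times> real) measure)"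
      using JH(1) by (rule measurable_restrict_subset)
    then show "P J = distr (P H) (\<Pi>\<^sub>M i\<in>J. borel) (\<lambda>x. restrict x J)"
      unfolding 1 unfolding P_def using meas_restrict[OF JH(3)] JH(1)
      by (subst distr_distr) (auto simp: comp_def Int_absorb1 cong: measurable_cong_sets)
  next
    fix J :: "nat list set" assume "finite J" "J \<subseteq> words"
    then have "(\<lambda>x. restrict x J) \<in> q (b J) \<rightarrow>\<^sub>M (\<Pi>\<^sub>M i\<in>J. borel)"
      using meas_restrict by (simp cong: measurable_cong_sets)
    then show "prob_space (P J)"
      unfolding P_def by (rule prob_space.prob_space_distr[OF prob_q])
  qed
  have sets_lim': "sets lim = sets tree_borel" by (simp add: tree_borel_def)
  note this[measurable_cong]
  have meas_lim: "(\<lambda>x. restrict x J) \<in> lim \<rightarrow>\<^sub>M (\<Pi>\<^sub>M i\<in>J. borel)" if "J \<subseteq> words" for J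
    using meas_restrict[OF that] measurable_cong_sets[OF sets_lim' refl] by blast
  have distr_lim: "distr lim (\<Pi>\<^sub>M i\<in>J. borel) (\<lambda>x. restrict x J) = P J" if J: "finite J" "J \<subseteq> words" for J
  proof (rule measure_eqI)
    fix X assume "X \<in> sets (distr lim (\<Pi>\<^sub>M i\<in>J. borel) (\<lambda>x. restrict x J))"
    then have X: "X \<in> sets (\<Pi>\<^sub>M i\<in>J. borel)" by simp
    have "emeasure (distr lim (\<Pi>\<^sub>M i\<in>J. borel) (\<lambda>x. restrict x J)) X = emeasure lim (emb words J X)"
      using X meas_lim[OF J(2)] by (subst emeasure_distr) (auto simp: prod_emb_def space_PiM)
    then show "emeasure (distr lim (\<Pi>\<^sub>M i\<in>J. borel) (\<lambda>x. restrict x J)) X = emeasure (P J) X"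
      using emeasure_lim_emb[OF J(2,1) X] by simp
  qed (simp add: P_def)
  \<comment> \<open>Truncation at depth \<open>n\<close> reads finitely many coordinates, so its law
    under the limit is given by the projective family.\<close>
  have trunc_lim: "distr lim tree_borel (truncate n) = distr (q n) tree_borel (truncate n)" for n
  proof -
    let ?J = "{i \<in> words. length i \<le> n}"
    have J: "finite ?J" "?J \<subseteq> words"
      using finite_lists_length_le[of "{1, 2::nat}" n] by (auto simp: words_def lists_eq_set)
    have tr: "truncate n \<in> (\<Pi>\<^sub>M i\<in>?J. borel) \<rightarrow>\<^sub>M tree_borel" by (rule measurable_truncate_PiM) simp
    have eq: "truncate n \<circ> (\<lambda>x. restrict x ?J) = truncate n"
      by (auto simp: truncate_def fun_eq_iff)
    have split: "distr S tree_borel (truncate n) =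
        distr (distr S (\<Pi>\<^sub>M i\<in>?J. borel) (\<lambda>x. restrict x ?J)) tree_borel (truncate n)"
      if "sets S = sets tree_borel" for S
      using tr meas_restrict[OF J(2)] that by (subst distr_distr) (auto simp: eq cong: measurable_cong_sets)
    have "distr lim tree_borel (truncate n) = distr (q (Suc n)) tree_borel (truncate n)"
      using split[OF sets_lim'] split[OF sets_q, of "Suc n"] distr_lim[OF J] P_eq[OF J, of "Suc n"] by simp
    then show ?thesis using trunc[of n "Suc n"] by simp
  qed
  have root: "root_law S = \<rho>" if "sets S = sets tree_borel"
      "distr S tree_borel (truncate 0) = distr (q 0) tree_borel (truncate 0)" for S
  proof -
    have "root_law R = root_law (distr R tree_borel (truncate 0))" if "sets R = sets tree_borel" for R
    proof -
      note that[measurable_cong]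
      have "root_time \<circ> truncate 0 = root_time" by (auto simp: truncate_def fun_eq_iff)
      then show ?thesis unfolding root_law_def by (subst distr_distr) auto
    qed
    then show ?thesis using that root_q[of 0] sets_q by metis
  qed
  have root_lim: "root_law lim = \<rho>" by (rule root[OF sets_lim' trunc_lim])
  have prob_lim: "prob_space lim" by (rule P.prob_space_axioms)
  \<comment> \<open>Depth 0 is the fixed point equation for \<open>\<rho>\<close>. Depth
    \<open>m + 1\<close> of the graft involves only depth \<open>m\<close> of the limit, where it
    agrees with \<open>q m\<close>.\<close>
  have "graft_law lim = lim"
  proof (rule tree_law_eqI)
    show "prob_space (graft_law lim)" by (rule prob_space_graft_law[OF prob_lim sets_lim'])
    show "distr (graft_law lim) tree_borel (truncate n) = distr lim tree_borel (truncate n)" for n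
    proof (cases n)
      case 0
      have "root_law (graft_law lim) = \<rho>"
        using root_law_graft_law[OF prob_lim sets_lim'] root_lim \<rho>(3) by simp
      then show ?thesis unfolding 0 by (intro distr_truncate_0_cong sets_lim' sets_graft_law) (simp add: root_lim)
    next
      case (Suc m)
      then show ?thesis
        using distr_truncate_graft_law[OF prob_lim sets_lim', of m] trunc_lim[of m] trunc_lim[of n]
          distr_truncate_graft_law[OF prob_q sets_q, of m m] by (simp add: q_rec)
    qed
  qed (rule sets_graft_law sets_lim')+
  then have "fixed_law lim" using prob_lim sets_lim' by (simp add: fixed_law_def)
  then show thesis using that root_lim by blast
qed

lemma measure_mark_pair_times:
  assumes "prob_space Q" "prob_space R" "A \<in> sets mark_space" "B \<in> sets Q" "C \<in> sets R"
  shows "measure (mark_law \<Otimes>\<^sub>M (Q \<Otimes>\<^sub>M R)) (A \<times> B \<times> C) = measure mark_law A * measure Q B * measure R C"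
proof -
  interpret Q: prob_space Q by fact
  interpret R: prob_space R by fact
  interpret QR: pair_prob_space Q R ..
  show ?thesis
    using assms by (simp add: measure_def QR.emeasure_pair_measure_Times R.emeasure_pair_measure_Times
      enn2real_mult)
qed

lemma measure_mark_law_times:
  assumes "A \<in> sets borel" "k \<in> {1, 2}"
  shows "measure mark_law (A \<times> {k}) = measure lborel ({0..1} \<inter> A) / 2"
proof -
  interpret U: prob_space "uniform_measure lborel {0..1::real}" by (rule prob_space_unit_uniform)
  interpret C: prob_space "uniform_count_measure {1, 2::nat}"
    by (rule prob_space_uniform_count_measure) auto
  have "emeasure (uniform_measure lborel {0..1::real} \<Otimes>\<^sub>M uniform_count_measure {1, 2::nat}) (A \<times> {k}) =
      emeasure (uniform_measure lborel {0..1}) A * emeasure (uniform_count_measure {1, 2::nat}) {k}"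
    using assms by (intro C.emeasure_pair_measure_Times) (auto simp: sets_uniform_count_measure)
  then have "measure mark_law (A \<times> {k}) =
      measure (uniform_measure lborel {0..1}) A * measure (uniform_count_measure {1, 2::nat}) {k}"
    by (simp add: measure_def mark_law_def enn2real_mult)
  also have "measure (uniform_measure lborel {0..1}) A = measure lborel ({0..1} \<inter> A)"
    using assms(1) by (subst measure_uniform_measure) auto
  also have "measure (uniform_count_measure {1, 2::nat}) {k} = 1 / 2"
    using assms(2) by (subst measure_uniform_count_measure) auto
  finally show ?thesis by simp
qed

lemma sets_mark_times:
  assumes "A \<in> sets borel" "k \<in> {1, 2}"
  shows "A \<times> {k} \<in> sets mark_space"
  unfolding mark_space_def using assms by (intro pair_measureI) auto

text \<open>The distribution function of the uniform law on the unit interval.\<close>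

definition unit_clamp :: "real \<Rightarrow> real" where "unit_clamp t = min 1 (max 0 t)"

lemma measure_mark_law_le:
  assumes "k \<in> {1, 2}"
  shows "measure mark_law ({..t} \<times> {k}) = unit_clamp t / 2" "measure mark_law ({..<t} \<times> {k}) = unit_clamp t / 2"
    "measure mark_law (UNIV \<times> {k}) = 1 / 2"
proof -
  have "measure lborel ({0..1} \<inter> {..t}) = unit_clamp t"
  proof -
    have "{0..1} \<inter> {..t} = {0..min 1 t}" by auto
    then show ?thesis by (simp add: unit_clamp_def)
  qed
  moreover have "measure lborel ({0..1} \<inter> {..<t}) = unit_clamp t"
  proof -
    have "{0..1} \<inter> {..<t} = (if t \<le> 1 then {0..<t} else {0..1})" by auto
    then show ?thesis by (cases "0 \<le> t") (auto simp: unit_clamp_def)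
  qed
  ultimately show "measure mark_law ({..t} \<times> {k}) = unit_clamp t / 2" "measure mark_law ({..<t} \<times> {k}) = unit_clamp t / 2"
    "measure mark_law (UNIV \<times> {k}) = 1 / 2"
    using assms by (simp_all add: measure_mark_law_times)
qed

subsection \<open>The recursive distributional equation\<close>

lemma measurable_combine_borel [measurable]:
  "(\<lambda>(w, x, y). combine w x y) \<in> mark_space \<Otimes>\<^sub>M (borel \<Otimes>\<^sub>M borel) \<rightarrow>\<^sub>M borel"
  by measurable

text \<open>Type 2 contributes the exact quadratic term. The type 1 contribution \<open>X\<close> is
  half the integral of \<open>unit_clamp\<close> over the interval; instead of forming the integral,
  it is squeezed between the events \<open>\<tau> \<le> u\<close> and \<open>\<tau> < t\<close>. As
  \<open>t < 2\<close>, frozen words do not count.\<close>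

lemma combine_law_interval:
  fixes \<rho> :: "real measure"
  assumes \<rho>: "prob_space \<rho>" "sets \<rho> = sets borel" and t: "u \<le> t" "t < 2"
  defines "G \<equiv> cdf \<rho>"
  obtains X where "cdf (combine_law \<rho>) t - cdf (combine_law \<rho>) u = X + ((1 - G u)\<^sup>2 - (1 - G t)\<^sup>2) / 2"
    "unit_clamp u * (G t - G u) / 2 \<le> X" "X \<le> unit_clamp t * (G t - G u) / 2"
proof -
  interpret \<rho>: prob_space \<rho> by fact
  have sp: "space \<rho> = UNIV" using sets_eq_imp_space_eq[OF \<rho>(2)] by simp
  note [measurable_cong] = \<rho>(2)
  interpret R: finite_borel_measure \<rho>
    by unfold_locales (use \<rho>(2) in simp)
  let ?P = "mark_law \<Otimes>\<^sub>M (\<rho> \<Otimes>\<^sub>M \<rho>)"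
  interpret P: prob_space ?P by (rule prob_space_mark_pair) fact+
  interpret L: prob_space "combine_law \<rho>"
    unfolding combine_law_def by (rule P.prob_space_distr) measurable
  interpret L: finite_borel_measure "combine_law \<rho>"
    by unfold_locales (simp add: combine_law_def)
  have gt: "measure \<rho> {s<..} = 1 - G s" for s
  proof -
    have "{s<..} = space \<rho> - {..s}" using sp by auto
    then show ?thesis using \<rho>.prob_compl[of "{..s}"] \<rho>(2) by (simp add: G_def cdf_def)
  qed
  have Ioc: "measure \<rho> {u<..t} = G t - G u"
    using R.cdf_diff_eq[of u t] t by (cases "u = t") (auto simp: G_def)
  define A where "A = {p \<in> space ?P. snd (fst p) = 1 \<and> fst (fst p) < fst (snd p) \<and> u < fst (snd p) \<and> fst (snd p) \<le> t}"
  define C :: "real \<Rightarrow> ((real \<times> nat) \<times> real \<times> real) set"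
    where "C s = (UNIV \<times> {2}) \<times> {s<..} \<times> {s<..}" for s
  have Asets [measurable]: "A \<in> sets ?P" unfolding A_def by measurable
  have rect: "W \<times> B \<times> D \<in> sets ?P" if "W \<in> sets mark_space" "B \<in> sets borel" "D \<in> sets borel" for W B D
    using that \<rho>(2) by (intro pair_measureI) auto
  have rect_measure: "P.prob (W \<times> B \<times> D) = measure mark_law W * measure \<rho> B * measure \<rho> D"
    if "W \<in> sets mark_space" "B \<in> sets borel" "D \<in> sets borel" for W B D
    using that \<rho> by (intro measure_mark_pair_times) auto
  have Csets [measurable]: "C s \<in> sets ?P" for s
    unfolding C_def by (intro rect sets_mark_times) auto
  have Cm: "P.prob (C s) = (1 - G s)\<^sup>2 / 2" for s
    unfolding C_def by (subst rect_measure)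
      (auto intro: sets_mark_times simp: measure_mark_law_le gt power2_eq_square)
  have Csub: "C t \<subseteq> C u" using t by (auto simp: C_def)
  have vim: "(\<lambda>(w, x, y). combine w x y) -` {u<..t} \<inter> space ?P = A \<union> (C u - C t)"
  proof (rule set_eqI)
    fix p :: "(real \<times> nat) \<times> real \<times> real"
    obtain a k x y where p: "p = ((a, k), x, y)" by (metis surj_pair)
    have sP: "p \<in> space ?P \<longleftrightarrow> k = 1 \<or> k = 2"
      by (auto simp: p space_pair_measure space_mark_law sp)
    have "p \<in> A \<longleftrightarrow> k = 1 \<and> a < x \<and> u < x \<and> x \<le> t"
      unfolding A_def mem_Collect_eq sP by (auto simp: p)
    moreover have "p \<in> C s \<longleftrightarrow> k = 2 \<and> s < x \<and> s < y" for s by (auto simp: p C_def)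
    moreover have "u < combine (a, k) x y \<and> combine (a, k) x y \<le> t \<longleftrightarrow>
        (k = 1 \<and> a < x \<and> u < x \<and> x \<le> t) \<or> (k = 2 \<and> u < x \<and> u < y \<and> \<not> (t < x \<and> t < y))"
      if "k = 1 \<or> k = 2"
      using that t(2) by (auto simp: combine_def)
    ultimately show "p \<in> (\<lambda>(w, x, y). combine w x y) -` {u<..t} \<inter> space ?P \<longleftrightarrow> p \<in> A \<union> (C u - C t)"
      using sP by (auto simp: p)
  qed
  have "cdf (combine_law \<rho>) t - cdf (combine_law \<rho>) u = L.prob {u<..t}"
    using L.cdf_diff_eq[of u t] t by (cases "u = t") auto
  also have "\<dots> = P.prob (A \<union> (C u - C t))"
    unfolding vim[symmetric] unfolding combine_law_def by (rule measure_distr) measurable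
  also have "\<dots> = P.prob A + P.prob (C u - C t)"
  proof (rule P.finite_measure_Union)
    show "A \<inter> (C u - C t) = {}" by (auto simp: A_def C_def)
  qed (rule Asets, intro sets.Diff Csets)
  also have "P.prob (C u - C t) = P.prob (C u) - P.prob (C t)"
    by (rule P.finite_measure_Diff) (rule Csets Csub)+
  finally have eq: "cdf (combine_law \<rho>) t - cdf (combine_law \<rho>) u =
      P.prob A + ((1 - G u)\<^sup>2 - (1 - G t)\<^sup>2) / 2"
    by (simp add: Cm diff_divide_distrib)
  have rA: "P.prob (({..u} \<times> {1}) \<times> {u<..t} \<times> UNIV) = unit_clamp u * (G t - G u) / 2"
      "P.prob (({..<t} \<times> {1}) \<times> {u<..t} \<times> UNIV) = unit_clamp t * (G t - G u) / 2"
    using \<rho>.prob_space sp by (simp_all add: rect_measure sets_mark_times measure_mark_law_le Ioc)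
  have "P.prob (({..u} \<times> {1}) \<times> {u<..t} \<times> UNIV) \<le> P.prob A"
  proof (rule P.finite_measure_mono[OF _ Asets], rule subsetI)
    fix p assume "p \<in> ({..u} \<times> {1::nat}) \<times> {u<..t} \<times> (UNIV :: real set)"
    then show "p \<in> A" by (auto simp: A_def space_pair_measure space_mark_law sp)
  qed
  moreover have "P.prob A \<le> P.prob (({..<t} \<times> {1}) \<times> {u<..t} \<times> UNIV)"
  proof (rule P.finite_measure_mono)
    show "A \<subseteq> ({..<t} \<times> {1}) \<times> {u<..t} \<times> UNIV"
      by (auto simp: A_def)
  qed (intro rect sets_mark_times; simp)
  ultimately show thesis using that[OF eq] rA by simp
qed

text \<open>Invariance cancels the linear terms and leaves \<open>2 * X\<close> as the increment of
  the squared distribution function. Up to time 0 the clamp vanishes, so the function is constant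
  there and equal to its limit 0.\<close>

lemma cdf_combine_invariant:
  assumes \<rho>: "prob_space \<rho>" "sets \<rho> = sets borel" "combine_law \<rho> = \<rho>"
  shows "0 \<le> u \<Longrightarrow> u \<le> t \<Longrightarrow> t \<le> 1 \<Longrightarrow> u * (cdf \<rho> t - cdf \<rho> u) \<le> (cdf \<rho> t)\<^sup>2 - (cdf \<rho> u)\<^sup>2"
    and "0 \<le> u \<Longrightarrow> u \<le> t \<Longrightarrow> t \<le> 1 \<Longrightarrow> (cdf \<rho> t)\<^sup>2 - (cdf \<rho> u)\<^sup>2 \<le> t * (cdf \<rho> t - cdf \<rho> u)"
    and "t \<le> 0 \<Longrightarrow> cdf \<rho> t = 0"
proof -
  let ?G = "cdf \<rho>"
  interpret R: real_distribution \<rho>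
    using \<rho> sets_eq_imp_space_eq[OF \<rho>(2)] by (simp add: real_distribution_def real_distribution_axioms_def)
  have bounds: "unit_clamp u * (?G t - ?G u) \<le> (?G t)\<^sup>2 - (?G u)\<^sup>2 \<and> (?G t)\<^sup>2 - (?G u)\<^sup>2 \<le> unit_clamp t * (?G t - ?G u)"
    if ut: "u \<le> t" "t \<le> 1" for u t
  proof -
    obtain X where "?G t - ?G u = X + ((1 - ?G u)\<^sup>2 - (1 - ?G t)\<^sup>2) / 2"
      "unit_clamp u * (?G t - ?G u) / 2 \<le> X" "X \<le> unit_clamp t * (?G t - ?G u) / 2"
      using combine_law_interval[OF \<rho>(1,2) ut(1)] ut(2) \<rho>(3) by auto
    moreover from this(1) have "2 * X = (?G t)\<^sup>2 - (?G u)\<^sup>2" by (simp add: power2_eq_square field_simps)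
    ultimately show ?thesis by linarith
  qed
  show "0 \<le> u \<Longrightarrow> u \<le> t \<Longrightarrow> t \<le> 1 \<Longrightarrow> u * (?G t - ?G u) \<le> (?G t)\<^sup>2 - (?G u)\<^sup>2"
    "0 \<le> u \<Longrightarrow> u \<le> t \<Longrightarrow> t \<le> 1 \<Longrightarrow> (?G t)\<^sup>2 - (?G u)\<^sup>2 \<le> t * (?G t - ?G u)"
    using bounds[of u t] by (auto simp: unit_clamp_def)
  have const: "?G u = ?G 0" if "u \<le> 0" for u
  proof -
    have "(?G 0)\<^sup>2 - (?G u)\<^sup>2 = 0" using bounds[of u 0] that by (simp add: unit_clamp_def)
    then show ?thesis using R.cdf_nonneg[of 0] R.cdf_nonneg[of u] by (simp add: power2_eq_iff_nonneg)
  qed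
  then have "\<forall>\<^sub>F u in at_bot. ?G u = ?G 0" by (intro eventually_mono[OF eventually_le_at_bot[of 0]])
  then have "(?G \<longlongrightarrow> ?G 0) at_bot" by (rule tendsto_eventually)
  then have "?G 0 = 0" using R.cdf_lim_at_bot tendsto_unique trivial_limit_at_bot_linorder by blast
  then show "t \<le> 0 \<Longrightarrow> ?G t = 0" using const[of t] by simp
qed

text \<open>
  A distribution function as above only bounds the increments of its square, so the recursive
  equation is recovered through partitions of vanishing mesh.
\<close>

lemma partition_zero:
  fixes f G :: "real \<Rightarrow> real"
  assumes "f 0 = 0" "0 \<le> t"
    and f: "\<And>u v. 0 \<le> u \<Longrightarrow> u \<le> v \<Longrightarrow> v \<le> t \<Longrightarrow> \<bar>f v - f u\<bar> \<le> (v - u) * (G v - G u)"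
  shows "f t = 0"
proof (rule ccontr)
  assume "f t \<noteq> 0"
  have bound: "\<bar>f t\<bar> * real (Suc n) \<le> t * (G t - G 0)" for n
  proof -
    define s where "s k = t * real k / real (Suc n)" for k
    have s: "0 \<le> s k" "s (Suc k) - s k = t / real (Suc n)" for k
      using \<open>0 \<le> t\<close> by (auto simp: s_def diff_divide_distrib[symmetric] algebra_simps)
    then have s_le: "s k \<le> s (Suc k)" for k
      using \<open>0 \<le> t\<close> by (metis diff_ge_0_iff_ge divide_nonneg_nonneg of_nat_0_le_iff)
    have st: "s k \<le> t" if "k \<le> Suc n" for k
    proof -
      have "t * real k \<le> t * real (Suc n)" using that \<open>0 \<le> t\<close> by (intro mult_left_mono) auto
      then show ?thesis by (simp add: s_def divide_le_eq)
    qed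
    have "\<bar>f (s k)\<bar> \<le> t / real (Suc n) * (G (s k) - G 0)" if "k \<le> Suc n" for k
      using that
    proof (induction k)
      case 0
      then show ?case by (simp add: s_def assms)
    next
      case (Suc k)
      have "\<bar>f (s (Suc k)) - f (s k)\<bar> \<le> t / real (Suc n) * (G (s (Suc k)) - G (s k))"
        using f[OF s(1) s_le st[OF Suc.prems]] s(2) by simp
      moreover have "\<bar>f (s k)\<bar> \<le> t / real (Suc n) * (G (s k) - G 0)" using Suc by simp
      moreover have "t / real (Suc n) * (G (s (Suc k)) - G (s k)) + t / real (Suc n) * (G (s k) - G 0) =
          t / real (Suc n) * (G (s (Suc k)) - G 0)"
        by (simp only: distrib_left[symmetric]) simp
      ultimately show ?case by linarith
    qed
    from this[of "Suc n"] have "\<bar>f t\<bar> \<le> t / real (Suc n) * (G t - G 0)" by (simp add: s_def)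
    then have "\<bar>f t\<bar> * real (Suc n) \<le> t / real (Suc n) * (G t - G 0) * real (Suc n)"
      by (intro mult_right_mono) auto
    then show ?thesis by simp
  qed
  obtain n where "t * (G t - G 0) < real n * \<bar>f t\<bar>" using ex_less_of_nat_mult[of "\<bar>f t\<bar>"] \<open>f t \<noteq> 0\<close> by auto
  also have "\<dots> \<le> \<bar>f t\<bar> * real (Suc n)" by (simp add: algebra_simps)
  finally show False using bound[of n] by simp
qed

text \<open>The missing mass is put at 2, the value of words that never burn. Increments of the
  distribution functions of \<open>\<rho>\<close> and of its image differ by at most the increment
  of \<open>unit_clamp\<close> times that of \<open>H\<close>. On \<open>[0, 1]\<close> this forces
  agreement by \<open>partition_zero\<close>; elsewhere below 2 the bound is 0.\<close>

lemma frozen_cdf_law: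
  assumes "\<Xi> \<subseteq> {0<..1}" and G: "frozen_cdf \<Xi> G" and rc: "\<And>x. continuous (at_right x) G" and le1: "\<And>x. G x \<le> 1"
  obtains \<rho> where "prob_space \<rho>" "sets \<rho> = sets borel" "combine_law \<rho> = \<rho>"
    "\<And>t. cdf \<rho> t = (if t < 2 then G t else 1)"
proof -
  define H where "H t = (if t < 2 then G t else 1)" for t
  have H_mono: "H x \<le> H y" if "x \<le> y" for x y
    using frozen_cdfD(1)[OF G that] le1 that by (auto simp: H_def)
  have H_rc: "continuous (at_right x) H" for x
  proof (cases "x < 2")
    case True
    then have "\<forall>\<^sub>F y in at_right x. G y = H y"
      by (intro eventually_at_rightI[of x 2]) (auto simp: H_def)
    then show ?thesis
      using rc[of x] True unfolding continuous_within
      by (subst (asm) tendsto_cong[where g = H]) (auto simp: H_def)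
  next
    case False
    then have "\<forall>\<^sub>F y in at_right x. 1 = H y"
      by (intro eventually_at_rightI[of x "x + 1"]) (auto simp: H_def)
    then show ?thesis
      using False tendsto_const[of "1 :: real" "at_right x"] unfolding continuous_within
      by (subst (asm) tendsto_cong[where g = H]) (auto simp: H_def)
  qed
  have H_bot: "(H \<longlongrightarrow> 0) at_bot"
    using frozen_cdfD(2)[OF G]
    by (intro tendsto_eventually eventually_mono[OF eventually_le_at_bot[of 0]]) (simp add: H_def)
  have H_top: "(H \<longlongrightarrow> 1) at_top"
    by (intro tendsto_eventually eventually_mono[OF eventually_ge_at_top[of 2]]) (simp add: H_def)
  define \<rho> where "\<rho> = interval_measure H"
  interpret \<rho>: real_distribution \<rho>
    unfolding \<rho>_def by (rule real_distribution_interval_measure) fact+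
  have cdf: "cdf \<rho> = H" unfolding \<rho>_def by (rule cdf_interval_measure) fact+
  have \<rho>: "prob_space \<rho>" "sets \<rho> = sets borel" by (rule \<rho>.prob_space_axioms) simp
  note [measurable_cong] = \<rho>(2)
  let ?P = "mark_law \<Otimes>\<^sub>M (\<rho> \<Otimes>\<^sub>M \<rho>)"
  interpret P: prob_space ?P by (rule prob_space_mark_pair) fact+
  interpret L: prob_space "combine_law \<rho>"
    unfolding combine_law_def by (rule P.prob_space_distr) measurable
  interpret L: real_distribution "combine_law \<rho>"
    by unfold_locales (simp_all add: combine_law_def)
  let ?K = "cdf (combine_law \<rho>)"
  have diff: "\<bar>(?K t - H t) - (?K u - H u)\<bar> \<le> (unit_clamp t - unit_clamp u) * (H t - H u)"
    if ut: "u \<le> t" "t < 2" "unit_clamp u * (H t - H u) \<le> (H t)\<^sup>2 - (H u)\<^sup>2" "(H t)\<^sup>2 - (H u)\<^sup>2 \<le> unit_clamp t * (H t - H u)" for u t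
  proof -
    obtain X where X: "?K t - ?K u = X + ((1 - H u)\<^sup>2 - (1 - H t)\<^sup>2) / 2"
      "unit_clamp u * (H t - H u) / 2 \<le> X" "X \<le> unit_clamp t * (H t - H u) / 2"
      using combine_law_interval[OF \<rho> ut(1,2)] unfolding cdf by auto
    have "(?K t - H t) - (?K u - H u) = X - ((H t)\<^sup>2 - (H u)\<^sup>2) / 2"
      using X(1) by (simp add: power2_eq_square field_simps)
    moreover have "\<bar>x - d / 2\<bar> \<le> a - b" if "b / 2 \<le> x" "x \<le> a / 2" "b \<le> d" "d \<le> a" for a b d x :: real
      using that by linarith
    from this[OF X(2,3) ut(3,4)] have "\<bar>X - ((H t)\<^sup>2 - (H u)\<^sup>2) / 2\<bar> \<le> (unit_clamp t - unit_clamp u) * (H t - H u)"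
      by (simp only: left_diff_distrib)
    ultimately show ?thesis by simp
  qed
  have low: "?K t = 0" if "t \<le> 0" for t
  proof -
    have "?K u = ?K 0" if "u \<le> 0" for u
      using diff[of u 0] that frozen_cdfD(2)[OF G] by (simp add: H_def)
    moreover from this have "(?K \<longlongrightarrow> ?K 0) at_bot"
      by (intro tendsto_eventually eventually_mono[OF eventually_le_at_bot[of 0]])
    then have "?K 0 = 0" using L.cdf_lim_at_bot tendsto_unique trivial_limit_at_bot_linorder by blast
    ultimately show ?thesis using that by simp
  qed
  have mid: "?K t - H t = 0" if t: "0 \<le> t" "t \<le> 1" for t
  proof (rule partition_zero[where f = "\<lambda>t. ?K t - H t" and G = H])
    show "?K 0 - H 0 = 0" using low[of 0] frozen_cdfD(2)[OF G] by (simp add: H_def)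
    fix u v assume uv: "0 \<le> u" "u \<le> v" "v \<le> t"
    then have "unit_clamp u = u" "unit_clamp v = v" "H u = G u" "H v = G v" using t by (auto simp: unit_clamp_def H_def)
    then show "\<bar>(?K v - H v) - (?K u - H u)\<bar> \<le> (v - u) * (H v - H u)"
      using diff[of u v] uv t frozen_cdfD(3,4)[OF G uv(1,2)] by auto
  qed fact
  have high: "?K t = H t" if t: "1 \<le> t" "t < 2" for t
  proof -
    have "{1<..t} \<inter> \<Xi> = {}" using assms(1) by force
    then have "H 1 = H t" using frozen_cdfD(6)[OF G, of 1 t] t by (simp add: H_def)
    then show ?thesis using diff[of 1 t] t mid[of 1] by auto
  qed
  have top: "?K t = 1" if t: "2 \<le> t" for t
  proof -
    \<comment> \<open>A combined value above \<open>t \<ge> 2\<close> can only be inherited, so it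
      forces the first argument above \<open>t\<close>.\<close>
    have "P.prob ((\<lambda>(w, x, y). combine w x y) -` {t<..} \<inter> space ?P) \<le> P.prob (space mark_law \<times> {t<..} \<times> UNIV)"
    proof (rule P.finite_measure_mono)
      show "space mark_law \<times> {t<..} \<times> UNIV \<in> P.events"
        by (intro pair_measureI sets.top) simp_all
    qed (use t in \<open>auto simp: combine_def space_pair_measure split: if_splits\<close>)
    also have "P.prob (space mark_law \<times> {t<..} \<times> UNIV) =
        measure mark_law (space mark_law) * measure \<rho> {t<..} * measure \<rho> (space \<rho>)"
      using sets.top[of mark_law] \<rho>(1)
      by (simp only: sets_mark_law \<rho>.space_eq_univ, intro measure_mark_pair_times) simp_all
    also have "\<dots> = measure \<rho> {t<..}"
      using \<rho>.prob_space prob_space.prob_space[OF prob_space_mark_law] by simp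
    also have "\<dots> = 1 - H t"
    proof -
      have "{t<..} = space \<rho> - {..t}" by auto
      moreover have "measure \<rho> {..t} = H t" using fun_cong[OF cdf, of t] by (simp add: cdf_def)
      ultimately show ?thesis using \<rho>.prob_compl[of "{..t}"] by simp
    qed
    also have "\<dots> = 0" using t by (simp add: H_def)
    finally have "L.prob {t<..} = 0"
      unfolding combine_law_def by (subst measure_distr) (auto intro: antisym)
    moreover have "{t<..} = space (combine_law \<rho>) - {..t}" by auto
    ultimately show ?thesis using L.prob_compl[of "{..t}"] by (simp add: cdf_def)
  qed
  have "?K t = H t" for t
    using low[of t] mid[of t] high[of t] top[of t] frozen_cdfD(2)[OF G, of t]
    by (cases "t \<le> 0"; cases "t \<le> 1"; cases "t < 2") (auto simp: H_def)
  then have "combine_law \<rho> = \<rho>"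
    by (intro cdf_unique L.real_distribution_axioms \<rho>.real_distribution_axioms) (auto simp: cdf)
  then show thesis using that[of \<rho>] \<rho> cdf by (simp add: H_def)
qed

declare graft.simps [simp del]

subsection \<open>Percolation on a tree with an invariant law\<close>

text \<open>Every real other than 1 is read as type 2, so that the decoded mark lies in
  \<open>mark_space\<close> at every sample point and not only almost surely.\<close>

definition mark_of :: "real \<times> real \<times> real \<Rightarrow> real \<times> nat" where
  "mark_of v = (fst v, if fst (snd v) = 1 then 1 else 2)"

definition tree_marks :: "sample_point \<Rightarrow> marks" where
  "tree_marks x i = mark_of (x i)"

definition tree_frozen :: "sample_point \<Rightarrow> nat list set" where
  "tree_frozen x = {i \<in> words. snd (tree_marks x i) = 1 \<and> snd (snd (x (i @ [1]))) \<le> fst (tree_marks x i)}"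

lemma measurable_mark_of [measurable]: "mark_of \<in> borel \<rightarrow>\<^sub>M mark_space"
  unfolding mark_of_def mark_space_def by measurable

lemma measurable_tree_marks:
  assumes "i \<in> words"
  shows "(\<lambda>x. tree_marks x i) \<in> tree_borel \<rightarrow>\<^sub>M mark_space"
  unfolding tree_marks_def using assms by measurable

lemma mark_of_eq [simp]: "k \<in> {1, 2} \<Longrightarrow> mark_of (t, real k, y) = (t, k)"
  by (auto simp: mark_of_def)

lemma pred_reach:
  assumes w: "\<And>i. i \<in> words \<Longrightarrow> (\<lambda>x. w x i) \<in> M \<rightarrow>\<^sub>M mark_space"
    and A: "\<And>i. i \<in> words \<Longrightarrow> Measurable.pred M (\<lambda>x. i \<in> A x)" and "i \<in> words"
  shows "Measurable.pred M (\<lambda>x. reach (w x) (A x) n i)"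
  using assms(3)
proof (induction n arbitrary: i)
  case (Suc n)
  note [measurable] = w[OF Suc.prems] A[OF Suc.prems]
  have [measurable]: "Measurable.pred M (\<lambda>x. reach (w x) (A x) n (i @ [j]))" if "j \<in> {1, 2}" for j
    using Suc that by auto
  show ?case unfolding reach.simps by measurable
qed simp

lemma pred_open_words:
  assumes "\<And>i. i \<in> words \<Longrightarrow> (\<lambda>x. w x i) \<in> M \<rightarrow>\<^sub>M mark_space" "i \<in> words"
    "\<And>i. i \<in> words \<Longrightarrow> Measurable.pred M (\<lambda>x. i \<in> F x)"
  shows "Measurable.pred M (\<lambda>x. i \<in> open_words (w x) t - F x)"
proof -
  note [measurable] = assms(1,3)[OF assms(2)]
  have "(i \<in> open_words (w x) t - F x) = ((snd (w x i) = 1 \<and> fst (w x i) \<le> t \<or> snd (w x i) = 2) \<and> i \<notin> F x)" for x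
    using assms(2) by (auto simp: open_words_def)
  then show ?thesis by simp
qed

lemma pred_burns:
  assumes "\<And>i. i \<in> words \<Longrightarrow> (\<lambda>x. w x i) \<in> M \<rightarrow>\<^sub>M mark_space"
    "\<And>i. i \<in> words \<Longrightarrow> Measurable.pred M (\<lambda>x. i \<in> F x)" "i \<in> words"
  shows "Measurable.pred M (\<lambda>x. burns (w x) (F x) t i)"
  unfolding percolates_iff_reach
  by (intro pred_intros_countable pred_reach pred_open_words assms) (use assms in auto)

lemma pred_tree_frozen: "i \<in> words \<Longrightarrow> Measurable.pred tree_borel (\<lambda>x. i \<in> tree_frozen x)"
proof -
  assume i: "i \<in> words"
  then have "i @ [1] \<in> words" by simp
  note child = measurable_triple(3)[OF measurable_component[OF measurable_ident this]]
  note mark = measurable_compose[OF measurable_tree_marks[OF i] measurable_mark_fst]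
    measurable_compose[OF measurable_tree_marks[OF i] measurable_mark_snd_UNIV]
  have eq: "(i \<in> tree_frozen x) = (snd (tree_marks x i) = 1 \<and> snd (snd (x (i @ [1]))) \<le> fst (tree_marks x i))" for x
    using i by (simp add: tree_frozen_def)
  have "Measurable.pred tree_borel (\<lambda>x. f x = 1 \<and> g x \<le> h x)"
    if [measurable]: "f \<in> tree_borel \<rightarrow>\<^sub>M count_space UNIV" "g \<in> borel_measurable tree_borel"
      "h \<in> borel_measurable tree_borel" for f :: "sample_point \<Rightarrow> nat" and g h :: "sample_point \<Rightarrow> real"
    unfolding not_less[symmetric] by measurable
  then show ?thesis unfolding eq using child mark by simp
qed

section \<open>Survival of the open unfrozen cluster\<close>

text \<open>The condition on the root time is built in because it is inherited along the cluster;
  only jointly with it does survival obey a closed recursion.\<close>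

definition alive :: "real \<Rightarrow> nat \<Rightarrow> sample_point \<Rightarrow> bool" where
  "alive t n x \<longleftrightarrow> t < root_time x \<and> reach (tree_marks x) (open_words (tree_marks x) t - tree_frozen x) n []"

lemma pred_alive [measurable]: "Measurable.pred tree_borel (alive t n)"
proof -
  note [measurable] = pred_reach[OF measurable_tree_marks
      pred_open_words[OF measurable_tree_marks _ pred_tree_frozen] words_Nil]
  show ?thesis unfolding alive_def[abs_def] by measurable
qed

definition subtree :: "nat list \<Rightarrow> sample_point \<Rightarrow> sample_point" where
  "subtree j x = (\<lambda>i\<in>words. x (j @ i))"

lemma reach_subtree:
  assumes "j \<in> words"
  shows "reach (tree_marks x) (open_words (tree_marks x) t - tree_frozen x) n j =
    reach (tree_marks (subtree j x)) (open_words (tree_marks (subtree j x)) t - tree_frozen (subtree j x)) n []"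
proof -
  let ?w = "\<lambda>k. tree_marks x (j @ k)"
  have "reach (tree_marks x) (open_words (tree_marks x) t - tree_frozen x) n j =
      reach ?w {k. j @ k \<in> open_words (tree_marks x) t - tree_frozen x} n []"
    using reach_append[of _ _ n j "[]"] by simp
  also have "\<dots> = reach (tree_marks (subtree j x)) (open_words (tree_marks (subtree j x)) t - tree_frozen (subtree j x)) n []"
    using assms by (intro reach_cong) (auto simp: tree_marks_def subtree_def open_words_def tree_frozen_def)
  finally show ?thesis .
qed

lemma subtree_graft:
  assumes "x \<in> space tree_borel" "y \<in> space tree_borel"
  shows "subtree [1] (graft (w, x, y)) = x" "subtree [2] (graft (w, x, y)) = y"
  using assms by (auto simp: graft.simps subtree_def tree_borel_def space_PiM PiE_def extensional_def fun_eq_iff)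

lemma root_time_graft: "root_time (graft (w, x, y)) = combine w (root_time x) (root_time y)"
  by (simp add: graft.simps)

text \<open>A root of type 1 is open and unfrozen if \<open>fst w \<le> t\<close> and
  \<open>fst w < root_time x\<close>; its time is then that of the child. For type 2 both children
  must outlast \<open>t\<close>, although only one of them has to survive.\<close>

lemma alive_graft:
  assumes w: "snd w \<in> {1, 2}" and x: "x \<in> space tree_borel" and y: "y \<in> space tree_borel" and "t \<le> 1"
  shows "alive t (Suc n) (graft (w, x, y)) \<longleftrightarrow>
    (snd w = 1 \<and> fst w \<le> t \<and> alive t n x) \<or>
    (snd w = 2 \<and> t < root_time x \<and> t < root_time y \<and> (alive t n x \<or> alive t n y))"
proof -
  let ?g = "graft (w, x, y)"
  let ?A = "open_words (tree_marks ?g) t - tree_frozen ?g"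
  have root: "tree_marks ?g [] = w" using w by (cases w) (simp add: tree_marks_def graft.simps)
  have frozen: "[] \<in> tree_frozen ?g \<longleftrightarrow> snd w = 1 \<and> root_time x \<le> fst w"
    using root by (simp add: tree_frozen_def graft.simps)
  have child: "reach (tree_marks ?g) ?A n [1] \<longleftrightarrow>
      reach (tree_marks x) (open_words (tree_marks x) t - tree_frozen x) n []"
    "reach (tree_marks ?g) ?A n [2] \<longleftrightarrow>
      reach (tree_marks y) (open_words (tree_marks y) t - tree_frozen y) n []"
    using reach_subtree[of "[1]" ?g t n] reach_subtree[of "[2]" ?g t n] subtree_graft[OF x y, of w]
    by (auto)
  have step: "reach (tree_marks ?g) ?A (Suc n) [] \<longleftrightarrow> [] \<in> ?A \<and>
      (1 \<le> snd w \<and> reach (tree_marks x) (open_words (tree_marks x) t - tree_frozen x) n [] \<or>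
       2 \<le> snd w \<and> reach (tree_marks y) (open_words (tree_marks y) t - tree_frozen y) n [])"
    unfolding child[symmetric] by (simp add: root)
  have mem: "[] \<in> ?A \<longleftrightarrow> (snd w = 1 \<and> fst w \<le> t \<and> fst w < root_time x) \<or> snd w = 2"
    using w frozen root by (auto simp: open_words_def not_le)
  have "alive t (Suc n) ?g \<longleftrightarrow> t < combine w (root_time x) (root_time y) \<and>
      (snd w = 1 \<and> fst w \<le> t \<and> fst w < root_time x \<or> snd w = 2) \<and>
      (1 \<le> snd w \<and> reach (tree_marks x) (open_words (tree_marks x) t - tree_frozen x) n [] \<or>
       2 \<le> snd w \<and> reach (tree_marks y) (open_words (tree_marks y) t - tree_frozen y) n [])"
    by (simp only: alive_def root_time_graft step mem)
  then show ?thesis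
    using w by (auto simp: alive_def combine_def)
qed

lemma measure_fixed_law:
  assumes "fixed_law Q" "A \<in> sets tree_borel"
  shows "measure Q A = measure (mark_law \<Otimes>\<^sub>M (Q \<Otimes>\<^sub>M Q)) (graft -` A \<inter> space (mark_law \<Otimes>\<^sub>M (Q \<Otimes>\<^sub>M Q)))"
proof -
  have [measurable_cong]: "sets Q = sets tree_borel" and inv: "graft_law Q = Q"
    using assms by (auto simp: fixed_law_def)
  have "graft \<in> mark_law \<Otimes>\<^sub>M (Q \<Otimes>\<^sub>M Q) \<rightarrow>\<^sub>M tree_borel" by measurable
  from measure_distr[OF this assms(2)] show ?thesis
    unfolding graft_law_def[symmetric] inv .
qed

lemma cdf_root_law:
  assumes "sets Q = sets tree_borel"
  shows "cdf (root_law Q) t = measure Q {x \<in> space Q. root_time x \<le> t}"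
proof -
  note assms[measurable_cong]
  show ?thesis
    unfolding cdf_def root_law_def by (subst measure_distr) (auto intro!: arg_cong[where f = "measure Q"])
qed

text \<open>Type 1 contributes \<open>t / 2 * p n\<close>. Type 2 contributes the event that both
  children outlast \<open>t\<close>, less the event that neither of them survives, that is
  \<open>((1 - G)\<^sup>2 - (1 - G - p n)\<^sup>2) / 2\<close>. The linear coefficient
  \<open>1 + t / 2 - G\<close> is the mean offspring.\<close>

lemma measure_alive_Suc:
  assumes Q: "fixed_law Q" and t: "0 \<le> t" "t \<le> 1"
  defines "p \<equiv> \<lambda>n. measure Q {x \<in> space Q. alive t n x}" and "G \<equiv> cdf (root_law Q) t"
  shows "p 0 = 1 - G" "p (Suc n) = p n * (1 + t / 2 - G - p n / 2)"
proof -
  have Q': "prob_space Q" "sets Q = sets tree_borel" using Q by (auto simp: fixed_law_def)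
  note [measurable_cong] = Q'(2)
  have spQ: "space Q = space tree_borel" using sets_eq_imp_space_eq[OF Q'(2)] .
  interpret Q: prob_space Q by fact
  let ?P = "mark_law \<Otimes>\<^sub>M (Q \<Otimes>\<^sub>M Q)"
  interpret P: prob_space ?P by (rule prob_space_mark_pair) fact+
  define B where "B n = {x \<in> space Q. alive t n x}" for n
  define C where "C = {x \<in> space Q. t < root_time x}"
  have BC_sets: "B n \<in> sets Q" "C \<in> sets Q" for n
    unfolding B_def C_def by measurable
  have C: "Q.prob C = 1 - G"
  proof -
    have "C = space Q - {x \<in> space Q. root_time x \<le> t}" by (auto simp: C_def)
    moreover have "{x \<in> space Q. root_time x \<le> t} \<in> sets Q" by measurable
    ultimately show ?thesis
      using Q.prob_compl[of "{x \<in> space Q. root_time x \<le> t}"] by (simp only: G_def cdf_root_law[OF Q'(2)])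
  qed
  have "B 0 = C" by (auto simp: B_def C_def alive_def)
  then show "p 0 = 1 - G" using C by (simp add: p_def B_def)
  have BC: "B n \<subseteq> C" by (auto simp: B_def C_def alive_def)
  define U where "U = ({..t} \<times> {1::nat}) \<times> B n \<times> space Q"
  define V where "V = ((UNIV :: real set) \<times> {2::nat}) \<times> C \<times> C"
  define W where "W = ((UNIV :: real set) \<times> {2::nat}) \<times> (C - B n) \<times> (C - B n)"
  have sets: "U \<in> sets ?P" "V \<in> sets ?P" "W \<in> sets ?P"
    unfolding U_def V_def W_def sets_mark_law[symmetric]
    by (intro pair_measureI sets.Diff sets.top BC_sets; simp add: sets_mark_times)+
  have "graft -` B (Suc n) \<inter> space ?P = U \<union> (V - W)"
  proof (rule set_eqI)
    fix p :: "(real \<times> nat) \<times> sample_point \<times> sample_point"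
    obtain a k x y where p: "p = ((a, k), x, y)" by (metis surj_pair)
    have sP: "p \<in> space ?P \<longleftrightarrow> (k = 1 \<or> k = 2) \<and> x \<in> space Q \<and> y \<in> space Q"
      by (auto simp: p space_pair_measure space_mark_law)
    have "graft p \<in> space Q" if "p \<in> space ?P"
      using that measurable_space[of graft ?P tree_borel p] spQ by simp
    then have "p \<in> graft -` B (Suc n) \<inter> space ?P \<longleftrightarrow> p \<in> space ?P \<and> alive t (Suc n) (graft p)"
      by (auto simp: B_def)
    also have "\<dots> \<longleftrightarrow> p \<in> space ?P \<and> (k = 1 \<and> a \<le> t \<and> alive t n x \<or>
        k = 2 \<and> t < root_time x \<and> t < root_time y \<and> (alive t n x \<or> alive t n y))"
      using alive_graft[of "(a, k)" x y t n] sP spQ t by (auto simp: p)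
    also have "\<dots> \<longleftrightarrow> p \<in> U \<union> (V - W)"
      unfolding sP by (auto simp: p U_def V_def W_def B_def C_def)
    finally show "p \<in> graft -` B (Suc n) \<inter> space ?P \<longleftrightarrow> p \<in> U \<union> (V - W)" .
  qed
  then have "p (Suc n) = P.prob (U \<union> (V - W))"
    using measure_fixed_law[OF Q, of "B (Suc n)"] BC_sets(1)[of "Suc n"]
    by (simp add: p_def B_def[symmetric] Q'(2))
  also have "\<dots> = P.prob U + P.prob (V - W)"
  proof (rule P.finite_measure_Union)
    show "U \<inter> (V - W) = {}" by (auto simp: U_def V_def)
  qed (intro sets sets.Diff)+
  also have "P.prob (V - W) = P.prob V - P.prob W"
  proof (rule P.finite_measure_Diff[OF sets(2,3)])
    show "W \<subseteq> V" by (auto simp: V_def W_def)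
  qed
  also have "P.prob U = t / 2 * p n"
  proof -
    have "P.prob U = measure mark_law ({..t} \<times> {1}) * Q.prob (B n) * Q.prob (space Q)"
      unfolding U_def by (intro measure_mark_pair_times Q'(1) sets_mark_times sets.top BC_sets) simp_all
    moreover have "measure mark_law ({..t} \<times> {1}) = t / 2"
      using t by (subst measure_mark_law_le) (auto simp: unit_clamp_def)
    ultimately show ?thesis by (simp add: Q.prob_space p_def B_def)
  qed
  also have "P.prob V = (1 - G)\<^sup>2 / 2"
  proof -
    have "P.prob V = measure mark_law (UNIV \<times> {2}) * Q.prob C * Q.prob C"
      unfolding V_def by (intro measure_mark_pair_times Q'(1) sets_mark_times BC_sets) simp_all
    moreover have "measure mark_law (UNIV \<times> {2}) = 1 / 2" by (rule measure_mark_law_le) simp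
    ultimately show ?thesis by (simp add: C power2_eq_square)
  qed
  also have "P.prob W = (1 - G - p n)\<^sup>2 / 2"
  proof -
    have "Q.prob (C - B n) = Q.prob C - Q.prob (B n)"
      by (rule Q.finite_measure_Diff) (rule BC BC_sets)+
    then have "Q.prob (C - B n) = 1 - G - p n" by (simp add: C p_def B_def)
    moreover have "P.prob W = measure mark_law (UNIV \<times> {2}) * Q.prob (C - B n) * Q.prob (C - B n)"
      unfolding W_def by (intro measure_mark_pair_times Q'(1) sets_mark_times sets.Diff BC_sets) simp_all
    moreover have "measure mark_law (UNIV \<times> {2}) = 1 / 2" by (rule measure_mark_law_le) simp
    ultimately show ?thesis by (simp add: power2_eq_square)
  qed
  also have "t / 2 * q + ((1 - G)\<^sup>2 / 2 - (1 - G - q)\<^sup>2 / 2) = q * (1 + t / 2 - G - q / 2)" for q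
    by (simp add: power2_eq_square algebra_simps diff_divide_distrib add_divide_distrib)
  finally show "p (Suc n) = p n * (1 + t / 2 - G - p n / 2)" .
qed

abbreviation tree_burns :: "real \<Rightarrow> sample_point \<Rightarrow> nat list \<Rightarrow> bool" where
  "tree_burns t x \<equiv> burns (tree_marks x) (tree_frozen x) t"

lemma pred_tree_burns: "i \<in> words \<Longrightarrow> Measurable.pred tree_borel (\<lambda>x. tree_burns t x i)"
  by (intro pred_burns measurable_tree_marks pred_tree_frozen)

text \<open>
  Given that the root time exceeds \<^term>\<open>t\<close>, the open unfrozen cluster of the root is a branching
  process of mean \<^term>\<open>1 + t / 2 - cdf (root_law Q) t\<close>.
\<close>

lemma AE_not_burns:
  assumes Q: "fixed_law Q" and t: "0 \<le> t" "t \<le> 1" and half: "t / 2 \<le> cdf (root_law Q) t"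
  shows "AE x in Q. \<not> (t < root_time x \<and> tree_burns t x [])"
proof -
  have Q': "prob_space Q" "sets Q = sets tree_borel" using Q by (auto simp: fixed_law_def)
  note [measurable_cong] = Q'(2)
  note [measurable] = pred_tree_burns[OF words_Nil]
  interpret Q: prob_space Q by fact
  define p where "p n = Q.prob {x \<in> space Q. alive t n x}" for n
  define e where "e = Q.prob {x \<in> space Q. t < root_time x \<and> tree_burns t x []}"
  have ep: "e \<le> p n" for n
    unfolding e_def p_def
  proof (rule Q.finite_measure_mono)
    show "{x \<in> space Q. t < root_time x \<and> tree_burns t x []} \<subseteq> {x \<in> space Q. alive t n x}"
      by (auto simp: percolates_iff_reach alive_def)
  qed measurable
  have e0: "0 \<le> e" by (simp add: e_def)
  \<comment> \<open>With mean at most 1, each generation loses at least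
    \<open>(p n)\<^sup>2 / 2\<close>, hence \<open>e\<^sup>2 / 2\<close>; this covers the critical
    case too. A positive \<open>e\<close> would eventually make \<open>p n\<close> negative.\<close>
  have dec: "p n \<le> 1 - real n * e\<^sup>2 / 2" for n
  proof (induction n)
    case 0
    show ?case by (simp add: p_def)
  next
    case (Suc n)
    have pn: "0 \<le> p n" using ep[of n] e0 by simp
    have "p (Suc n) = p n * (1 + t / 2 - cdf (root_law Q) t - p n / 2)"
      using measure_alive_Suc(2)[OF Q t] by (simp add: p_def)
    also have "\<dots> \<le> p n * (1 - p n / 2)" using half pn by (intro mult_left_mono) auto
    also have "\<dots> = p n - (p n)\<^sup>2 / 2" by (simp add: power2_eq_square algebra_simps)
    also have "\<dots> \<le> p n - e\<^sup>2 / 2" using ep[of n] e0 by (simp add: power_mono)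
    finally show ?case using Suc.IH by (simp add: field_simps)
  qed
  have "e = 0"
  proof (rule ccontr)
    assume "e \<noteq> 0"
    then obtain n where "1 < real n * (e\<^sup>2 / 2)" using ex_less_of_nat_mult[of "e\<^sup>2 / 2" 1] by auto
    then show False using dec[of n] ep[of n] e0 by simp
  qed
  then have "Q.prob {x \<in> space Q. \<not> (t < root_time x \<and> tree_burns t x [])} = 1"
    using Q.prob_neg[of "\<lambda>x. t < root_time x \<and> tree_burns t x []"] by (simp add: e_def)
  then show ?thesis by (subst (asm) Q.prob_Collect_eq_1) measurable
qed

text \<open>Below \<open>t / 2\<close> the process is supercritical and survives with positive
  probability, against the assumption that burning at \<open>t\<close> forces the root time to be at
  most \<open>t\<close>.\<close>

lemma half_le_cdf:
  assumes Q: "fixed_law Q" and t: "0 \<le> t" "t \<le> 1"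
    and AE: "AE x in Q. tree_burns t x [] \<longrightarrow> root_time x \<le> t"
  shows "t / 2 \<le> cdf (root_law Q) t"
proof (rule ccontr)
  have Q': "prob_space Q" "sets Q = sets tree_borel" using Q by (auto simp: fixed_law_def)
  note [measurable_cong] = Q'(2)
  note [measurable] = pred_tree_burns[OF words_Nil]
  interpret Q: prob_space Q by fact
  define p where "p n = Q.prob {x \<in> space Q. alive t n x}" for n
  define G where "G = cdf (root_law Q) t"
  \<comment> \<open>The number \<open>2 * c\<close> is the positive fixed point of the map from
    \<open>p\<close> to \<open>p * (1 + c - p / 2)\<close> and stays a lower bound in all
    generations.\<close>
  define c where "c = t / 2 - G"
  assume "\<not> t / 2 \<le> cdf (root_law Q) t"
  then have c: "0 < c" by (simp add: c_def G_def)
  have G0: "0 \<le> G" by (simp add: G_def cdf_def)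
  have low: "2 * c \<le> p n" for n
  proof (induction n)
    case 0
    have "p 0 = 1 - G" using measure_alive_Suc(1)[OF Q t] by (simp add: p_def G_def)
    then show ?case using t G0 by (simp add: c_def)
  next
    case (Suc n)
    have "p n \<le> 1" by (simp add: p_def)
    have "p (Suc n) = p n * (1 + c - p n / 2)"
      using measure_alive_Suc(2)[OF Q t] by (simp add: p_def G_def c_def algebra_simps)
    moreover have "p n * (1 + c - p n / 2) - 2 * c = (p n - 2 * c) * (1 - p n / 2)"
      by (simp add: field_simps)
    moreover have "0 \<le> (p n - 2 * c) * (1 - p n / 2)"
      using Suc.IH \<open>p n \<le> 1\<close> by (intro mult_nonneg_nonneg) auto
    ultimately show ?case by simp
  qed
  have "(\<lambda>n. p n) \<longlonglongrightarrow> Q.prob (\<Inter>n. {x \<in> space Q. alive t n x})"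
    unfolding p_def
  proof (rule Q.finite_Lim_measure_decseq)
    show "decseq (\<lambda>n. {x \<in> space Q. alive t n x})"
    proof (intro decseq_SucI subsetI)
      fix n x assume "x \<in> {x \<in> space Q. alive t (Suc n) x}"
      then show "x \<in> {x \<in> space Q. alive t n x}"
        using reach_decreasing unfolding alive_def by blast
    qed
    have "{x \<in> space Q. alive t n x} \<in> sets Q" for n by measurable
    then show "range (\<lambda>n. {x \<in> space Q. alive t n x}) \<subseteq> sets Q" by blast
  qed
  then have "2 * c \<le> Q.prob (\<Inter>n. {x \<in> space Q. alive t n x})"
    using low by (intro LIMSEQ_le_const) auto
  also have "(\<Inter>n. {x \<in> space Q. alive t n x}) = {x \<in> space Q. t < root_time x \<and> tree_burns t x []}"
    by (auto simp: alive_def percolates_iff_reach)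
  also have "Q.prob \<dots> = 0"
  proof (rule Q.prob_eq_0_AE)
    show "AE x in Q. \<not> (t < root_time x \<and> tree_burns t x [])" using AE by eventually_elim auto
  qed
  finally show False using c by simp
qed

section \<open>Rooted subtrees and cylinder events\<close>

lemma finite_boundary: "finite U \<Longrightarrow> finite (boundary U)"
proof -
  assume "finite U"
  have "boundary U \<subseteq> insert [] ((\<lambda>(i, a). i @ [a]) ` (U \<times> {1, 2}))"
  proof
    fix j assume j: "j \<in> boundary U"
    show "j \<in> insert [] ((\<lambda>(i, a). i @ [a]) ` (U \<times> {1, 2}))"
    proof (cases j rule: rev_cases)
      case (snoc i a)
      then have "i @ [a] \<in> words" "i \<in> U" using j by (auto simp: boundary_def split: if_splits)
      then show ?thesis using snoc by auto
    qed simp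
  qed
  with \<open>finite U\<close> show ?thesis by (auto intro: finite_subset)
qed

lemma boundary_subset: "boundary U \<subseteq> words"
  by (auto simp: boundary_def)

lemma boundary_disjoint: "U \<inter> boundary U = {}"
  by (auto simp: boundary_def)

lemma rooted_subtreeD:
  assumes "rooted_subtree U" "i \<in> U"
  shows "i \<in> words" "i \<noteq> [] \<Longrightarrow> butlast i \<in> U"
  using assms by (simp_all add: rooted_subtree_def subset_iff)

lemma rooted_subtree_Nil:
  assumes "rooted_subtree U" "U \<noteq> {}"
  shows "[] \<in> U"
proof -
  have "i \<in> U \<Longrightarrow> [] \<in> U" for i
  proof (induction i rule: rev_induct)
    case (snoc a i)
    then have "butlast (i @ [a]) \<in> U" using rooted_subtreeD(2)[OF assms(1), of "i @ [a]"] by simp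
    with snoc.IH show ?case by simp
  qed
  with assms(2) show ?thesis by blast
qed

lemma rooted_subtree_child:
  assumes "rooted_subtree U"
  shows "rooted_subtree {i. a # i \<in> U}"
  unfolding rooted_subtree_def
proof (intro conjI ballI impI subsetI)
  fix i assume "i \<in> {i. a # i \<in> U}"
  then have i: "a # i \<in> U" by simp
  show "i \<in> words" using rooted_subtreeD(1)[OF assms i] by simp
  show "butlast i \<in> {i. a # i \<in> U}" if "i \<noteq> []" using rooted_subtreeD(2)[OF assms i] that by simp
qed

text \<open>Prepares induction on the size of the subtree. The convention for the boundary of the
  empty set makes the formula valid for a missing child as well, which is then itself a boundary
  word.\<close>

lemma rooted_subtree_decompose:
  assumes "rooted_subtree U" "U \<noteq> {}"
  shows "U = insert [] ((#) 1 ` {i. 1 # i \<in> U} \<union> (#) 2 ` {i. 2 # i \<in> U})"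
    and "boundary U = (#) 1 ` boundary {i. 1 # i \<in> U} \<union> (#) 2 ` boundary {i. 2 # i \<in> U}"
proof -
  have nil: "[] \<in> U" using rooted_subtree_Nil assms .
  have U: "U \<subseteq> words" using assms(1) by (simp add: rooted_subtree_def)
  show "U = insert [] ((#) 1 ` {i. 1 # i \<in> U} \<union> (#) 2 ` {i. 2 # i \<in> U})"
  proof (rule set_eqI)
    fix i
    show "i \<in> U \<longleftrightarrow> i \<in> insert [] ((#) 1 ` {i. 1 # i \<in> U} \<union> (#) 2 ` {i. 2 # i \<in> U})"
    proof (cases i)
      case (Cons a k)
      have "a = 1 \<or> a = 2" if "i \<in> U"
      proof -
        have "a # k \<in> words" using that U Cons by blast
        then show ?thesis by simp
      qed
      then show ?thesis using Cons by auto
    qed (use nil in simp)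
  qed
  have child: "a # i \<in> boundary U \<longleftrightarrow> i \<in> boundary {i. a # i \<in> U}" if "a \<in> {1, 2}" for a i
  proof (cases "i = []")
    case True
    have "{i. a # i \<in> U} = {}" if "[a] \<notin> U"
      using rooted_subtree_Nil[OF rooted_subtree_child[OF assms(1)], of a] that by auto
    then show ?thesis
      using True that nil assms(2) by (auto simp: boundary_def)
  next
    case False
    have "a # i \<in> boundary U \<longleftrightarrow> a # i \<in> words \<and> a # i \<notin> U \<and> a # butlast i \<in> U"
      using assms(2) False by (simp add: boundary_def)
    also have "\<dots> \<longleftrightarrow> i \<in> words \<and> a # i \<notin> U \<and> a # butlast i \<in> U" using that by simp
    also have "\<dots> \<longleftrightarrow> i \<in> boundary {i. a # i \<in> U}"
    proof (cases "{i. a # i \<in> U} = {}")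
      case True
      then have "a # k \<notin> U" for k by blast
      then show ?thesis using False by (simp add: boundary_def)
    next
      case nonempty: False
      show ?thesis unfolding boundary_def if_not_P[OF nonempty] using False by simp
    qed
    finally show ?thesis .
  qed
  show "boundary U = (#) 1 ` boundary {i. 1 # i \<in> U} \<union> (#) 2 ` boundary {i. 2 # i \<in> U}"
  proof (rule set_eqI)
    fix i
    show "i \<in> boundary U \<longleftrightarrow> i \<in> (#) 1 ` boundary {i. 1 # i \<in> U} \<union> (#) 2 ` boundary {i. 2 # i \<in> U}"
    proof (cases i)
      case Nil
      then show ?thesis using nil by (auto simp: boundary_def)
    next
      case (Cons a k)
      have "a = 1 \<or> a = 2" if "i \<in> boundary U"
      proof -
        have "a # k \<in> words" using that boundary_subset[of U] Cons by blast
        then show ?thesis by simp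
      qed
      then show ?thesis using Cons child[of a k] by auto
    qed
  qed
qed

lemma measurable_subtree: "j \<in> words \<Longrightarrow> subtree j \<in> tree_borel \<rightarrow>\<^sub>M tree_borel"
  unfolding subtree_def[abs_def] by (intro measurable_tree_borel measurable_component) auto

lemma subtree_Nil: "x \<in> space tree_borel \<Longrightarrow> subtree [] x = x"
  by (auto simp: subtree_def tree_borel_def space_PiM PiE_def extensional_def fun_eq_iff)

lemma subtree_graft_Cons:
  assumes "j \<in> words"
  shows "subtree (1 # j) (graft (w, x, y)) = subtree j x" "subtree (2 # j) (graft (w, x, y)) = subtree j y"
  using assms by (auto simp: subtree_def graft.simps fun_eq_iff)

lemma tree_marks_graft:
  "snd w \<in> {1, 2} \<Longrightarrow> tree_marks (graft (w, x, y)) [] = w"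
  "i \<in> words \<Longrightarrow> tree_marks (graft (w, x, y)) (1 # i) = tree_marks x i"
  "i \<in> words \<Longrightarrow> tree_marks (graft (w, x, y)) (2 # i) = tree_marks y i"
  by (cases w; simp add: tree_marks_def graft.simps)+

definition cylinder :: "nat list set \<Rightarrow> (nat list \<Rightarrow> (real \<times> nat) set) \<Rightarrow> (nat list \<Rightarrow> sample_point set) \<Rightarrow> sample_point set" where
  "cylinder U A B = {x \<in> space tree_borel. (\<forall>i\<in>U. tree_marks x i \<in> A i) \<and> (\<forall>j\<in>boundary U. subtree j x \<in> B j)}"

lemma sets_cylinder:
  assumes "finite U" "U \<subseteq> words" "\<And>i. i \<in> U \<Longrightarrow> A i \<in> sets mark_space"
    "\<And>j. j \<in> boundary U \<Longrightarrow> B j \<in> sets tree_borel"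
  shows "cylinder U A B \<in> sets tree_borel"
proof -
  have "{x \<in> space tree_borel. tree_marks x i \<in> A i} \<in> sets tree_borel" if i: "i \<in> U" for i
  proof -
    have "i \<in> words" using i assms(2) by blast
    from measurable_sets[OF measurable_tree_marks[OF this] assms(3)[OF i]]
    show ?thesis by (simp add: vimage_def Int_def conj_commute)
  qed
  moreover have "{x \<in> space tree_borel. subtree j x \<in> B j} \<in> sets tree_borel" if j: "j \<in> boundary U" for j
  proof -
    have "j \<in> words" using j boundary_subset[of U] by blast
    from measurable_sets[OF measurable_subtree[OF this] assms(4)[OF j]]
    show ?thesis by (simp add: vimage_def Int_def conj_commute)
  qed
  ultimately show ?thesis
    unfolding cylinder_def using assms(1) finite_boundary[OF assms(1)]
    by (intro sets.sets_Collect_conj sets.sets_Collect_finite_All) simp_all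
qed

text \<open>The preimage of a cylinder under \<open>graft\<close> is the product of a mark event and
  two cylinders on the child subtrees, so invariance factorises the measure by induction on
  \<open>card U\<close>. Stationarity, adaptedness and independence all follow from this one
  formula.\<close>

theorem measure_cylinder:
  assumes Q: "fixed_law Q" and U: "finite U" "rooted_subtree U"
    and A: "\<And>i. i \<in> U \<Longrightarrow> A i \<in> sets mark_space"
    and B: "\<And>j. j \<in> boundary U \<Longrightarrow> B j \<in> sets tree_borel"
  shows "measure Q (cylinder U A B) = (\<Prod>i\<in>U. measure mark_law (A i)) * (\<Prod>j\<in>boundary U. measure Q (B j))"
  using U A B
proof (induction "card U" arbitrary: U A B rule: less_induct)
  case less
  have Q': "prob_space Q" "sets Q = sets tree_borel" using Q by (auto simp: fixed_law_def)
  show ?case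
  proof (cases "U = {}")
    case True
    then have "cylinder U A B = B []"
      using less.prems(4)[of "[]"] sets.sets_into_space[of "B []" tree_borel]
      by (auto simp: cylinder_def boundary_def subtree_Nil)
    then show ?thesis using True by (simp add: boundary_def)
  next
    case False
    note dec = rooted_subtree_decompose[OF less.prems(2) False]
    have nil: "[] \<in> U" using rooted_subtree_Nil[OF less.prems(2) False] .
    define V where "V a = {i. a # i \<in> U}" for a
    have V_img: "(#) a ` V a \<subseteq> U" for a by (auto simp: V_def)
    have fin: "finite (V a)" for a
      using finite_subset[OF V_img less.prems(1)] by (rule finite_imageD) simp
    have rooted: "rooted_subtree (V a)" for a unfolding V_def by (rule rooted_subtree_child) fact
    have Vw: "V a \<subseteq> words" for a using rooted[of a] by (simp add: rooted_subtree_def)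
    have card: "card (V a) < card U" for a
    proof -
      have "card (V a) = card ((#) a ` V a)" by (simp add: card_image)
      also have "(#) a ` V a \<subset> U" using V_img nil by blast
      then have "card ((#) a ` V a) < card U" using less.prems(1) by (rule psubset_card_mono[rotated])
      finally show ?thesis .
    qed
    define E where "E a = cylinder (V a) (\<lambda>i. A (a # i)) (\<lambda>j. B (a # j))" for a
    have dec': "U = insert [] ((#) 1 ` V 1 \<union> (#) 2 ` V 2)" "boundary U = (#) 1 ` boundary (V 1) \<union> (#) 2 ` boundary (V 2)"
      using dec by (simp_all add: V_def)
    have ball_U: "(\<forall>i\<in>U. R i) \<longleftrightarrow> R [] \<and> (\<forall>i\<in>V 1. R (1 # i)) \<and> (\<forall>i\<in>V 2. R (2 # i))" for R
      by (subst dec'(1)) blast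
    have ball_boundary: "(\<forall>j\<in>boundary U. R j) \<longleftrightarrow>
        (\<forall>j\<in>boundary (V 1). R (1 # j)) \<and> (\<forall>j\<in>boundary (V 2). R (2 # j))" for R
      by (subst dec'(2)) blast
    have Aa: "A (a # i) \<in> sets mark_space" if "i \<in> V a" for a i using that less.prems(3) by (simp add: V_def)
    have Ba: "B (a # j) \<in> sets tree_borel" if "j \<in> boundary (V a)" "a \<in> {1, 2}" for a j
      using that less.prems(4) dec'(2) by auto
    have IH: "measure Q (E a) = (\<Prod>i\<in>V a. measure mark_law (A (a # i))) * (\<Prod>j\<in>boundary (V a). measure Q (B (a # j)))"
      if "a \<in> {1, 2}" for a
      unfolding E_def using card fin rooted Aa Ba that by (intro less.hyps) auto
    have E_sets: "E a \<in> sets tree_borel" if "a \<in> {1, 2}" for a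
      unfolding E_def using fin Vw Aa Ba that by (intro sets_cylinder) auto
    have cyl: "cylinder U A B \<in> sets tree_borel"
      using less.prems by (intro sets_cylinder) (auto simp: rooted_subtree_def)
    let ?P = "mark_law \<Otimes>\<^sub>M (Q \<Otimes>\<^sub>M Q)"
    have spQ: "space Q = space tree_borel" using sets_eq_imp_space_eq[OF Q'(2)] .
    have "graft -` cylinder U A B \<inter> space ?P = A [] \<times> E 1 \<times> E 2"
    proof (rule set_eqI)
      fix p :: "(real \<times> nat) \<times> sample_point \<times> sample_point"
      obtain w x y where p: "p = (w, x, y)" by (metis surj_pair)
      have sP: "p \<in> space ?P \<longleftrightarrow> snd w \<in> {1, 2} \<and> x \<in> space tree_borel \<and> y \<in> space tree_borel"
        by (cases w) (auto simp: p space_pair_measure space_mark_law spQ)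
      have Asp: "w \<in> A [] \<Longrightarrow> snd w \<in> {1, 2}"
        using sets.sets_into_space[OF less.prems(3)[OF nil]] by (cases w) (auto simp: space_mark_space)
      have gsp: "graft (w, x, y) \<in> space tree_borel"
        by (auto simp: graft.simps tree_borel_def space_PiM)
      have marks: "(\<forall>i\<in>U. tree_marks (graft (w, x, y)) i \<in> A i) \<longleftrightarrow> w \<in> A [] \<and>
          (\<forall>i\<in>V 1. tree_marks x i \<in> A (1 # i)) \<and> (\<forall>i\<in>V 2. tree_marks y i \<in> A (2 # i))"
        if "snd w \<in> {1, 2}"
      proof -
        have "tree_marks (graft (w, x, y)) (1 # i) = tree_marks x i" if "i \<in> V 1" for i
          using that Vw[of 1] by (intro tree_marks_graft) blast
        moreover have "tree_marks (graft (w, x, y)) (2 # i) = tree_marks y i" if "i \<in> V 2" for i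
          using that Vw[of 2] by (intro tree_marks_graft) blast
        ultimately show ?thesis
          unfolding ball_U tree_marks_graft(1)[OF that] by (simp cong: ball_cong)
      qed
      have "subtree (1 # j) (graft (w, x, y)) = subtree j x" if "j \<in> boundary (V 1)" for j
        using that boundary_subset[of "V 1"] by (intro subtree_graft_Cons) blast
      moreover have "subtree (2 # j) (graft (w, x, y)) = subtree j y" if "j \<in> boundary (V 2)" for j
        using that boundary_subset[of "V 2"] by (intro subtree_graft_Cons) blast
      ultimately have "(\<forall>j\<in>boundary U. subtree j (graft (w, x, y)) \<in> B j) \<longleftrightarrow>
          (\<forall>j\<in>boundary (V 1). subtree j x \<in> B (1 # j)) \<and> (\<forall>j\<in>boundary (V 2). subtree j y \<in> B (2 # j))"
        unfolding ball_boundary by (simp cong: ball_cong)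
      then have "p \<in> graft -` cylinder U A B \<inter> space ?P \<longleftrightarrow> p \<in> space ?P \<and>
          (\<forall>i\<in>U. tree_marks (graft (w, x, y)) i \<in> A i) \<and>
          (\<forall>j\<in>boundary (V 1). subtree j x \<in> B (1 # j)) \<and> (\<forall>j\<in>boundary (V 2). subtree j y \<in> B (2 # j))"
        using gsp by (auto simp: cylinder_def p)
      moreover have "p \<in> A [] \<times> E 1 \<times> E 2 \<longleftrightarrow> w \<in> A [] \<and>
          (x \<in> space tree_borel \<and> (\<forall>i\<in>V 1. tree_marks x i \<in> A (1 # i)) \<and> (\<forall>j\<in>boundary (V 1). subtree j x \<in> B (1 # j))) \<and>
          (y \<in> space tree_borel \<and> (\<forall>i\<in>V 2. tree_marks y i \<in> A (2 # i)) \<and> (\<forall>j\<in>boundary (V 2). subtree j y \<in> B (2 # j)))"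
        by (simp add: p E_def cylinder_def)
      ultimately show "p \<in> graft -` cylinder U A B \<inter> space ?P \<longleftrightarrow> p \<in> A [] \<times> E 1 \<times> E 2"
        using marks Asp sP by argo
    qed
    then have "measure Q (cylinder U A B) = measure ?P (A [] \<times> E 1 \<times> E 2)"
      using measure_fixed_law[OF Q cyl] by simp
    also have "\<dots> = measure mark_law (A []) * measure Q (E 1) * measure Q (E 2)"
      using E_sets less.prems(3)[OF nil] Q' by (intro measure_mark_pair_times) auto
    also have "\<dots> = (\<Prod>i\<in>U. measure mark_law (A i)) * (\<Prod>j\<in>boundary U. measure Q (B j))"
    proof -
      have "(\<Prod>i\<in>U. measure mark_law (A i)) = measure mark_law (A []) *
          ((\<Prod>i\<in>(#) 1 ` V 1. measure mark_law (A i)) * (\<Prod>i\<in>(#) 2 ` V 2. measure mark_law (A i)))"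
        using fin by (subst dec'(1), subst prod.insert) (auto intro!: prod.union_disjoint)
      moreover have "(\<Prod>j\<in>boundary U. measure Q (B j)) =
          (\<Prod>j\<in>(#) 1 ` boundary (V 1). measure Q (B j)) * (\<Prod>j\<in>(#) 2 ` boundary (V 2). measure Q (B j))"
        using fin finite_boundary by (subst dec'(2)) (auto intro!: prod.union_disjoint)
      moreover have "inj_on ((#) a) S" for a :: nat and S by simp
      ultimately show ?thesis by (simp add: IH prod.reindex ac_simps)
    qed
    finally show ?thesis .
  qed
qed

subsection \<open>Independence along a finite subtree\<close>

lemma space_fixed_law: "fixed_law Q \<Longrightarrow> space Q = space tree_borel"
  unfolding fixed_law_def by (auto dest: sets_eq_imp_space_eq)

lemma measure_fixed_law_space: "fixed_law Q \<Longrightarrow> measure Q (space tree_borel) = 1"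
  using space_fixed_law[of Q] prob_space.prob_space[of Q] by (simp add: fixed_law_def)

lemma measure_mark_law_space: "measure mark_law (space mark_space) = 1"
  using prob_space.prob_space[OF prob_space_mark_law] by (simp add: space_mark_law space_mark_space)

lemma distr_root_mark:
  assumes Q: "fixed_law Q"
  shows "distr Q mark_space (\<lambda>x. tree_marks x []) = mark_law"
proof (rule measure_eqI)
  have Q': "prob_space Q" "sets Q = sets tree_borel" using Q by (auto simp: fixed_law_def)
  note [measurable_cong] = Q'(2)
  interpret Q: prob_space Q by fact
  interpret K: prob_space mark_law by (rule prob_space_mark_law)
  fix A assume "A \<in> sets (distr Q mark_space (\<lambda>x. tree_marks x []))"
  then have A: "A \<in> sets mark_space" by simp
  have U: "rooted_subtree {[]}" by (simp add: rooted_subtree_def)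
  have "measure Q (cylinder {[]} (\<lambda>_. A) (\<lambda>_. space tree_borel)) = measure mark_law A"
    using A by (subst measure_cylinder[OF Q _ U]) (simp_all add: measure_fixed_law_space[OF Q])
  moreover have "cylinder {[]} (\<lambda>_. A) (\<lambda>_. space tree_borel) = (\<lambda>x. tree_marks x []) -` A \<inter> space Q"
    using measurable_space[OF measurable_subtree] boundary_subset[of "{[]}"]
    by (auto simp: cylinder_def space_fixed_law[OF Q])
  moreover have "(\<lambda>x. tree_marks x []) \<in> Q \<rightarrow>\<^sub>M mark_space"
    using measurable_tree_marks[of "[]"] by (simp cong: measurable_cong_sets add: Q'(2))
  ultimately show "emeasure (distr Q mark_space (\<lambda>x. tree_marks x [])) A = emeasure mark_law A"
    using A by (simp add: emeasure_distr Q.emeasure_eq_measure K.emeasure_eq_measure)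
qed simp

text \<open>The proper prefixes of \<open>j\<close> form a subtree with \<open>j\<close> on its
  boundary, and in a cylinder that constrains only the subtree at \<open>j\<close> all other factors
  are 1.\<close>

lemma distr_subtree:
  assumes Q: "fixed_law Q" and j: "j \<in> words"
  shows "distr Q tree_borel (subtree j) = Q"
proof (rule measure_eqI)
  have Q': "prob_space Q" "sets Q = sets tree_borel" using Q by (auto simp: fixed_law_def)
  interpret Q: prob_space Q by fact
  fix B assume "B \<in> sets (distr Q tree_borel (subtree j))"
  then have B: "B \<in> sets tree_borel" by simp
  define U where "U = (\<lambda>k. take k j) ` {..<length j}"
  have fin: "finite U" by (simp add: U_def)
  have U: "rooted_subtree U"
    unfolding rooted_subtree_def U_def
  proof (intro conjI subsetI ballI impI)
    fix i assume "i \<in> (\<lambda>k. take k j) ` {..<length j}"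
    then obtain k where k: "i = take k j" "k < length j" by auto
    have "take k j @ drop k j \<in> words" using j by simp
    then show "i \<in> words" unfolding words_append k(1) by blast
    show "butlast i \<in> (\<lambda>k. take k j) ` {..<length j}"
      using k by (auto simp: butlast_take intro!: image_eqI[of _ _ "k - 1"])
  qed
  have jU: "j \<in> boundary U"
  proof (cases "j = []")
    case False
    have "j \<notin> U"
    proof
      assume "j \<in> U"
      then obtain k where k: "j = take k j" "k < length j" by (auto simp: U_def)
      have "length (take k j) = k" using k(2) by simp
      then show False using k by simp
    qed
    moreover have "butlast j \<in> U"
      using False by (auto simp: U_def butlast_conv_take intro!: image_eqI[of _ _ "length j - 1"])
    ultimately show ?thesis using j False by (auto simp: boundary_def)
  qed (simp add: U_def boundary_def)
  define B' where "B' i = (if i = j then B else space tree_borel)" for i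
  have "measure Q (cylinder U (\<lambda>_. space mark_space) B') =
      (\<Prod>i\<in>boundary U. if i = j then measure Q B else 1)"
    using B by (subst measure_cylinder[OF Q fin U])
      (auto simp: B'_def measure_mark_law_space measure_fixed_law_space[OF Q] intro!: prod.cong)
  also have "\<dots> = measure Q B"
    using jU finite_boundary[OF fin] by (simp add: prod.delta)
  also have "cylinder U (\<lambda>_. space mark_space) B' = subtree j -` B \<inter> space Q"
  proof -
    have "tree_marks x i \<in> space mark_space" if "x \<in> space tree_borel" for x i
      by (auto simp: tree_marks_def mark_of_def space_mark_space)
    moreover have "subtree i x \<in> space tree_borel" for x i
      by (auto simp: subtree_def tree_borel_def space_PiM)
    ultimately show ?thesis
      using jU by (auto simp: cylinder_def B'_def space_fixed_law[OF Q] split: if_splits)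
  qed
  finally have "measure Q (subtree j -` B \<inter> space Q) = measure Q B" .
  moreover have "subtree j \<in> Q \<rightarrow>\<^sub>M tree_borel"
    using measurable_subtree[OF j] by (simp cong: measurable_cong_sets add: Q'(2))
  ultimately show "emeasure (distr Q tree_borel (subtree j)) B = emeasure Q B"
    using B by (simp add: emeasure_distr Q.emeasure_eq_measure)
qed (use Q in \<open>simp add: fixed_law_def\<close>)

lemma tree_marks_subtree: "i \<in> words \<Longrightarrow> tree_marks (subtree j x) i = tree_marks x (j @ i)"
  by (simp add: tree_marks_def subtree_def)

lemma distr_tree_marks:
  assumes Q: "fixed_law Q" and i: "i \<in> words"
  shows "distr Q mark_space (\<lambda>x. tree_marks x i) = mark_law"
proof -
  have s: "subtree i \<in> Q \<rightarrow>\<^sub>M tree_borel"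
    using measurable_subtree[OF i] Q by (simp add: fixed_law_def cong: measurable_cong_sets)
  have "(\<lambda>x. tree_marks x i) = (\<lambda>x. tree_marks x []) \<circ> subtree i"
    by (auto simp: tree_marks_subtree)
  then have "distr Q mark_space (\<lambda>x. tree_marks x i) = distr (distr Q tree_borel (subtree i)) mark_space (\<lambda>x. tree_marks x [])"
    using s measurable_tree_marks[of "[]"] by (simp add: distr_distr)
  then show ?thesis using distr_subtree[OF Q i] distr_root_mark[OF Q] by simp
qed

text \<open>Marks inside \<open>U\<close> and subtrees at its boundary form one family over a common
  index set, from which independence within each group and between the groups can be
  extracted.\<close>

definition family_events :: "sample_point measure \<Rightarrow> nat list set \<Rightarrow> nat list \<Rightarrow> sample_point set set" where
  "family_events Q U i = (if i \<in> U then {(\<lambda>x. tree_marks x i) -` A \<inter> space Q | A. A \<in> sets mark_space}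
     else {subtree i -` B \<inter> space Q | B. B \<in> sets tree_borel})"

text \<open>An intersection over the whole index set is a cylinder, and the factors of its measure
  are the probabilities of the single events. Smaller index sets are covered because each family
  contains the whole space.\<close>

lemma indep_family_events:
  assumes Q: "fixed_law Q" and U: "finite U" "rooted_subtree U"
  shows "prob_space.indep_sets Q (family_events Q U) (U \<union> boundary U)"
proof -
  have Q': "prob_space Q" "sets Q = sets tree_borel" using Q by (auto simp: fixed_law_def)
  interpret Q: prob_space Q by fact
  have Uw: "U \<subseteq> words" using U by (simp add: rooted_subtree_def)
  have mm: "(\<lambda>x. tree_marks x i) \<in> Q \<rightarrow>\<^sub>M mark_space" if "i \<in> words" for i
    using measurable_tree_marks[OF that] by (simp cong: measurable_cong_sets add: Q'(2))
  have ms: "subtree j \<in> Q \<rightarrow>\<^sub>M tree_borel" if "j \<in> words" for j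
    using measurable_subtree[OF that] by (simp cong: measurable_cong_sets add: Q'(2))
  have fin: "finite (U \<union> boundary U)" using U finite_boundary by blast
  have ne: "U \<union> boundary U \<noteq> {}" by (cases "U = {}") (auto simp: boundary_def)
  have ev: "family_events Q U i \<subseteq> sets Q" if "i \<in> U \<union> boundary U" for i
  proof -
    have "i \<in> words" using that Uw boundary_subset[of U] by blast
    then show ?thesis
      using measurable_sets[OF mm] measurable_sets[OF ms] by (auto simp: family_events_def)
  qed
  have top: "space Q \<in> family_events Q U i" for i
  proof -
    have "(\<lambda>x. tree_marks x i) -` space mark_space \<inter> space Q = space Q"
      by (auto simp: tree_marks_def mark_of_def space_mark_space)
    moreover have "subtree i -` space tree_borel \<inter> space Q = space Q"
      by (auto simp: subtree_def tree_borel_def space_PiM)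
    ultimately show ?thesis unfolding family_events_def using sets.top by (auto split: if_splits)
  qed
  show ?thesis
  proof (subst Q.indep_sets_finite[OF ne fin ev top], assumption, intro ballI)
    fix X assume X: "X \<in> Pi (U \<union> boundary U) (family_events Q U)"
    have "\<exists>A. A \<in> sets mark_space \<and> X i = (\<lambda>x. tree_marks x i) -` A \<inter> space Q" if "i \<in> U" for i
    proof -
      have "X i \<in> family_events Q U i" using X that by blast
      then show ?thesis using that by (auto simp: family_events_def)
    qed
    then obtain A where A: "\<And>i. i \<in> U \<Longrightarrow> A i \<in> sets mark_space"
        "\<And>i. i \<in> U \<Longrightarrow> X i = (\<lambda>x. tree_marks x i) -` A i \<inter> space Q"
      by metis
    have "\<exists>B. B \<in> sets tree_borel \<and> X j = subtree j -` B \<inter> space Q" if "j \<in> boundary U" for j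
    proof -
      have "X j \<in> family_events Q U j" "j \<notin> U" using X that boundary_disjoint[of U] by blast+
      then show ?thesis by (auto simp: family_events_def)
    qed
    then obtain B where B: "\<And>j. j \<in> boundary U \<Longrightarrow> B j \<in> sets tree_borel"
        "\<And>j. j \<in> boundary U \<Longrightarrow> X j = subtree j -` B j \<inter> space Q"
      by metis
    have "(\<Inter>j\<in>U \<union> boundary U. X j) = cylinder U A B"
      using ne A(2) B(2) by (auto simp: cylinder_def space_fixed_law[OF Q] INT_Un split: if_splits)
    then have "Q.prob (\<Inter>j\<in>U \<union> boundary U. X j) =
        (\<Prod>i\<in>U. measure mark_law (A i)) * (\<Prod>j\<in>boundary U. measure Q (B j))"
      using measure_cylinder[OF Q U A(1) B(1)] by simp
    also have "measure mark_law (A i) = Q.prob (X i)" if "i \<in> U" for i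
    proof -
      have i: "i \<in> words" using that Uw by blast
      show ?thesis
        using measure_distr[OF mm[OF i] A(1)[OF that]] distr_tree_marks[OF Q i] A(2)[OF that] by simp
    qed
    then have "(\<Prod>i\<in>U. measure mark_law (A i)) = (\<Prod>i\<in>U. Q.prob (X i))" by simp
    also have "Q.prob (B j) = Q.prob (X j)" if "j \<in> boundary U" for j
    proof -
      have j: "j \<in> words" using that boundary_subset[of U] by blast
      show ?thesis
        using measure_distr[OF ms[OF j] B(1)[OF that]] distr_subtree[OF Q j] B(2)[OF that] by simp
    qed
    then have "(\<Prod>j\<in>boundary U. measure Q (B j)) = (\<Prod>j\<in>boundary U. Q.prob (X j))" by simp
    also have "(\<Prod>i\<in>U. Q.prob (X i)) * (\<Prod>j\<in>boundary U. Q.prob (X j)) = (\<Prod>j\<in>U \<union> boundary U. Q.prob (X j))"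
      using U(1) finite_boundary[OF U(1)] boundary_disjoint[of U] by (intro prod.union_disjoint[symmetric])
    finally show "Q.prob (\<Inter>j\<in>U \<union> boundary U. X j) = (\<Prod>j\<in>U \<union> boundary U. Q.prob (X j))" .
  qed
qed

lemma Int_stable_vimage: "Int_stable {f -` A \<inter> S |A. A \<in> sets N}"
proof (rule Int_stableI)
  fix a b assume "a \<in> {f -` A \<inter> S |A. A \<in> sets N}" "b \<in> {f -` A \<inter> S |A. A \<in> sets N}"
  then obtain A B where AB: "a = f -` A \<inter> S" "b = f -` B \<inter> S" "A \<in> sets N" "B \<in> sets N"
    by blast
  have "a \<inter> b = f -` (A \<inter> B) \<inter> S" by (auto simp: AB)
  then show "a \<inter> b \<in> {f -` A \<inter> S |A. A \<in> sets N}" using AB(3,4) by blast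
qed

text \<open>A map into a product space is measurable once its coordinates are, here for the
  sigma-algebra generated by the coordinate events.\<close>

lemma vimage_PiM_sigma_sets:
  assumes X: "\<And>x. x \<in> \<Omega> \<Longrightarrow> X x \<in> space (Pi\<^sub>M J N)"
    and E: "\<And>j. j \<in> J \<Longrightarrow> E j \<subseteq> Pow \<Omega>"
    and comp: "\<And>j B. j \<in> J \<Longrightarrow> B \<in> sets (N j) \<Longrightarrow> (\<lambda>x. X x j) -` B \<inter> \<Omega> \<in> E j"
  shows "{X -` C \<inter> \<Omega> | C. C \<in> sets (Pi\<^sub>M J N)} \<subseteq> sigma_sets \<Omega> (\<Union>j\<in>J. E j)"
proof -
  let ?S = "sigma \<Omega> (\<Union>j\<in>J. E j)"
  have sp: "space ?S = \<Omega>" "sets ?S = sigma_sets \<Omega> (\<Union>j\<in>J. E j)"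
    using E by (simp_all add: space_measure_of sets_measure_of UN_subset_iff)
  have "X \<in> ?S \<rightarrow>\<^sub>M Pi\<^sub>M J N"
  proof (rule measurable_PiM_single')
    fix j assume j: "j \<in> J"
    show "(\<lambda>x. X x j) \<in> ?S \<rightarrow>\<^sub>M N j"
    proof (rule measurableI)
      show "X x j \<in> space (N j)" if "x \<in> space ?S" for x
        using X[of x] that j sp(1) by (auto simp: space_PiM)
      show "(\<lambda>x. X x j) -` B \<inter> space ?S \<in> sets ?S" if "B \<in> sets (N j)" for B
        unfolding sp using comp[OF j that] j by blast
    qed
  next
    show "X \<in> space ?S \<rightarrow> (\<Pi>\<^sub>E j\<in>J. space (N j))" using X sp(1) by (auto simp: space_PiM)
  qed
  from measurable_sets[OF this] show ?thesis unfolding sp by blast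
qed

lemma measurable_tree_spaceI:
  assumes "\<And>i. i \<in> words \<Longrightarrow> (\<lambda>x. f x i) \<in> M \<rightarrow>\<^sub>M mark_space"
    "\<And>i. i \<in> words \<Longrightarrow> Measurable.pred M (\<lambda>x. i \<in> F x)"
  shows "(\<lambda>x. (\<lambda>i\<in>words. f x i, \<lambda>i\<in>words. i \<in> F x)) \<in> M \<rightarrow>\<^sub>M tree_space"
  unfolding tree_space_def using assms by (intro measurable_Pair measurable_restrict) auto

abbreviation coordinate_tree where
  "coordinate_tree \<equiv> tree_at (\<lambda>i x. tree_marks x i) tree_frozen"

lemma coordinate_tree_subtree:
  "j \<in> words \<Longrightarrow> coordinate_tree j x = coordinate_tree [] (subtree j x)"
  by (auto simp: tree_at_def fun_eq_iff tree_marks_def tree_frozen_def subtree_def restrict_def)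

lemma measurable_coordinate_tree_Nil: "coordinate_tree [] \<in> tree_borel \<rightarrow>\<^sub>M tree_space"
  unfolding tree_at_def append_Nil
  by (intro measurable_tree_spaceI measurable_tree_marks pred_tree_frozen)

lemma measurable_coordinate_tree:
  assumes "j \<in> words"
  shows "coordinate_tree j \<in> tree_borel \<rightarrow>\<^sub>M tree_space"
proof -
  have "coordinate_tree j = (\<lambda>x. coordinate_tree [] (subtree j x))"
    using coordinate_tree_subtree[OF assms] by (rule ext)
  then show ?thesis
    using measurable_compose[OF measurable_subtree[OF assms] measurable_coordinate_tree_Nil] by simp
qed

context
  fixes Q assumes Q: "fixed_law Q"
begin

interpretation Q: prob_space Q using Q by (simp add: fixed_law_def)

lemma measurable_fixed_law: "f \<in> tree_borel \<rightarrow>\<^sub>M N \<Longrightarrow> f \<in> Q \<rightarrow>\<^sub>M N"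
  using Q by (simp add: fixed_law_def cong: measurable_cong_sets)

lemma iid_tree_marks: "iid_uniform_marks Q (\<lambda>i x. tree_marks x i)"
  unfolding iid_uniform_marks_def
proof (intro conjI ballI Q.prob_space_axioms)
  show "Q.indep_vars (\<lambda>_. mark_space) (\<lambda>i x. tree_marks x i) words"
    unfolding Q.indep_vars_def2
  proof (intro conjI ballI)
    show "(\<lambda>x. tree_marks x i) \<in> Q \<rightarrow>\<^sub>M mark_space" if "i \<in> words" for i
      using measurable_fixed_law[OF measurable_tree_marks[OF that]] .
    show "Q.indep_sets (\<lambda>i. {(\<lambda>x. tree_marks x i) -` A \<inter> space Q |A. A \<in> sets mark_space}) words"
    proof (subst Q.indep_sets_finite_index_sets, intro allI impI)
      fix J :: "nat list set" assume J: "J \<subseteq> words" "finite J"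
      define n where "n = Max (insert 0 (length ` J))"
      \<comment> \<open>Independence of infinitely many marks is a matter of finite sets
        \<open>J\<close>, and each of these lies in a ball of words of bounded length, which is a
        finite rooted subtree.\<close>
      define U where "U = {i \<in> words. length i \<le> n}"
      have "finite U"
        using finite_lists_length_le[of "{1, 2::nat}" n] by (auto simp: U_def words_def lists_eq_set)
      moreover have "rooted_subtree U"
      proof -
        have "butlast i \<in> words" if "i \<in> words" "i \<noteq> []" for i
        proof -
          have "butlast i @ [last i] \<in> words" using that by simp
          then show ?thesis unfolding words_append by blast
        qed
        then show ?thesis by (auto simp: rooted_subtree_def U_def)
      qed
      ultimately have indep: "Q.indep_sets (family_events Q U) (U \<union> boundary U)"
        by (rule indep_family_events[OF Q])
      have "length i \<le> n" if "i \<in> J" for i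
        unfolding n_def using that J(2) by (intro Max_ge) auto
      then have JU: "J \<subseteq> U" using J(1) by (auto simp: U_def)
      show "Q.indep_sets (\<lambda>i. {(\<lambda>x. tree_marks x i) -` A \<inter> space Q |A. A \<in> sets mark_space}) J"
      proof (rule Q.indep_sets_mono[OF indep])
        show "J \<subseteq> U \<union> boundary U" using JU by blast
        fix i assume "i \<in> J"
        then have "i \<in> U" using JU by blast
        then show "{(\<lambda>x. tree_marks x i) -` A \<inter> space Q |A. A \<in> sets mark_space} \<subseteq> family_events Q U i"
          by (simp add: family_events_def)
      qed
    qed
  qed
qed (rule distr_tree_marks[OF Q])

lemma random_words_tree_frozen: "random_words Q tree_frozen"
  unfolding random_words_def
proof (intro conjI ballI)
  show "tree_frozen x \<subseteq> words" for x by (auto simp: tree_frozen_def)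
  show "{x \<in> space Q. i \<in> tree_frozen x} \<in> sets Q" if "i \<in> words" for i
    using measurable_fixed_law[OF pred_tree_frozen[OF that]] by (simp add: pred_def)
qed

lemma stationary_tree: "stationary Q (\<lambda>i x. tree_marks x i) tree_frozen"
proof -
  have "law_at Q (\<lambda>i x. tree_marks x i) tree_frozen j = distr Q tree_space (coordinate_tree [])" if j: "j \<in> words" for j
  proof -
    have "coordinate_tree j = coordinate_tree [] \<circ> subtree j"
      using coordinate_tree_subtree[OF j] by (simp only: fun_eq_iff comp_apply) blast
    then have "law_at Q (\<lambda>i x. tree_marks x i) tree_frozen j = distr Q tree_space (coordinate_tree [] \<circ> subtree j)"
      unfolding law_at_def by (rule arg_cong)
    also have "\<dots> = distr (distr Q tree_borel (subtree j)) tree_space (coordinate_tree [])"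
      using measurable_coordinate_tree_Nil measurable_fixed_law[OF measurable_subtree[OF j]] by (simp add: distr_distr)
    finally show ?thesis using distr_subtree[OF Q j] by simp
  qed
  then show ?thesis unfolding stationary_def by simp
qed

lemma vimage_coordinate_tree:
  assumes "j \<in> boundary U" "B \<in> sets tree_space"
  shows "coordinate_tree j -` B \<inter> space Q \<in> family_events Q U j"
proof -
  have j: "j \<in> words" "j \<notin> U" using assms(1) boundary_subset[of U] boundary_disjoint[of U] by blast+
  have "coordinate_tree [] -` B \<inter> space tree_borel \<in> sets tree_borel"
    by (rule measurable_sets[OF measurable_coordinate_tree_Nil assms(2)])
  moreover have "coordinate_tree j -` B \<inter> space Q = subtree j -` (coordinate_tree [] -` B \<inter> space tree_borel) \<inter> space Q"
    using j(1) measurable_space[OF measurable_subtree[OF j(1)]]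
    by (auto simp: coordinate_tree_subtree[OF j(1)] space_fixed_law[OF Q])
  ultimately show ?thesis using j(2) unfolding family_events_def by (simp only: if_False) blast
qed

lemma respects_tree_fixed_law: "respects_tree Q (\<lambda>i x. tree_marks x i) tree_frozen"
  unfolding respects_tree_def
proof (intro allI impI, elim conjE)
  fix U :: "nat list set" assume U: "finite U" "rooted_subtree U"
  show "Q.indep_vars (\<lambda>_. tree_space) coordinate_tree (boundary U)"
    unfolding Q.indep_vars_def2
  proof (intro conjI ballI)
    show "coordinate_tree j \<in> Q \<rightarrow>\<^sub>M tree_space" if "j \<in> boundary U" for j
      using that boundary_subset[of U] by (intro measurable_fixed_law measurable_coordinate_tree) blast
    show "Q.indep_sets (\<lambda>i. {coordinate_tree i -` A \<inter> space Q |A. A \<in> sets tree_space}) (boundary U)"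
    proof (rule Q.indep_sets_mono[OF indep_family_events[OF Q U]])
      show "{coordinate_tree j -` A \<inter> space Q |A. A \<in> sets tree_space} \<subseteq> family_events Q U j"
        if "j \<in> boundary U" for j
        using vimage_coordinate_tree[OF that] by auto
    qed simp
  qed
qed

lemma adapted_fixed_law: "adapted Q (\<lambda>i x. tree_marks x i) tree_frozen"
  unfolding adapted_def
proof (intro allI impI, elim conjE)
  fix U :: "nat list set" assume U: "finite U" "rooted_subtree U"
  let ?X = "\<lambda>x. \<lambda>j\<in>boundary U. coordinate_tree j x" and ?Y = "\<lambda>x. \<lambda>i\<in>U. tree_marks x i"
  have Uw: "U \<subseteq> words" using U by (simp add: rooted_subtree_def)
  have X: "?X \<in> Q \<rightarrow>\<^sub>M (\<Pi>\<^sub>M j\<in>boundary U. tree_space)"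
    using boundary_subset[of U] by (intro measurable_restrict measurable_fixed_law measurable_coordinate_tree) blast
  have Y: "?Y \<in> Q \<rightarrow>\<^sub>M (\<Pi>\<^sub>M i\<in>U. mark_space)"
    using Uw by (intro measurable_restrict measurable_fixed_law measurable_tree_marks) blast
  have indep: "Q.indep_sets (family_events Q U) (U \<union> boundary U)" by (rule indep_family_events[OF Q U])
  then have pow: "family_events Q U i \<subseteq> Pow (space Q)" if "i \<in> U \<union> boundary U" for i
    using that sets.sets_into_space unfolding Q.indep_sets_def by blast
  have stable: "Int_stable (family_events Q U i)" for i
    by (simp add: family_events_def Int_stable_vimage)
  \<comment> \<open>Boundary events and mark events are grouped by a boolean index; since the
    generators are stable under intersection, independence passes to the generated
    sigma-algebras.\<close>
  have "Q.indep_sets (\<lambda>b. sigma_sets (space Q) (\<Union>i\<in>case_bool (boundary U) U b. family_events Q U i)) UNIV"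
  proof (rule Q.indep_sets_collect_sigma)
    show "Q.indep_sets (family_events Q U) (\<Union>b. case_bool (boundary U) U b)"
      using indep by (simp add: UNIV_bool Un_commute)
    show "disjoint_family_on (case_bool (boundary U) U) UNIV"
      using boundary_disjoint[of U] by (auto simp: disjoint_family_on_def split: bool.splits)
  qed (rule stable)
  moreover have "sigma_sets (space Q) {?X -` A \<inter> space Q |A. A \<in> sets (\<Pi>\<^sub>M j\<in>boundary U. tree_space)} \<subseteq>
      sigma_sets (space Q) (\<Union>j\<in>boundary U. family_events Q U j)"
  proof (rule sigma_sets_mono, rule vimage_PiM_sigma_sets)
    show "?X x \<in> space (\<Pi>\<^sub>M j\<in>boundary U. tree_space)" if "x \<in> space Q" for x
      using measurable_space[OF X that] .
    show "(\<lambda>x. ?X x j) -` B \<inter> space Q \<in> family_events Q U j" if "j \<in> boundary U" "B \<in> sets tree_space" for j B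
      using vimage_coordinate_tree[OF that] that(1) by simp
  qed (use pow in blast)
  moreover have "sigma_sets (space Q) {?Y -` A \<inter> space Q |A. A \<in> sets (\<Pi>\<^sub>M i\<in>U. mark_space)} \<subseteq>
      sigma_sets (space Q) (\<Union>i\<in>U. family_events Q U i)"
  proof (rule sigma_sets_mono, rule vimage_PiM_sigma_sets)
    show "?Y x \<in> space (\<Pi>\<^sub>M i\<in>U. mark_space)" if "x \<in> space Q" for x
      using measurable_space[OF Y that] .
    show "(\<lambda>x. ?Y x i) -` B \<inter> space Q \<in> family_events Q U i" if "i \<in> U" "B \<in> sets mark_space" for i B
      using that by (auto simp: family_events_def)
  qed (use pow in blast)
  ultimately have "Q.indep_set (sigma_sets (space Q) {?X -` A \<inter> space Q |A. A \<in> sets (\<Pi>\<^sub>M j\<in>boundary U. tree_space)})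
      (sigma_sets (space Q) {?Y -` A \<inter> space Q |A. A \<in> sets (\<Pi>\<^sub>M i\<in>U. mark_space)})"
    unfolding Q.indep_set_def by (elim Q.indep_sets_mono_sets) (auto split: bool.splits)
  then show "independent_pair Q (\<Pi>\<^sub>M j\<in>boundary U. tree_space) ?X (\<Pi>\<^sub>M i\<in>U. mark_space) ?Y"
    unfolding independent_pair_def using X Y by blast
qed

end

subsection \<open>Existence\<close>

lemma AE_mark_law: "AE w in mark_law. snd w \<in> {1, 2} \<and> 0 < fst w \<and> fst w \<le> 1"
proof -
  interpret prob_space mark_law by (rule prob_space_mark_law)
  let ?A = "\<lambda>k. {0<..1::real} \<times> {k::nat}"
  have A: "?A k \<in> events" "prob (?A k) = 1 / 2" if "k \<in> {1, 2}" for k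
  proof -
    show "?A k \<in> events" using that sets_mark_times[of "{0<..1}" k] by simp
    have "{0..1} \<inter> {0<..1} = {0<..1::real}" by auto
    then show "prob (?A k) = 1 / 2" using that by (subst measure_mark_law_times) auto
  qed
  have "prob (?A 1 \<union> ?A 2) = prob (?A 1) + prob (?A 2)"
    by (rule finite_measure_Union[OF A(1) A(1)]) auto
  then have "prob (?A 1 \<union> ?A 2) = 1" using A(2)[of 1] A(2)[of 2] by simp
  from AE_prob_1[OF this] show ?thesis by eventually_elim auto
qed

lemma AE_subtree:
  assumes "fixed_law Q" "j \<in> words" "AE x in Q. P x"
  shows "AE x in Q. P (subtree j x)"
proof -
  have "subtree j \<in> Q \<rightarrow>\<^sub>M tree_borel"
    using measurable_fixed_law[OF assms(1) measurable_subtree[OF assms(2)]] .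
  moreover have "AE x in distr Q tree_borel (subtree j). P x"
    using assms(3) unfolding distr_subtree[OF assms(1,2)] .
  ultimately show ?thesis by (rule AE_distrD)
qed

text \<open>The identity holds for every graft onto a root with type 1 or 2, and by invariance
  \<open>Q\<close> is the law of such a graft.\<close>

lemma AE_root_recursion:
  assumes Q: "fixed_law Q"
  shows "AE x in Q. root_time x = combine (tree_marks x []) (snd (snd (x [1]))) (snd (snd (x [2])))"
proof -
  have Q': "prob_space Q" "sets Q = sets tree_borel" "graft_law Q = Q" using Q by (auto simp: fixed_law_def)
  note [measurable_cong] = Q'(2)
  have w: "[1] \<in> words" "[2] \<in> words" by auto
  have gm: "graft \<in> mark_law \<Otimes>\<^sub>M (Q \<Otimes>\<^sub>M Q) \<rightarrow>\<^sub>M tree_borel" by measurable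
  have cm: "(\<lambda>x. combine (tree_marks x []) (snd (snd (x [1]))) (snd (snd (x [2])))) \<in> borel_measurable tree_borel"
    using w by (intro measurable_combine measurable_tree_marks measurable_triple(3) measurable_component[of "\<lambda>x. x"]) auto
  have "{x \<in> space tree_borel. root_time x = combine (tree_marks x []) (snd (snd (x [1]))) (snd (snd (x [2])))} \<in> sets tree_borel"
    by (rule borel_measurable_eq[OF measurable_root_time cm])
  from AE_distr_iff[OF gm this]
  have iff: "(AE x in graft_law Q. root_time x = combine (tree_marks x []) (snd (snd (x [1]))) (snd (snd (x [2])))) \<longleftrightarrow>
      (AE p in mark_law \<Otimes>\<^sub>M (Q \<Otimes>\<^sub>M Q). root_time (graft p) =
        combine (tree_marks (graft p) []) (snd (snd (graft p [1]))) (snd (snd (graft p [2]))))"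
    unfolding graft_law_def .
  have "root_time (graft p) = combine (tree_marks (graft p) []) (snd (snd (graft p [1]))) (snd (snd (graft p [2])))"
    if "p \<in> space (mark_law \<Otimes>\<^sub>M (Q \<Otimes>\<^sub>M Q))" for p
  proof -
    obtain w x y where p: "p = (w, x, y)" by (metis surj_pair)
    have "snd w \<in> {1, 2}" using that by (cases w) (auto simp: p space_pair_measure space_mark_law)
    then show ?thesis by (simp add: p tree_marks_graft(1)) (simp add: graft.simps)
  qed
  then have "AE x in graft_law Q. root_time x = combine (tree_marks x []) (snd (snd (x [1]))) (snd (snd (x [2])))"
    unfolding iff by (rule AE_I2)
  then show ?thesis unfolding Q'(3) .
qed

context freezing_times
begin

text \<open>Between 0 and 2 the complement of the closed set \<open>insert 0 \<Xi>\<close> is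
  covered by countably many rational intervals on which the distribution function is constant, so
  they carry no mass.\<close>

lemma AE_freezing_time:
  assumes G: "frozen_cdf \<Xi> G" and \<rho>: "prob_space \<rho>" "sets \<rho> = sets borel"
    and cdf: "\<And>t. cdf \<rho> t = (if t < 2 then G t else 1)"
  shows "AE y in \<rho>. y \<in> insert 2 \<Xi>"
proof -
  interpret \<rho>: prob_space \<rho> by fact
  interpret R: real_distribution \<rho>
    using \<rho> sets_eq_imp_space_eq[OF \<rho>(2)] by (simp add: real_distribution_def real_distribution_axioms_def)
  have null: "AE y in \<rho>. y \<notin> A" if "measure \<rho> A = 0" "A \<in> sets borel" for A
    using that by (intro AE_not_in) (simp add: null_sets_def \<rho>.emeasure_eq_measure)
  have "AE y in \<rho>. y \<notin> {..0}"
    using cdf[of 0] frozen_cdfD(2)[OF G, of 0] by (intro null) (auto simp: cdf_def)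
  moreover have "AE y in \<rho>. y \<notin> {2<..}"
  proof (rule null)
    have "{2<..} = space \<rho> - {..2}" by auto
    then show "measure \<rho> {2<..} = 0" using \<rho>.prob_compl[of "{..2}"] cdf[of 2] by (simp add: cdf_def)
  qed simp
  moreover have "AE y in \<rho>. \<forall>(p, q)\<in>(\<rat> \<times> \<rat> \<inter> {(p, q). 0 \<le> p \<and> p < q \<and> q < 2 \<and> {p<..q} \<inter> \<Xi> = {}}). y \<notin> {p<..q}"
  proof (subst AE_ball_countable)
    show "countable (\<rat> \<times> \<rat> \<inter> {(p, q). 0 \<le> p \<and> p < q \<and> q < 2 \<and> {p<..q} \<inter> \<Xi> = {}} :: (real \<times> real) set)"
      using countable_rat by (intro countable_Int1 countable_SIGMA)
    have "AE y in \<rho>. y \<notin> {p<..q}" if "0 \<le> p" "p < q" "q < 2" "{p<..q} \<inter> \<Xi> = {}" for p q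
      using that cdf[of p] cdf[of q] frozen_cdfD(6)[OF G, of p q] R.cdf_diff_eq[of p q]
      by (intro null) auto
    then show "\<forall>i\<in>\<rat> \<times> \<rat> \<inter> {(p, q). 0 \<le> p \<and> p < q \<and> q < 2 \<and> {p<..q} \<inter> \<Xi> = {}}.
        AE y in \<rho>. case i of (p, q) \<Rightarrow> y \<notin> {p<..q}" by auto
  qed
  ultimately show ?thesis
  proof eventually_elim
    case (elim y)
    show ?case
    proof (rule ccontr)
      assume y: "y \<notin> insert 2 \<Xi>"
      then have "0 < y" "y < 2" "y \<in> - insert 0 \<Xi>" using elim by auto
      then obtain e where e: "0 < e" "ball y e \<subseteq> - insert 0 \<Xi>"
        using closed by (meson open_Compl open_contains_ball)
      obtain p where p: "p \<in> \<rat>" "max 0 (y - e) < p" "p < y"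
        using Rats_dense_in_real[of "max 0 (y - e)" y] \<open>0 < y\<close> e(1) by auto
      obtain q where q: "q \<in> \<rat>" "y < q" "q < min 2 (y + e)"
        using Rats_dense_in_real[of y "min 2 (y + e)"] \<open>y < 2\<close> e(1) by auto
      have "x \<in> ball y e" if "x \<in> {p<..q}" for x
        using that p q by (auto simp: dist_real_def abs_less_iff)
      then have "{p<..q} \<inter> \<Xi> = {}" using e(2) by blast
      then have "y \<notin> {p<..q}" using elim(3) p q by (auto dest!: bspec[of _ _ "(p, q)"])
      then show False using p q by simp
    qed
  qed
qed

theorem frozen_solution_exists:
  "\<exists>(M :: sample_point measure) \<omega> F.
    frozen_solution \<Xi> M \<omega> F \<and> stationary M \<omega> F \<and> adapted M \<omega> F \<and> respects_tree M \<omega> F"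
proof -
  obtain G where G: "frozen_cdf \<Xi> G" "\<And>x. continuous (at_right x) G" "\<And>x. G x \<le> 1"
    using frozen_cdf_exists[OF unit closed] by blast
  obtain \<rho> where \<rho>: "prob_space \<rho>" "sets \<rho> = sets borel" "combine_law \<rho> = \<rho>"
      "\<And>t. cdf \<rho> t = (if t < 2 then G t else 1)"
    using frozen_cdf_law[OF unit G] by blast
  obtain Q where Q: "fixed_law Q" "root_law Q = \<rho>" using fixed_law_exists[OF \<rho>(1-3)] by blast
  obtain D where D: "countable D" "D \<subseteq> \<Xi>" "\<And>s a. s \<in> \<Xi> \<Longrightarrow> s < a \<Longrightarrow> \<exists>d\<in>D. s \<le> d \<and> d < a"
    using right_dense_times by blast
  have rootm: "root_time \<in> borel_measurable Q" by (rule measurable_fixed_law[OF Q(1) measurable_root_time])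
  have range: "AE x in Q. root_time x \<in> insert 2 \<Xi>"
    using AE_freezing_time[OF G(1) \<rho>(1,2,4)] Q(2) unfolding root_law_def
    by (intro AE_distrD[OF rootm, of "\<lambda>y. y \<in> insert 2 \<Xi>"]) auto
  have mark: "AE x in Q. snd (tree_marks x []) \<in> {1, 2} \<and> fst (tree_marks x []) \<le> 1"
  proof (rule AE_distrD[of "\<lambda>x. tree_marks x []" Q mark_space "\<lambda>w. snd w \<in> {1, 2} \<and> fst w \<le> 1"])
    show "(\<lambda>x. tree_marks x []) \<in> Q \<rightarrow>\<^sub>M mark_space"
      by (rule measurable_fixed_law[OF Q(1) measurable_tree_marks]) simp
    show "AE w in distr Q mark_space (\<lambda>x. tree_marks x []). snd w \<in> {1, 2} \<and> fst w \<le> 1"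
      unfolding distr_root_mark[OF Q(1)] using AE_mark_law by eventually_elim blast
  qed
  \<comment> \<open>The branching estimate has its own null set for each time, so it is used only
    for the countably many times in \<open>D\<close>.\<close>
  have no: "AE x in Q. \<forall>d\<in>D. \<not> (d < root_time x \<and> tree_burns d x [])"
  proof (subst AE_ball_countable[OF D(1)], intro ballI)
    fix d assume "d \<in> D"
    then have d: "d \<in> \<Xi>" "0 \<le> d" "d \<le> 1" using D(2) unit by force+
    have "d / 2 \<le> cdf (root_law Q) d" using frozen_cdfD(5)[OF G(1) d(1)] d(3) by (simp add: Q(2) \<rho>(4))
    from AE_not_burns[OF Q(1) d(2,3) this]
    show "AE x in Q. \<not> (d < root_time x \<and> tree_burns d x [])" .
  qed
  \<comment> \<open>All requirements at a word are phrased for the root of its subtree. Every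
    subtree has law \<open>Q\<close> and there are countably many words, so almost surely they hold
    at all words together.\<close>
  define good where "good x \<longleftrightarrow> root_time x \<in> insert 2 \<Xi> \<and>
      (snd (tree_marks x []) \<in> {1, 2} \<and> fst (tree_marks x []) \<le> 1) \<and>
      (\<forall>d\<in>D. \<not> (d < root_time x \<and> tree_burns d x [])) \<and>
      root_time x = combine (tree_marks x []) (snd (snd (x [1]))) (snd (snd (x [2])))" for x
  have "AE x in Q. good x"
    using range mark no AE_root_recursion[OF Q(1)] by eventually_elim (simp only: good_def)
  then have "AE x in Q. good (subtree i x)" if "i \<in> words" for i
    by (rule AE_subtree[OF Q(1) that])
  then have "AE x in Q. \<forall>i\<in>words. good (subtree i x)"
    by (subst AE_ball_countable) auto
  then have "AE x in Q. frozen_equation \<Xi> (\<lambda>i. tree_marks x i) (tree_frozen x)"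
  proof eventually_elim
    case (elim x)
    have "frozen_equation \<Xi> (tree_marks x) {i \<in> words. snd (tree_marks x i) = 1 \<and> snd (snd (x (i @ [1]))) \<le> fst (tree_marks x i)}"
    proof (rule frozen_equationI[where Y = "\<lambda>i. snd (snd (x i))" and D = D])
      fix i assume i: "i \<in> words"
      have good: "good (subtree i x)" using elim i by blast
      have st: "root_time (subtree i x) = snd (snd (x i))" "tree_marks (subtree i x) [] = tree_marks x i"
          "subtree i x [1] = x (i @ [1])" "subtree i x [2] = x (i @ [2])"
        by (simp_all add: subtree_def tree_marks_def)
      show "snd (tree_marks x i) \<in> {1, 2} \<and> fst (tree_marks x i) \<le> 1" "snd (snd (x i)) \<in> insert 2 \<Xi>"
        "snd (snd (x i)) = combine (tree_marks x i) (snd (snd (x (i @ [1])))) (snd (snd (x (i @ [2]))))"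
        using good unfolding good_def st by blast+
      fix d assume "d \<in> D" "d < snd (snd (x i))"
      then have "\<not> tree_burns d (subtree i x) []" using good unfolding good_def st by blast
      then have "\<not> tree_burns d x i" unfolding percolates_iff_reach reach_subtree[OF i] .
      then show "\<not> burns (tree_marks x) {i \<in> words. snd (tree_marks x i) = 1 \<and> snd (snd (x (i @ [1]))) \<le> fst (tree_marks x i)} d i"
        unfolding tree_frozen_def .
    qed (rule D(3))
    then show ?case by (simp only: tree_frozen_def)
  qed
  then have "frozen_solution \<Xi> Q (\<lambda>i x. tree_marks x i) tree_frozen"
    unfolding frozen_solution_def using iid_tree_marks[OF Q(1)] random_words_tree_frozen[OF Q(1)] by blast
  then show ?thesis
    using stationary_tree[OF Q(1)] adapted_fixed_law[OF Q(1)] respects_tree_fixed_law[OF Q(1)] by blast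
qed

end

subsection \<open>Uniqueness\<close>

lemma reach_shift:
  assumes "\<And>k. k \<in> words \<Longrightarrow> w (j @ k) = w' k \<and> (j @ k \<in> A \<longleftrightarrow> k \<in> A')" "i \<in> words"
  shows "reach w A n (j @ i) = reach w' A' n i"
  unfolding reach_append[of w A n j i] using assms by (intro reach_cong) auto

lemma burning_time_shift:
  assumes "\<And>k. k \<in> words \<Longrightarrow> w (j @ k) = w' k \<and> (j @ k \<in> F \<longleftrightarrow> k \<in> F')" "i \<in> words" "j \<in> words"
  shows "burning_time \<Xi> w F (j @ i) = burning_time \<Xi> w' F' i"
proof -
  have "burns w F t (j @ i) = burns w' F' t i" for t
    unfolding percolates_iff_reach using assms
    by (intro all_cong1 reach_shift) (auto simp: open_words_def)
  then show ?thesis by (simp add: burning_time_def)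
qed

definition expand :: "real set \<Rightarrow> (nat list \<Rightarrow> real \<times> nat) \<times> (nat list \<Rightarrow> bool) \<Rightarrow> sample_point" where
  "expand \<Xi> p = (\<lambda>i\<in>words. (fst (fst p i), real (snd (fst p i)),
     burning_time \<Xi> (fst p) {k \<in> words. snd p k} i))"

lemma expand_tree_at:
  assumes "j \<in> words" "i \<in> words" "F x \<subseteq> words"
  shows "expand \<Xi> (tree_at \<omega> F j x) i = (fst (\<omega> (j @ i) x), real (snd (\<omega> (j @ i) x)),
    burning_time \<Xi> (\<lambda>i. \<omega> i x) (F x) (j @ i))"
proof -
  have "burning_time \<Xi> (\<lambda>i. \<omega> i x) (F x) (j @ i) =
      burning_time \<Xi> (fst (tree_at \<omega> F j x)) {k \<in> words. snd (tree_at \<omega> F j x) k} i"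
    using assms by (intro burning_time_shift) (auto simp: tree_at_def)
  then show ?thesis using assms(2) by (simp add: expand_def) (simp add: tree_at_def)
qed

context freezing_times
begin

text \<open>By monotonicity in time, the sublevel sets below 2 involve only the countably many times
  in \<open>D\<close>; beyond 2 they are the whole space.\<close>

lemma measurable_burning_time:
  assumes w: "\<And>i. i \<in> words \<Longrightarrow> (\<lambda>x. w x i) \<in> M \<rightarrow>\<^sub>M mark_space"
    and F: "\<And>i. i \<in> words \<Longrightarrow> Measurable.pred M (\<lambda>x. i \<in> F x)" and i: "i \<in> words"
  shows "(\<lambda>x. burning_time \<Xi> (w x) (F x) i) \<in> borel_measurable M"
proof (subst borel_measurable_iff_less, intro allI)
  fix a :: real
  obtain D where D: "countable D" "D \<subseteq> \<Xi>" "\<And>s a. s \<in> \<Xi> \<Longrightarrow> s < a \<Longrightarrow> \<exists>d\<in>D. s \<le> d \<and> d < a"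
    using right_dense_times by blast
  show "{x \<in> space M. burning_time \<Xi> (w x) (F x) i < a} \<in> sets M"
  proof (cases "a \<le> 2")
    case True
    have "burning_time \<Xi> (w x) (F x) i < a \<longleftrightarrow> (\<exists>d\<in>D. d < a \<and> burns (w x) (F x) d i)" for x
    proof
      assume "burning_time \<Xi> (w x) (F x) i < a"
      then obtain t where t: "t \<in> \<Xi>" "t < a" "burns (w x) (F x) t i"
        unfolding burning_time_less_iff[OF True] by blast
      then obtain d where "d \<in> D" "t \<le> d" "d < a" using D(3) by blast
      then show "\<exists>d\<in>D. d < a \<and> burns (w x) (F x) d i" using burns_mono[OF \<open>t \<le> d\<close> t(3)] by blast
    next
      assume "\<exists>d\<in>D. d < a \<and> burns (w x) (F x) d i"
      then show "burning_time \<Xi> (w x) (F x) i < a"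
        unfolding burning_time_less_iff[OF True] using D(2) by blast
    qed
    moreover have "{x \<in> space M. d < a \<and> burns (w x) (F x) d i} \<in> sets M" for d
      using pred_burns[OF w F i, where t = d] by (intro sets.sets_Collect_conj) (auto simp: pred_def)
    then have "{x \<in> space M. \<exists>d\<in>D. d < a \<and> burns (w x) (F x) d i} \<in> sets M"
      by (intro sets.sets_Collect_countable_Ex' D(1))
    ultimately show ?thesis by simp
  next
    case False
    have "burning_time \<Xi> (w x) (F x) i < a" for x
      using burning_time_range[of "w x" "F x" i] unit False by force
    then show ?thesis by simp
  qed
qed

lemma measurable_tree_space_component:
  assumes "i \<in> words"
  shows "(\<lambda>p. fst p i) \<in> tree_space \<rightarrow>\<^sub>M mark_space" "Measurable.pred tree_space (\<lambda>p. snd p i)"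
  unfolding tree_space_def
  using measurable_compose[OF measurable_fst measurable_component_singleton[OF assms]]
    measurable_compose[OF measurable_snd measurable_component_singleton[OF assms]] by auto

lemma measurable_expand: "expand \<Xi> \<in> tree_space \<rightarrow>\<^sub>M tree_borel"
  unfolding expand_def[abs_def]
proof (rule measurable_tree_borel)
  fix i assume i: "i \<in> words"
  note [measurable] = measurable_tree_space_component[OF i]
  have [measurable]: "(\<lambda>p. burning_time \<Xi> (fst p) {k \<in> words. snd p k} i) \<in> borel_measurable tree_space"
    by (intro measurable_burning_time i) (auto intro: measurable_tree_space_component)
  have "(\<lambda>p. fst (fst p i)) \<in> borel_measurable tree_space" "(\<lambda>p. real (snd (fst p i))) \<in> borel_measurable tree_space"
    using measurable_compose[OF measurable_tree_space_component(1)[OF i] measurable_mark_fst]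
      measurable_compose[OF measurable_compose[OF measurable_tree_space_component(1)[OF i] measurable_mark_snd_UNIV], of real borel]
    by auto
  then show "(\<lambda>p. (fst (fst p i), real (snd (fst p i)), burning_time \<Xi> (fst p) {k \<in> words. snd p k} i)) \<in> tree_space \<rightarrow>\<^sub>M borel"
    by (intro borel_measurable_Pair) measurable
qed

end

section \<open>The tree law of an arbitrary solution\<close>

locale frozen_percolation = freezing_times \<Xi> for \<Xi> +
  fixes M :: "'a measure" and \<omega> :: "nat list \<Rightarrow> 'a \<Rightarrow> real \<times> nat" and F :: "'a \<Rightarrow> nat list set"
  assumes sol: "frozen_solution \<Xi> M \<omega> F" and stat: "stationary M \<omega> F"
    and adap: "adapted M \<omega> F" and resp: "respects_tree M \<omega> F"
begin

sublocale prob_space M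
  using sol by (simp add: frozen_solution_def iid_uniform_marks_def)

lemma F_words: "x \<in> space M \<Longrightarrow> F x \<subseteq> words"
  using sol by (auto simp: frozen_solution_def random_words_def)

lemma pred_F: "i \<in> words \<Longrightarrow> Measurable.pred M (\<lambda>x. i \<in> F x)"
  using sol by (auto simp: frozen_solution_def random_words_def pred_def)

lemma measurable_mark: "i \<in> words \<Longrightarrow> \<omega> i \<in> M \<rightarrow>\<^sub>M mark_space"
  using sol by (auto simp: frozen_solution_def iid_uniform_marks_def indep_vars_def2)

lemma distr_mark: "i \<in> words \<Longrightarrow> distr M mark_space (\<omega> i) = mark_law"
  using sol by (auto simp: frozen_solution_def iid_uniform_marks_def)

lemma measurable_tree_at: "j \<in> words \<Longrightarrow> tree_at \<omega> F j \<in> M \<rightarrow>\<^sub>M tree_space"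
proof -
  assume j: "j \<in> words"
  have "(\<lambda>x. (\<lambda>i\<in>words. \<omega> (j @ i) x, \<lambda>i\<in>words. i \<in> {i. j @ i \<in> F x})) \<in> M \<rightarrow>\<^sub>M tree_space"
    using j by (intro measurable_tree_spaceI) (auto intro: measurable_mark pred_F)
  then show ?thesis unfolding tree_at_def by simp
qed

abbreviation L where "L \<equiv> joint_law M \<omega> F"

lemma prob_space_L: "prob_space L"
  unfolding law_at_def by (rule prob_space_distr) (rule measurable_tree_at, simp)

lemma sets_L: "sets L = sets tree_space"
  by (simp add: law_at_def)

lemma sets_LL: "sets (L \<Otimes>\<^sub>M L) = sets (tree_space \<Otimes>\<^sub>M tree_space)"
  by (rule sets_pair_measure_cong) (rule sets_L)+

lemma distr_tree_at: "j \<in> words \<Longrightarrow> distr M tree_space (tree_at \<omega> F j) = L"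
  using stat words_Nil unfolding stationary_def law_at_def by blast

lemma boundary_root: "boundary {[]} = {[1], [2]}"
proof (rule set_eqI)
  fix j
  show "j \<in> boundary {[]} \<longleftrightarrow> j \<in> {[1], [2]}"
    by (cases j rule: rev_cases) (auto simp: boundary_def)
qed

lemma rooted_root: "finite {[]} \<and> rooted_subtree {[]}"
  by (simp add: rooted_subtree_def)

text \<open>Respecting the tree structure, applied to the one-word subtree, makes the two children
  independent; stationarity gives both of them the law \<open>L\<close>.\<close>

lemma distr_children:
  "L \<Otimes>\<^sub>M L = distr M (tree_space \<Otimes>\<^sub>M tree_space) (\<lambda>x. (tree_at \<omega> F [1] x, tree_at \<omega> F [2] x))"
proof (rule pair_measure_eqI)
  interpret L: prob_space L by (rule prob_space_L)
  show "sigma_finite_measure L" by (rule L.sigma_finite_measure_axioms)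
  then show "sigma_finite_measure L" .
  have w: "[1] \<in> words" "[2] \<in> words" by auto
  note m = measurable_tree_at[OF w(1)] measurable_tree_at[OF w(2)]
  have "indep_vars (\<lambda>_. tree_space) (tree_at \<omega> F) {[1], [2]}"
    using resp rooted_root unfolding respects_tree_def boundary_root[symmetric] by blast
  then have indep: "indep_sets (\<lambda>i. {tree_at \<omega> F i -` A \<inter> space M |A. A \<in> sets tree_space}) {[1], [2]}"
    unfolding indep_vars_def2 by blast
  fix B C assume "B \<in> sets L" "C \<in> sets L"
  then have BC: "B \<in> sets tree_space" "C \<in> sets tree_space" by (simp_all add: sets_L)
  define X where "X i = tree_at \<omega> F i -` (if i = [1] then B else C) \<inter> space M" for i
  have "prob (\<Inter>i\<in>{[1], [2]}. X i) = (\<Prod>i\<in>{[1], [2]}. prob (X i))"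
    using BC by (intro indep_setsD[OF indep]) (auto simp: X_def)
  then have "prob (X [1] \<inter> X [2]) = prob (X [1]) * prob (X [2])" by simp
  moreover have "(\<lambda>x. (tree_at \<omega> F [1] x, tree_at \<omega> F [2] x)) -` (B \<times> C) \<inter> space M = X [1] \<inter> X [2]"
    by (auto simp: X_def)
  moreover have "emeasure L B = prob (X [1])" "emeasure L C = prob (X [2])"
    using distr_tree_at[OF w(1)] distr_tree_at[OF w(2)] emeasure_distr[OF m(1) BC(1)] emeasure_distr[OF m(2) BC(2)]
    by (simp_all add: X_def emeasure_eq_measure)
  moreover have "emeasure (distr M (tree_space \<Otimes>\<^sub>M tree_space) (\<lambda>x. (tree_at \<omega> F [1] x, tree_at \<omega> F [2] x))) (B \<times> C) =
      emeasure M ((\<lambda>x. (tree_at \<omega> F [1] x, tree_at \<omega> F [2] x)) -` (B \<times> C) \<inter> space M)"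
    using BC m by (intro emeasure_distr measurable_Pair pair_measureI) auto
  ultimately show "emeasure L B * emeasure L C =
      emeasure (distr M (tree_space \<Otimes>\<^sub>M tree_space) (\<lambda>x. (tree_at \<omega> F [1] x, tree_at \<omega> F [2] x))) (B \<times> C)"
    by (simp add: emeasure_eq_measure ennreal_mult)
qed (simp add: sets_LL)

text \<open>Adaptedness for the one-word subtree makes the root mark independent of the pair of
  children.\<close>

lemma distr_root_children:
  "mark_law \<Otimes>\<^sub>M (L \<Otimes>\<^sub>M L) = distr M (mark_space \<Otimes>\<^sub>M (tree_space \<Otimes>\<^sub>M tree_space))
     (\<lambda>x. (\<omega> [] x, tree_at \<omega> F [1] x, tree_at \<omega> F [2] x))" (is "_ = distr M ?S ?T")
proof (rule pair_measure_eqI)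
  interpret L: prob_space L by (rule prob_space_L)
  interpret LL: pair_prob_space L L ..
  interpret K: prob_space mark_law by (rule prob_space_mark_law)
  show "sigma_finite_measure mark_law" by (rule K.sigma_finite_measure_axioms)
  show "sigma_finite_measure (L \<Otimes>\<^sub>M L)" by (rule LL.sigma_finite_measure_axioms)
  show "sets (mark_law \<Otimes>\<^sub>M (L \<Otimes>\<^sub>M L)) = sets (distr M ?S ?T)"
    unfolding sets_distr by (rule sets_pair_measure_cong) (rule sets_mark_law sets_LL)+
  have w: "[1] \<in> words" "[2] \<in> words" by auto
  note m = measurable_tree_at[OF w(1)] measurable_tree_at[OF w(2)] measurable_mark[OF words_Nil]
  have pm: "(\<lambda>x. (tree_at \<omega> F [1] x, tree_at \<omega> F [2] x)) \<in> M \<rightarrow>\<^sub>M tree_space \<Otimes>\<^sub>M tree_space"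
    by (intro measurable_Pair m)
  let ?X = "\<lambda>x. \<lambda>j\<in>{[1], [2]}. tree_at \<omega> F j x" and ?Y = "\<lambda>x. \<lambda>i\<in>{[]}. \<omega> i x"
  have "independent_pair M (\<Pi>\<^sub>M j\<in>{[1], [2]}. tree_space) ?X (\<Pi>\<^sub>M i\<in>{[]}. mark_space) ?Y"
    using adap rooted_root unfolding adapted_def boundary_root[symmetric] by blast
  then have indep: "indep_set (sigma_sets (space M) {?X -` A \<inter> space M |A. A \<in> sets (\<Pi>\<^sub>M j\<in>{[1], [2]}. tree_space)})
      (sigma_sets (space M) {?Y -` A \<inter> space M |A. A \<in> sets (\<Pi>\<^sub>M i\<in>{[]}. mark_space)})"
    unfolding independent_pair_def by blast
  fix A E assume "A \<in> sets mark_law" "E \<in> sets (L \<Otimes>\<^sub>M L)"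
  then have AE: "A \<in> sets mark_space" "E \<in> sets (tree_space \<Otimes>\<^sub>M tree_space)" by (simp_all add: sets_LL)
  \<comment> \<open>Adaptedness is stated for functions on \<open>{[]}\<close> and on the boundary,
    so \<open>a\<close> and \<open>e\<close> have to be recognised as events of these
    functions.\<close>
  define a where "a = \<omega> [] -` A \<inter> space M"
  define e where "e = (\<lambda>x. (tree_at \<omega> F [1] x, tree_at \<omega> F [2] x)) -` E \<inter> space M"
  have "(\<lambda>f. f []) \<in> (\<Pi>\<^sub>M i\<in>{[] :: nat list}. mark_space) \<rightarrow>\<^sub>M mark_space"
    by (rule measurable_component_singleton) simp
  from measurable_sets[OF this AE(1)]
  have "?Y -` ((\<lambda>f. f []) -` A \<inter> space (\<Pi>\<^sub>M i\<in>{[] :: nat list}. mark_space)) \<inter> space M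
      \<in> {?Y -` A \<inter> space M |A. A \<in> sets (\<Pi>\<^sub>M i\<in>{[]}. mark_space)}" by blast
  moreover have "?Y -` ((\<lambda>f. f []) -` A \<inter> space (\<Pi>\<^sub>M i\<in>{[] :: nat list}. mark_space)) \<inter> space M = a"
  proof (rule set_eqI)
    fix x
    have "x \<in> space M \<Longrightarrow> \<omega> [] x \<in> space mark_space" by (rule measurable_space[OF m(3)])
    then show "x \<in> ?Y -` ((\<lambda>f. f []) -` A \<inter> space (\<Pi>\<^sub>M i\<in>{[] :: nat list}. mark_space)) \<inter> space M \<longleftrightarrow> x \<in> a"
      by (auto simp: a_def space_PiM)
  qed
  ultimately have a: "a \<in> sigma_sets (space M) {?Y -` A \<inter> space M |A. A \<in> sets (\<Pi>\<^sub>M i\<in>{[]}. mark_space)}"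
    by (intro sigma_sets.Basic) simp
  have "(\<lambda>f. (f [1], f [2])) \<in> (\<Pi>\<^sub>M j\<in>{[1], [2 :: nat]}. tree_space) \<rightarrow>\<^sub>M tree_space \<Otimes>\<^sub>M tree_space"
    by (intro measurable_Pair measurable_component_singleton) simp_all
  from measurable_sets[OF this AE(2)]
  have "?X -` ((\<lambda>f. (f [1], f [2])) -` E \<inter> space (\<Pi>\<^sub>M j\<in>{[1], [2 :: nat]}. tree_space)) \<inter> space M
      \<in> {?X -` A \<inter> space M |A. A \<in> sets (\<Pi>\<^sub>M j\<in>{[1], [2]}. tree_space)}" by blast
  moreover have "?X -` ((\<lambda>f. (f [1], f [2])) -` E \<inter> space (\<Pi>\<^sub>M j\<in>{[1], [2 :: nat]}. tree_space)) \<inter> space M = e"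
  proof (rule set_eqI)
    fix x
    have "x \<in> space M \<Longrightarrow> ?X x \<in> space (\<Pi>\<^sub>M j\<in>{[1], [2 :: nat]}. tree_space)"
      using measurable_space[OF m(1)] measurable_space[OF m(2)] by (simp add: space_PiM PiE_iff)
    moreover have "?X x [1] = tree_at \<omega> F [1] x" "?X x [2] = tree_at \<omega> F [2] x" by simp_all
    ultimately show "x \<in> ?X -` ((\<lambda>f. (f [1], f [2])) -` E \<inter> space (\<Pi>\<^sub>M j\<in>{[1], [2 :: nat]}. tree_space)) \<inter> space M \<longleftrightarrow> x \<in> e"
      unfolding e_def vimage_def Int_iff mem_Collect_eq by (simp only:) blast
  qed
  ultimately have e: "e \<in> sigma_sets (space M) {?X -` A \<inter> space M |A. A \<in> sets (\<Pi>\<^sub>M j\<in>{[1], [2]}. tree_space)}"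
    by (intro sigma_sets.Basic) simp
  have "prob (e \<inter> a) = prob e * prob a" by (rule indep_setD[OF indep e a])
  moreover have "?T -` (A \<times> E) \<inter> space M = e \<inter> a" by (auto simp: e_def a_def)
  moreover have "emeasure mark_law A = prob a"
    using distr_mark[OF words_Nil] emeasure_distr[OF m(3) AE(1)] by (simp add: a_def emeasure_eq_measure)
  moreover have "emeasure (L \<Otimes>\<^sub>M L) E = prob e"
    unfolding distr_children using emeasure_distr[OF pm AE(2)] by (simp add: e_def emeasure_eq_measure)
  moreover have "emeasure (distr M ?S ?T) (A \<times> E) = emeasure M (?T -` (A \<times> E) \<inter> space M)"
    using AE by (intro emeasure_distr measurable_Pair m pair_measureI)
  ultimately show "emeasure mark_law A * emeasure (L \<Otimes>\<^sub>M L) E = emeasure (distr M ?S ?T) (A \<times> E)"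
    by (simp add: emeasure_eq_measure ennreal_mult mult.commute)
qed

definition burning_tree :: "'a \<Rightarrow> sample_point" where "burning_tree x = expand \<Xi> (tree_at \<omega> F [] x)"

abbreviation burn :: "'a \<Rightarrow> nat list \<Rightarrow> real" where
  "burn x \<equiv> burning_time \<Xi> (\<lambda>i. \<omega> i x) (F x)"

lemma burning_tree_eq: "x \<in> space M \<Longrightarrow> i \<in> words \<Longrightarrow> burning_tree x i = (fst (\<omega> i x), real (snd (\<omega> i x)), burn x i)"
  using expand_tree_at[of "[]" i F x \<Xi> \<omega>] F_words by (simp add: burning_tree_def)

lemma measurable_burning_tree: "burning_tree \<in> M \<rightarrow>\<^sub>M tree_borel"
  unfolding burning_tree_def using measurable_compose[OF measurable_tree_at[OF words_Nil] measurable_expand] .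

lemma AE_equation:
  "AE x in M. \<forall>i\<in>words. (i \<in> F x \<longleftrightarrow> snd (\<omega> i x) = 1 \<and> burn x (i @ [1]) \<le> fst (\<omega> i x)) \<and>
     burn x i = combine (\<omega> i x) (burn x (i @ [1])) (burn x (i @ [2])) \<and> snd (\<omega> i x) \<in> {1, 2}"
proof -
  have "AE x in M. snd (\<omega> i x) \<in> {1, 2} \<and> 0 < fst (\<omega> i x) \<and> fst (\<omega> i x) \<le> 1" if "i \<in> words" for i
    using AE_mark_law unfolding distr_mark[OF that, symmetric] by (rule AE_distrD[OF measurable_mark[OF that]])
  then have "AE x in M. \<forall>i\<in>words. snd (\<omega> i x) \<in> {1, 2} \<and> 0 < fst (\<omega> i x) \<and> fst (\<omega> i x) \<le> 1"
    by (subst AE_ball_countable) auto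
  moreover have "AE x in M. frozen_equation \<Xi> (\<lambda>i. \<omega> i x) (F x)"
    using sol by (simp add: frozen_solution_def)
  ultimately show ?thesis
  proof eventually_elim
    case (elim x)
    then show ?case using burning_time_recursion[of "\<lambda>i. \<omega> i x" "F x"] by blast
  qed
qed

definition tree_law :: "sample_point measure" where "tree_law = distr M tree_borel burning_tree"

lemma prob_space_tree_law: "prob_space tree_law"
  unfolding tree_law_def by (rule prob_space_distr) (rule measurable_burning_tree)

lemma sets_tree_law [simp]: "sets tree_law = sets tree_borel"
  by (simp add: tree_law_def)

lemma tree_law_eq: "tree_law = distr L tree_borel (expand \<Xi>)"
  unfolding tree_law_def law_at_def burning_tree_def
  using measurable_tree_at[OF words_Nil] measurable_expand by (simp add: distr_distr comp_def)

text \<open>The burning times below a child are computed inside its own subtree, so by the recursion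
  the burning tree is almost surely the graft of the two expanded children onto the root mark. The
  law of that triple is \<open>mark_law \<Otimes>\<^sub>M (L \<Otimes>\<^sub>M L)\<close>.\<close>

lemma fixed_law_tree_law: "fixed_law tree_law"
proof -
  have em: "expand \<Xi> \<in> L \<rightarrow>\<^sub>M tree_borel"
    using measurable_expand by (simp add: sets_L cong: measurable_cong_sets)
  have gm: "(\<lambda>(w, x, y). graft (w, expand \<Xi> x, expand \<Xi> y)) \<in>
      mark_space \<Otimes>\<^sub>M (tree_space \<Otimes>\<^sub>M tree_space) \<rightarrow>\<^sub>M tree_borel"
  proof -
    note [measurable] = measurable_expand
    have "(\<lambda>(w, x, y). (w, expand \<Xi> x, expand \<Xi> y)) \<in>
        mark_space \<Otimes>\<^sub>M (tree_space \<Otimes>\<^sub>M tree_space) \<rightarrow>\<^sub>M mark_space \<Otimes>\<^sub>M (tree_borel \<Otimes>\<^sub>M tree_borel)"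
      by measurable
    from measurable_compose[OF this measurable_graft] show ?thesis by (simp add: case_prod_beta)
  qed
  have w: "[1] \<in> words" "[2] \<in> words" by auto
  have tm: "(\<lambda>x. (\<omega> [] x, tree_at \<omega> F [1] x, tree_at \<omega> F [2] x)) \<in> M \<rightarrow>\<^sub>M mark_space \<Otimes>\<^sub>M (tree_space \<Otimes>\<^sub>M tree_space)"
    using w by (intro measurable_Pair measurable_tree_at measurable_mark) auto
  have "graft_law tree_law = distr (mark_law \<Otimes>\<^sub>M (L \<Otimes>\<^sub>M L)) tree_borel (\<lambda>(w, x, y). graft (w, expand \<Xi> x, expand \<Xi> y))"
    unfolding tree_law_eq by (rule graft_law_distr[OF prob_space_L em])
  also have "\<dots> = distr M tree_borel (\<lambda>x. graft (\<omega> [] x, expand \<Xi> (tree_at \<omega> F [1] x), expand \<Xi> (tree_at \<omega> F [2] x)))"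
    unfolding distr_root_children using gm tm by (simp add: distr_distr comp_def)
  also have "\<dots> = distr M tree_borel burning_tree"
  proof (rule distr_cong_AE[OF refl refl])
    show "AE x in M. graft (\<omega> [] x, expand \<Xi> (tree_at \<omega> F [1] x), expand \<Xi> (tree_at \<omega> F [2] x)) = burning_tree x"
      using AE_equation AE_space
    proof eventually_elim
      case (elim x)
      note e = expand_tree_at[of "[1]" _ F x \<Xi> \<omega>, OF w(1) _ F_words[OF elim(2)]]
        expand_tree_at[of "[2]" _ F x \<Xi> \<omega>, OF w(2) _ F_words[OF elim(2)]]
      have rec: "burn x [] = combine (\<omega> [] x) (burn x [1]) (burn x [2])"
        using bspec[OF elim(1) words_Nil] by simp
      show ?case
      proof (rule ext)
        fix i
        show "graft (\<omega> [] x, expand \<Xi> (tree_at \<omega> F [1] x), expand \<Xi> (tree_at \<omega> F [2] x)) i = burning_tree x i"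
        proof (cases "i \<in> words")
          case True
          then show ?thesis
            using e rec burning_tree_eq[OF elim(2) True] by (cases i) (auto simp: graft.simps)
        next
          case False
          then show ?thesis by (simp add: graft.simps burning_tree_def expand_def)
        qed
      qed
    qed
    show "(\<lambda>x. graft (\<omega> [] x, expand \<Xi> (tree_at \<omega> F [1] x), expand \<Xi> (tree_at \<omega> F [2] x))) \<in> M \<rightarrow>\<^sub>M tree_borel"
      using measurable_compose[OF tm gm] by simp
  qed (rule measurable_burning_tree)
  finally show ?thesis unfolding fixed_law_def using prob_space_tree_law by (simp add: tree_law_def)
qed

lemma cdf_tree_law: "cdf (root_law tree_law) t = prob {x \<in> space M. burn x [] \<le> t}"
proof -
  have "cdf (root_law tree_law) t = measure tree_law {x \<in> space tree_law. root_time x \<le> t}"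
    by (rule cdf_root_law) simp
  also have "\<dots> = prob (burning_tree -` {x \<in> space tree_law. root_time x \<le> t} \<inter> space M)"
  proof -
    have "{x \<in> space tree_borel. root_time x \<le> t} \<in> sets tree_borel" by measurable
    then show ?thesis using measurable_burning_tree by (simp add: tree_law_def measure_distr)
  qed
  also have "burning_tree -` {x \<in> space tree_law. root_time x \<le> t} \<inter> space M = {x \<in> space M. burn x [] \<le> t}"
    using measurable_space[OF measurable_burning_tree] burning_tree_eq by (auto simp: tree_law_def)
  finally show ?thesis .
qed

text \<open>Burning times take values in \<open>\<Xi>\<close>, 0 and 2 only, so none falls into a
  gap.\<close>

lemma cdf_tree_law_gap:
  assumes "{u<..t} \<inter> \<Xi> = {}" "0 \<le> u" "u \<le> t" "t < 2"
  shows "cdf (root_law tree_law) u = cdf (root_law tree_law) t"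
proof -
  have "burn x [] \<le> u \<longleftrightarrow> burn x [] \<le> t" for x
  proof -
    have "burn x [] \<in> insert 2 (insert 0 \<Xi>)" by (rule burning_time_range)
    moreover have "burn x [] \<notin> {u<..t} \<inter> \<Xi>" using assms(1) by simp
    ultimately show ?thesis using assms(2-4) by auto
  qed
  then show ?thesis by (simp add: cdf_tree_law)
qed

lemma cdf_tree_law_top: "2 \<le> t \<Longrightarrow> cdf (root_law tree_law) t = 1"
proof -
  assume t: "2 \<le> t"
  have "burn x [] \<le> 2" for x using burning_time_range[of "\<lambda>i. \<omega> i x" "F x" "[]"] unit by force
  then have "{x \<in> space M. burn x [] \<le> t} = space M" using t by (auto intro: order_trans)
  then show ?thesis by (simp add: cdf_tree_law prob_space)
qed

text \<open>Whether a word of type 1 is frozen can be read off from the time of its first child, so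
  passing to the burning tree loses no information about \<open>F\<close>.\<close>

lemma AE_decode: "AE x in M. coordinate_tree [] (burning_tree x) = tree_at \<omega> F [] x \<and> tree_frozen (burning_tree x) = F x"
  using AE_equation AE_space
proof eventually_elim
  case (elim x)
  have marks: "tree_marks (burning_tree x) i = \<omega> i x" if "i \<in> words" for i
    using burning_tree_eq[OF elim(2) that] bspec[OF elim(1) that] by (simp add: tree_marks_def)
  have "i \<in> tree_frozen (burning_tree x) \<longleftrightarrow> i \<in> F x" if "i \<in> words" for i
    using bspec[OF elim(1) that] marks[OF that] burning_tree_eq[OF elim(2), of "i @ [1]"] that by (simp add: tree_frozen_def)
  then have frozen: "tree_frozen (burning_tree x) = F x"
    using F_words[OF elim(2)] by (auto simp: tree_frozen_def)
  then show ?case using marks by (auto simp: tree_at_def fun_eq_iff)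
qed

lemma joint_law_eq: "L = distr tree_law tree_space (coordinate_tree [])"
proof -
  have "distr tree_law tree_space (coordinate_tree []) = distr M tree_space (\<lambda>x. coordinate_tree [] (burning_tree x))"
    unfolding tree_law_def using measurable_burning_tree measurable_coordinate_tree_Nil by (simp add: distr_distr comp_def)
  also have "\<dots> = distr M tree_space (tree_at \<omega> F [])"
  proof (rule distr_cong_AE[OF refl refl])
    show "AE x in M. coordinate_tree [] (burning_tree x) = tree_at \<omega> F [] x"
      using AE_decode by eventually_elim blast
    show "(\<lambda>x. coordinate_tree [] (burning_tree x)) \<in> M \<rightarrow>\<^sub>M tree_space"
      by (rule measurable_compose[OF measurable_burning_tree measurable_coordinate_tree_Nil])
  qed (rule measurable_tree_at, simp)
  finally show ?thesis by (simp add: law_at_def)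
qed

text \<open>A root burning at \<open>t \<in> \<Xi>\<close> has burning time at most \<open>t\<close>
  by definition, so given a later burning time its cluster must die out.\<close>

lemma half_tree_law:
  assumes t: "t \<in> \<Xi>"
  shows "t / 2 \<le> cdf (root_law tree_law) t"
proof (rule half_le_cdf[OF fixed_law_tree_law])
  show "0 \<le> t" "t \<le> 1" using t unit by force+
  have "AE x in M. tree_burns t (burning_tree x) [] \<longrightarrow> root_time (burning_tree x) \<le> t"
    using AE_decode AE_equation AE_space
  proof eventually_elim
    case (elim x)
    have marks: "tree_marks (burning_tree x) i = \<omega> i x" if "i \<in> words" for i
      using burning_tree_eq[OF elim(3) that] bspec[OF elim(2) that] by (simp add: tree_marks_def)
    have "tree_burns t (burning_tree x) [] = burns (\<lambda>i. \<omega> i x) (F x) t []"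
      unfolding percolates_iff_reach using marks elim(1)
      by (intro all_cong1 reach_cong) (auto simp: open_words_def)
    then show ?case using burning_time_le[OF t] burning_tree_eq[OF elim(3) words_Nil] by simp
  qed
  moreover have "{x \<in> space tree_borel. tree_burns t x [] \<longrightarrow> root_time x \<le> t} \<in> sets tree_borel"
  proof -
    note [measurable] = pred_tree_burns[OF words_Nil]
    show ?thesis by measurable
  qed
  ultimately show "AE x in tree_law. tree_burns t x [] \<longrightarrow> root_time x \<le> t"
    unfolding tree_law_def by (subst AE_distr_iff[OF measurable_burning_tree])
qed

lemma prob_space_root_tree_law: "prob_space (root_law tree_law)" "sets (root_law tree_law) = sets borel"
  unfolding root_law_def
  by (rule prob_space.prob_space_distr[OF prob_space_tree_law]) (simp_all add: measurable_root_time cong: measurable_cong_sets)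

lemma combine_law_root_tree_law: "combine_law (root_law tree_law) = root_law tree_law"
  using root_law_graft_law[OF prob_space_tree_law sets_tree_law] fixed_law_tree_law by (simp add: fixed_law_def)

text \<open>Stopping at 1 removes the possible atom at 2, which stands for words that never burn and
  is not a freezing time.\<close>

lemma frozen_cdf_tree_law: "frozen_cdf \<Xi> (\<lambda>t. cdf (root_law tree_law) (min t 1))"
proof -
  let ?G = "cdf (root_law tree_law)"
  interpret R: finite_borel_measure "root_law tree_law"
    using prob_space_root_tree_law by (simp add: finite_borel_measure_def finite_borel_measure_axioms_def prob_space.finite_measure)
  note inv = cdf_combine_invariant[OF prob_space_root_tree_law combine_law_root_tree_law]
  have mono: "?G x \<le> ?G y" if "x \<le> y" for x y using R.cdf_nondecreasing[OF that] .
  show ?thesis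
  proof (rule frozen_cdfI)
    show "?G (min x 1) \<le> ?G (min y 1)" if "x \<le> y" for x y using that by (intro mono) auto
    show "?G (min t 1) = 0" if "t \<le> 0" for t using inv(3)[of t] that by simp
    fix u t :: real assume ut: "0 \<le> u" "u \<le> t"
    consider "t \<le> 1" | "u \<le> 1" "1 < t" | "1 < u" by linarith
    then have "u * (?G (min t 1) - ?G (min u 1)) \<le> (?G (min t 1))\<^sup>2 - (?G (min u 1))\<^sup>2 \<and>
      (?G (min t 1))\<^sup>2 - (?G (min u 1))\<^sup>2 \<le> t * (?G (min t 1) - ?G (min u 1))"
    proof cases
      case 1
      then show ?thesis using inv(1,2)[OF ut] ut by simp
    next
      case 2
      \<comment> \<open>The stopped function no longer grows after 1, so the upper bound with factor
        1 implies the one with factor \<open>t\<close>.\<close>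
      have "1 * (?G 1 - ?G u) \<le> t * (?G 1 - ?G u)" using 2 mono[of u 1] by (intro mult_right_mono) auto
      then show ?thesis using inv(1,2)[OF ut(1) 2(1)] 2 by simp
    next
      case 3
      then show ?thesis using ut by simp
    qed
    then show "u * (?G (min t 1) - ?G (min u 1)) \<le> (?G (min t 1))\<^sup>2 - (?G (min u 1))\<^sup>2"
      "(?G (min t 1))\<^sup>2 - (?G (min u 1))\<^sup>2 \<le> t * (?G (min t 1) - ?G (min u 1))" by auto
    show "?G (min u 1) = ?G (min t 1)" if "{u<..t} \<inter> \<Xi> = {}"
    proof (rule cdf_tree_law_gap)
      have "{min u 1<..min t 1} \<subseteq> {u<..t}" by (auto simp: min_def split: if_splits)
      then show "{min u 1<..min t 1} \<inter> \<Xi> = {}" using that by blast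
    qed (use ut in auto)
  next
    show "t / 2 \<le> ?G (min t 1)" if "t \<in> \<Xi>" for t
    proof -
      have "min t 1 = t" using that unit by force
      then show ?thesis using half_tree_law[OF that] by simp
    qed
  qed
qed

lemma cdf_root_tree_law:
  "cdf (root_law tree_law) t = (if t < 2 then cdf (root_law tree_law) (min t 1) else 1)"
proof -
  have "{1<..t} \<inter> \<Xi> = {}" using unit by force
  then show ?thesis using cdf_tree_law_gap[of 1 t] cdf_tree_law_top[of t] by (auto simp: min_def)
qed

end

text \<open>The stopped distribution functions agree by \<open>frozen_cdf_unique\<close>, which
  fixes the root law and with it the invariant tree law; both joint laws are images of that law
  under the same decoding.\<close>

theorem (in freezing_times) joint_law_unique:
  assumes 1: "frozen_percolation \<Xi> M \<omega> F" and 2: "frozen_percolation \<Xi> N \<omega>' F'"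
  shows "joint_law M \<omega> F = joint_law N \<omega>' F'"
proof -
  interpret A: frozen_percolation \<Xi> M \<omega> F by fact
  interpret B: frozen_percolation \<Xi> N \<omega>' F' by fact
  have eq: "cdf (root_law A.tree_law) (min t 1) = cdf (root_law B.tree_law) (min t 1)" for t
  proof (cases "0 \<le> t")
    case True
    then show ?thesis using frozen_cdf_unique[OF unit closed A.frozen_cdf_tree_law B.frozen_cdf_tree_law] by blast
  next
    case False
    then show ?thesis using frozen_cdfD(2)[OF A.frozen_cdf_tree_law, of t] frozen_cdfD(2)[OF B.frozen_cdf_tree_law, of t] by simp
  qed
  have "root_law A.tree_law = root_law B.tree_law"
  proof (rule cdf_unique')
    show "finite_borel_measure (root_law A.tree_law)" "finite_borel_measure (root_law B.tree_law)"
      using A.prob_space_root_tree_law B.prob_space_root_tree_law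
      by (simp_all add: finite_borel_measure_def finite_borel_measure_axioms_def prob_space.finite_measure)
    show "cdf (root_law A.tree_law) = cdf (root_law B.tree_law)"
      using A.cdf_root_tree_law B.cdf_root_tree_law eq by (intro ext) metis
  qed
  then have "A.tree_law = B.tree_law" by (rule fixed_law_unique[OF A.fixed_law_tree_law B.fixed_law_tree_law])
  then show ?thesis using A.joint_law_eq B.joint_law_eq by simp
qed

theorem theorem1:
  fixes \<Xi> :: "real set"
  assumes "\<Xi> \<subseteq> {0<..1}" and "closedin (top_of_set {0<..1}) \<Xi>"
  shows "(\<exists>(M :: sample_point measure) \<omega> F.
            frozen_solution \<Xi> M \<omega> F \<and> stationary M \<omega> F \<and> adapted M \<omega> F \<and> respects_tree M \<omega> F) \<and>
         (\<forall>(M :: 'a measure) \<omega> F (N :: 'b measure) \<omega>' F'.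
            frozen_solution \<Xi> M \<omega> F \<and> stationary M \<omega> F \<and> adapted M \<omega> F \<and> respects_tree M \<omega> F \<longrightarrow>
            frozen_solution \<Xi> N \<omega>' F' \<and> stationary N \<omega>' F' \<and> adapted N \<omega>' F' \<and> respects_tree N \<omega>' F' \<longrightarrow>
            joint_law M \<omega> F = joint_law N \<omega>' F')"
proof -
  interpret freezing_times \<Xi>
    using assms closed_insert_zero by unfold_locales
  show ?thesis
  proof (intro conjI frozen_solution_exists allI impI)
    fix M :: "'a measure" and \<omega> F and N :: "'b measure" and \<omega>' F'
    assume "frozen_solution \<Xi> M \<omega> F \<and> stationary M \<omega> F \<and> adapted M \<omega> F \<and> respects_tree M \<omega> F"
      "frozen_solution \<Xi> N \<omega>' F' \<and> stationary N \<omega>' F' \<and> adapted N \<omega>' F' \<and> respects_tree N \<omega>' F'"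
    then have "frozen_percolation \<Xi> M \<omega> F" "frozen_percolation \<Xi> N \<omega>' F'"
      by (unfold_locales; blast)+
    then show "joint_law M \<omega> F = joint_law N \<omega>' F'" by (rule joint_law_unique)
  qed
qed

end
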